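(* Let $A,B\in\mathbb{Z}$ with $AB\neq 0$. (1) There exist two infinite single-parameter families, $\mathcal{F}_1$ and $\mathcal{F}_2$, of monogenic cyclic cubic trinomials of the form $x^3+Ax+B$, such that $\mathcal{F}_1\cap\mathcal{F}_2=\varnothing$ and no two elements of $\mathcal{F}_1\cup\mathcal{F}_2$ are equivalent. (2) There are exactly four monogenic cyclic trinomials of the form $x^3+Ax^2+B$: $$x^3+3x^2-3,\quad x^3-3x^2+3,\quad x^3-3x^2+1,\quad x^3+3x^2-1;$$ and they are all equivalent to $T(x)=x^3-3x+1\in\mathcal{F}_1$, where $\mathcal{F}_1$ is the family in (1).
   Context: A monic polynomial $f(x)\in\mathbb{Z}[x]$ of degree $n$ that is irreducible over $\mathbb{Q}$ is called cyclic if its Galois group over $\mathbb{Q}$ is the cyclic group of order $n$. It is called monogenic if $\{1,\theta,\theta^2,\ldots,\theta^{n-1}\}$ is a basis for the ring of integers of $\mathbb{Q}(\theta)$, where $f(\theta)=0$. Two monogenic cyclic cubic trinomials are called equivalent if their splitting fields are equal; otherwise they are called distinct. Trivially, a monogenic cyclic cubic trinomial is equivalent to itself. *)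

theory Defs
  imports
    "HOL-Algebra.Algebraic_Closure_Type"
    "HOL-Algebra.Elementary_Groups"
    "HOL-Algebra.Generated_Fields"
    "HOL-Algebra.Bij"
begin

text \<open>
  All number fields are taken inside the complex numbers. Session \<open>HOL-Algebra\<close> reuses several
  names of \<open>HOL-Computational_Algebra\<close> and \<open>HOL.Modules\<close>, hence the qualified constants below.
\<close>

abbreviation complex_field :: "complex ring" where
  "complex_field \<equiv> ring_of_type_algebra"

definition adjoin_rat :: "complex set \<Rightarrow> complex set" where
  "adjoin_rat S = generate_field complex_field (\<rat> \<union> S)"

definition complex_roots :: "int poly \<Rightarrow> complex set" where
  "complex_roots f = {z. poly (map_poly of_int f) z = 0}"

definition splitting_field :: "int poly \<Rightarrow> complex set" where
  "splitting_field f = adjoin_rat (complex_roots f)"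

text \<open>
  The group of field automorphisms of \<open>K\<close> that fix the rationals pointwise, under composition.
  As in \<^const>\<open>BijGroup\<close>, automorphisms are extensional functions, so that each is counted once.
\<close>

definition galois_group :: "complex set \<Rightarrow> (complex \<Rightarrow> complex) monoid" where
  "galois_group K = (BijGroup K)
     \<lparr>carrier := {\<sigma> \<in> Bij K.
        \<sigma> \<in> ring_iso (complex_field\<lparr>carrier := K\<rparr>) (complex_field\<lparr>carrier := K\<rparr>)
        \<and> (\<forall>q\<in>\<rat>. \<sigma> q = q)}\<rparr>"

definition monic_irreducible :: "int poly \<Rightarrow> bool" where
  "monic_irreducible f \<longleftrightarrow>
     lead_coeff f = 1 \<and> Factorial_Ring.irreducible (map_poly of_int f :: rat poly)"

definition cyclic_poly :: "int poly \<Rightarrow> bool" where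
  "cyclic_poly f \<longleftrightarrow> monic_irreducible f
     \<and> cyclic_group (galois_group (splitting_field f))
     \<and> Coset.order (galois_group (splitting_field f)) = Polynomial.degree f"

definition ring_of_integers :: "complex set \<Rightarrow> complex set" where
  "ring_of_integers K = {\<alpha> \<in> K. algebraic_int \<alpha>}"

abbreviation int_scale :: "int \<Rightarrow> complex \<Rightarrow> complex" where
  "int_scale c z \<equiv> of_int c * z"

definition is_int_basis :: "complex set \<Rightarrow> complex set \<Rightarrow> bool" where
  "is_int_basis B M \<longleftrightarrow>
     \<not> Modules.module.dependent int_scale B \<and> Modules.module.span int_scale B = M"

text \<open>
  The choice of root is immaterial, the roots of an irreducible polynomial being conjugate;
  the definition quantifies over all of them.
\<close>

definition monogenic :: "int poly \<Rightarrow> bool" where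
  "monogenic f \<longleftrightarrow> monic_irreducible f
     \<and> (\<forall>\<theta>\<in>complex_roots f.
          is_int_basis {\<theta> ^ i | i. i < Polynomial.degree f} (ring_of_integers (adjoin_rat {\<theta>})))"

definition equivalent :: "int poly \<Rightarrow> int poly \<Rightarrow> bool" where
  "equivalent f g \<longleftrightarrow> splitting_field f = splitting_field g"

text \<open>
  \<open>linear_trinomial A B\<close> is \<open>x^3 + A x + B\<close> and \<open>quadratic_trinomial A B\<close> is \<open>x^3 + A x^2 + B\<close>
  (coefficient lists start with the constant term).
\<close>

definition linear_trinomial :: "int \<Rightarrow> int \<Rightarrow> int poly" where
  "linear_trinomial A B = [:B, A, 0, 1:]"

definition quadratic_trinomial :: "int \<Rightarrow> int \<Rightarrow> int poly" where
  "quadratic_trinomial A B = [:B, 0, A, 1:]"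

text \<open>
  In a single-parameter family of trinomials \<open>x^3 + A x + B\<close> the coefficients \<open>A\<close> and \<open>B\<close> are
  fixed integer polynomials in one integer parameter \<open>k\<close>, which ranges over a set \<open>S\<close> of admissible
  values. (Allowing arbitrary functions of \<open>k\<close> would make this vacuous, by countability.)
\<close>

definition single_parameter_family :: "int poly set \<Rightarrow> bool" where
  "single_parameter_family F \<longleftrightarrow>
     (\<exists>a b :: int poly. \<exists>S :: int set. F = (\<lambda>k. linear_trinomial (poly a k) (poly b k)) ` S)"

end

theory Submission
  imports Defs "Jordan_Normal_Form.Char_Poly" "HOL-Number_Theory.Residues"
begin

text \<open>
  The first family consists of the polynomials \<open>x\<^sup>3 - 3 g x + g (2 k + 1)\<close>, where \<open>g = k\<^sup>2 + k + 1\<close> is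
  squarefree and prime to 3, with discriminant \<open>(9 g)\<^sup>2\<close>; the second one of
  \<open>x\<^sup>3 - g x + g (2 k + 1)\<close>, where \<open>g = 27 k\<^sup>2 + 27 k + 7\<close> is squarefree, with discriminant \<open>g\<^sup>2\<close>.
  A square discriminant makes an irreducible cubic cyclic. At every prime dividing the discriminant a
  translate of the polynomial is Eisenstein, which makes it monogenic. For monogenic cyclic
  polynomials the discriminant is an invariant of the splitting field, and it separates the members
  of the two families. An elementary sieve shows that both values of \<open>g\<close> are squarefree
  infinitely often.

  For a monogenic cyclic \<open>x\<^sup>3 + A x\<^sup>2 + B\<close> the discriminant \<open>- B (4 A\<^sup>3 + 27 B)\<close> is a square, and
  Dedekind's criterion limits its prime factors: \<open>B\<close> is squarefree and divides \<open>A\<close>, and with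
  \<open>A = - B n\<close> one gets \<open>4 B\<^sup>2 n\<^sup>3 = 27 + 9\<^sup>j\<close>. Dedekind's criterion at 3 excludes \<open>j \<ge> 3\<close>.
\<close>

section \<open>Algebraic integers\<close>

text \<open>The families come from one observation: x^3 - 3 g x + g b has discriminant 27 g^2 (4 g -
  b^2), and x^3 - g x + g b has g^2 (4 g - 27 b^2). Both are squares once 4 g - b^2 = 3,
  respectively 4 g - 27 b^2 = 1, and b = 2 k + 1 makes either equation solvable for an integer g.
  Monogenicity is tested without ideals: an integer of Q(r) is (x + y r + z r^2) / N with integer x,
  y, z, and it suffices that every prime factor of N cancels. Traces, norms and conjugates enter as
  symmetric expressions in three explicit complex roots, and statements pass from one root to
  another through divisibility by the minimal polynomial. The sieve is the tight spot. The values of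
  the second g below N reach 27 N^2, so squares of primes up to about 5.2 N may divide them, and
  even one value of k lost per odd number in that range would exceed N. Only primes p = 1 mod 6
  occur, which brings the loss down to 19/20 of N, up to lower order terms. For the classification,
  cyclicity enters only through the order 3 of the Galois group, which forces a square
  discriminant.\<close>

lemma algebraic_int_eigenvalue:
  fixes z :: complex
  assumes fin: "finite V" and nz: "\<exists>v\<in>V. v \<noteq> 0"
    and rel: "\<And>v. v \<in> V \<Longrightarrow> \<exists>c :: complex \<Rightarrow> int. z * v = (\<Sum>w\<in>V. of_int (c w) * w)"
  shows "algebraic_int z"
proof -
  obtain vs where vs: "set vs = V" "distinct vs"
    using finite_distinct_list[OF fin] by blast
  define n where "n = length vs"
  obtain C :: "complex \<Rightarrow> complex \<Rightarrow> int"
    where C: "\<And>v. v \<in> V \<Longrightarrow> z * v = (\<Sum>w\<in>V. of_int (C v w) * w)"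
    using rel by metis
  define A :: "int mat" where "A = mat n n (\<lambda>(i,j). C (vs ! i) (vs ! j))"
  define x :: "complex vec" where "x = vec n (\<lambda>i. vs ! i)"
  have A: "A \<in> carrier_mat n n" by (simp add: A_def)
  let ?A = "map_mat of_int A :: complex mat"
  have Ac: "?A \<in> carrier_mat n n" using A by simp
  \<comment> \<open>Determinant trick: listing \<open>V\<close> as a vector turns the relations into
    an eigenvector equation for an integer matrix, so \<open>z\<close> is a root of a monic integer
    characteristic polynomial. The nonzero element of \<open>V\<close> makes the vector
    nonzero.\<close>
  have "?A *\<^sub>v x = z \<cdot>\<^sub>v x"
  proof (rule eq_vecI)
    fix i assume i: "i < dim_vec (z \<cdot>\<^sub>v x)"
    then have i: "i < n" by (simp add: x_def)
    then have "vs ! i \<in> V" using vs n_def by force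
    then have "z * vs ! i = (\<Sum>w\<in>V. of_int (C (vs ! i) w) * w)" using C by blast
    also have "\<dots> = (\<Sum>j\<in>{0..<n}. of_int (C (vs ! i) (vs ! j)) * vs ! j)"
      unfolding vs(1)[symmetric] n_def
      by (subst sum.reindex_bij_betw[symmetric, OF bij_betw_nth[OF vs(2), of "{0..<length vs}" "set vs"]])
        (auto simp: atLeast0LessThan)
    finally show "(?A *\<^sub>v x) $ i = (z \<cdot>\<^sub>v x) $ i"
      using i by (simp add: A_def x_def scalar_prod_def)
  qed (simp_all add: A_def x_def)
  moreover have "x \<noteq> 0\<^sub>v n"
  proof
    assume eq: "x = 0\<^sub>v n"
    obtain v where "v \<in> V" "v \<noteq> 0" using nz by blast
    then obtain i where "i < n" "vs ! i = v" using vs n_def by (metis in_set_conv_nth)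
    then have "x $ i = v" by (simp add: x_def)
    with eq \<open>i < n\<close> \<open>v \<noteq> 0\<close> show False by simp
  qed
  ultimately have "eigenvalue ?A z"
    unfolding eigenvalue_def eigenvector_def using A by (intro exI[of _ x]) (simp add: x_def)
  then have root: "poly (char_poly ?A) z = 0"
    using eigenvalue_root_char_poly[OF Ac] by blast
  have "lead_coeff (char_poly A) = 1"
    using degree_monic_char_poly[OF A] by simp
  moreover have "poly (map_poly of_int (char_poly A)) z = 0"
    using root of_int_hom.char_poly_hom[OF A, where 'a = complex] by simp
  ultimately show ?thesis
    unfolding algebraic_int_altdef_ipoly by blast
qed

interpretation int_module: Modules.module int_scale
  by unfold_locales (auto simp: algebra_simps)

text \<open>The products x^i y^j with exponents below the degrees of the monic equations span a
  finitely generated module over the integers. Both \<open>x\<close> and \<open>y\<close> map it to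
  itself, hence so do their sum and product, and the eigenvalue argument applies.\<close>

lemma algebraic_int_closed:
  fixes x y :: complex
  assumes "algebraic_int x" "algebraic_int y"
  shows algebraic_int_plus: "algebraic_int (x + y)"
    and algebraic_int_times: "algebraic_int (x * y)"
proof -
  obtain p :: "int poly" where p: "poly (map_poly of_int p) x = 0" "lead_coeff p = 1"
    using assms(1) unfolding algebraic_int_altdef_ipoly by blast
  obtain q :: "int poly" where q: "poly (map_poly of_int q) y = 0" "lead_coeff q = 1"
    using assms(2) unfolding algebraic_int_altdef_ipoly by blast
  define n where "n = Polynomial.degree p"
  define m where "m = Polynomial.degree q"
  have np: "n > 0"
  proof (rule ccontr)
    assume "\<not> n > 0"
    then obtain a where "p = [:a:]" unfolding n_def using degree_eq_zeroE by blast
    with p show False by simp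
  qed
  have mp: "m > 0"
  proof (rule ccontr)
    assume "\<not> m > 0"
    then obtain a where "q = [:a:]" unfolding m_def using degree_eq_zeroE by blast
    with q show False by simp
  qed
  have powers: "z ^ Polynomial.degree g = (\<Sum>i<Polynomial.degree g. of_int (- Polynomial.coeff g i) * z ^ i)"
    if "poly (map_poly of_int g) z = 0" "lead_coeff g = 1" for z :: complex and g
  proof -
    have "(\<Sum>i\<le>Polynomial.degree g. of_int (Polynomial.coeff g i) * z ^ i) = 0"
      using that(1) by (simp add: poly_altdef coeff_map_poly degree_map_poly)
    then show ?thesis
      using that(2) unfolding lessThan_Suc_atMost[symmetric]
      by (simp add: sum_negf add_eq_0_iff)
  qed
  define V where "V = (\<lambda>(i,j). x ^ i * y ^ j) ` ({..<n} \<times> {..<m})"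
  let ?S = "int_module.span V"
  have V: "x ^ i * y ^ j \<in> ?S" if "i < n" "j < m" for i j
    using that by (intro int_module.span_base) (auto simp: V_def)
  have xV: "x * v \<in> ?S" if v: "v \<in> V" for v
  proof -
    obtain i j where ij: "i < n" "j < m" "v = x ^ i * y ^ j" using v by (auto simp: V_def)
    show ?thesis
    proof (cases "Suc i < n")
      case True
      with V[of "Suc i" j] ij show ?thesis by (simp add: mult.assoc)
    next
      case False
      then have "x * v = x ^ n * y ^ j" using ij by (simp add: Suc_lessI less_antisym flip: mult.assoc power_Suc)
          (metis Suc_lessI)
      also have "\<dots> = (\<Sum>k<n. of_int (- Polynomial.coeff p k) * (x ^ k * y ^ j))"
        using powers[OF p] by (simp add: n_def sum_distrib_right mult.assoc)
      also have "\<dots> \<in> ?S"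
        by (intro int_module.span_sum int_module.span_scale V) (use ij in auto)
      finally show ?thesis .
    qed
  qed
  have yV: "y * v \<in> ?S" if v: "v \<in> V" for v
  proof -
    obtain i j where ij: "i < n" "j < m" "v = x ^ i * y ^ j" using v by (auto simp: V_def)
    show ?thesis
    proof (cases "Suc j < m")
      case True
      with V[of i "Suc j"] ij show ?thesis by (simp add: mult.left_commute)
    next
      case False
      then have "Suc j = m" using ij by simp
      then have "y * v = x ^ i * y ^ m" using ij by (simp add: mult.left_commute flip: power_Suc)
      also have "\<dots> = (\<Sum>k<m. of_int (- Polynomial.coeff q k) * (x ^ i * y ^ k))"
        using powers[OF q] by (simp add: m_def sum_distrib_left mult.left_commute)
      also have "\<dots> \<in> ?S"
        by (intro int_module.span_sum int_module.span_scale V) (use ij in auto)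
      finally show ?thesis .
    qed
  qed
  have xS: "x * v \<in> ?S" if "v \<in> ?S" for v
    using that
  proof (induction rule: int_module.span_induct_alt)
    case base then show ?case by (simp add: int_module.span_zero)
  next
    case (step c a b)
    then show ?case
      using int_module.span_add[OF int_module.span_scale[OF xV, of a c]]
      by (simp add: algebra_simps)
  qed
  have fin: "finite V" by (simp add: V_def)
  have nz: "\<exists>v\<in>V. v \<noteq> 0"
    using np mp by (intro bexI[of _ 1]) (auto simp: V_def intro!: image_eqI[of _ _ "(0,0)"])
  have main: "algebraic_int z" if "\<And>v. v \<in> V \<Longrightarrow> z * v \<in> ?S" for z
    using algebraic_int_eigenvalue[OF fin nz] that
    unfolding int_module.span_finite[OF fin] by blast
  show "algebraic_int (x + y)"
    by (rule main) (simp add: distrib_right int_module.span_add xV yV)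
  show "algebraic_int (x * y)"
    by (rule main) (simp add: mult.assoc xS yV)
qed

section \<open>Subfields of the complex numbers and their Galois groups\<close>

lemma complex_field_simps [simp]:
  "carrier complex_field = UNIV" "x \<otimes>\<^bsub>complex_field\<^esub> y = x * y" "x \<oplus>\<^bsub>complex_field\<^esub> y = x + y"
  "\<one>\<^bsub>complex_field\<^esub> = 1" "\<zero>\<^bsub>complex_field\<^esub> = 0"
  by (simp_all add: ring_of_type_algebra_def)

lemma complex_field_a_inv [simp]: "\<ominus>\<^bsub>complex_field\<^esub> x = - x"
proof -
  interpret Ring.cring complex_field by (rule cring_from_type_algebra)
  show ?thesis by (rule minus_equality) simp_all
qed

lemma complex_field_m_inv [simp]: "x \<noteq> 0 \<Longrightarrow> inv\<^bsub>complex_field\<^esub> x = inverse x"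
proof -
  interpret Ring.cring complex_field by (rule cring_from_type_algebra)
  show "x \<noteq> 0 \<Longrightarrow> ?thesis" by (rule comm_inv_char) simp_all
qed

locale rat_subfield =
  fixes K :: "complex set"
  assumes rats_subset: "\<rat> \<subseteq> K"
    and add_closed: "x \<in> K \<Longrightarrow> y \<in> K \<Longrightarrow> x + y \<in> K"
    and mult_closed: "x \<in> K \<Longrightarrow> y \<in> K \<Longrightarrow> x * y \<in> K"
    and inverse_closed: "x \<in> K \<Longrightarrow> inverse x \<in> K"
begin

lemma rat_closed: "x \<in> \<rat> \<Longrightarrow> x \<in> K"
  using rats_subset by blast

lemma of_int_closed: "of_int n \<in> K"
  by (intro rat_closed) simp

lemma of_rat_closed: "of_rat n \<in> K"
  by (intro rat_closed) simp

lemma numeral_closed: "numeral n \<in> K" "0 \<in> K" "1 \<in> K"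
  by (intro rat_closed; simp)+

lemma uminus_closed: "x \<in> K \<Longrightarrow> - x \<in> K"
  using mult_closed[OF of_int_closed[of "-1"], of x] by simp

lemma diff_closed: "x \<in> K \<Longrightarrow> y \<in> K \<Longrightarrow> x - y \<in> K"
  using add_closed[OF _ uminus_closed] by fastforce

lemma divide_closed: "x \<in> K \<Longrightarrow> y \<in> K \<Longrightarrow> x / y \<in> K"
  by (simp add: divide_inverse mult_closed inverse_closed)

lemma power_closed: "x \<in> K \<Longrightarrow> x ^ n \<in> K"
  by (induction n) (auto intro: mult_closed numeral_closed)

lemmas closed = of_int_closed of_rat_closed numeral_closed uminus_closed add_closed diff_closed
  mult_closed inverse_closed divide_closed power_closed

end

lemma rat_subfield_adjoin_rat: "rat_subfield (adjoin_rat S)"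
proof
  fix x assume "x \<in> adjoin_rat S"
  then show "inverse x \<in> adjoin_rat S"
    unfolding adjoin_rat_def using generate_field.m_inv[of x complex_field]
    by (cases "x = 0") auto
qed (use generate_field.eng_add[of _ complex_field] generate_field.eng_mult[of _ complex_field] in
      \<open>auto simp: adjoin_rat_def intro: generate_field.incl\<close>)

lemma adjoin_rat_superset: "S \<subseteq> adjoin_rat S"
  by (auto simp: adjoin_rat_def intro: generate_field.incl)

lemma adjoin_rat_least:
  assumes "rat_subfield K" "S \<subseteq> K"
  shows "adjoin_rat S \<subseteq> K"
proof
  interpret rat_subfield K by fact
  fix x assume "x \<in> adjoin_rat S"
  then show "x \<in> K"
    unfolding adjoin_rat_def
  proof (induction rule: generate_field.induct)
    case (m_inv h) then show ?case by (simp add: closed)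
  qed (use assms in \<open>auto simp: closed rat_closed\<close>)
qed

section \<open>Simple extensions Q(z) through values of rational polynomials\<close>

definition rat_eval :: "rat poly \<Rightarrow> complex \<Rightarrow> complex" where
  "rat_eval q z = poly (map_poly of_rat q) z"

lemma rat_eval_simps [simp]:
  "rat_eval 0 z = 0" "rat_eval 1 z = 1"
  "rat_eval (pCons a q) z = of_rat a + z * rat_eval q z"
  "rat_eval (p + q) z = rat_eval p z + rat_eval q z"
  "rat_eval (p - q) z = rat_eval p z - rat_eval q z"
  "rat_eval (- q) z = - rat_eval q z"
  "rat_eval (p * q) z = rat_eval p z * rat_eval q z"
proof -
  interpret map_poly_comm_ring_hom "of_rat :: rat \<Rightarrow> complex" ..
  show "rat_eval 0 z = 0" "rat_eval 1 z = 1"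
  "rat_eval (pCons a q) z = of_rat a + z * rat_eval q z"
  "rat_eval (p + q) z = rat_eval p z + rat_eval q z"
  "rat_eval (p - q) z = rat_eval p z - rat_eval q z"
  "rat_eval (- q) z = - rat_eval q z"
  "rat_eval (p * q) z = rat_eval p z * rat_eval q z"
    by (simp_all add: rat_eval_def hom_distribs)
qed

lemma rat_eval_pcompose: "rat_eval (p \<circ>\<^sub>p q) z = rat_eval p (rat_eval q z)"
  by (induction p) (simp_all add: pcompose_pCons)

lemma rat_eval_of_int_poly: "rat_eval (map_poly of_int p) z = poly (map_poly of_int p) z"
  by (simp add: rat_eval_def map_poly_map_poly o_def)

lemma (in rat_subfield) rat_eval_closed: "z \<in> K \<Longrightarrow> rat_eval q z \<in> K"
  by (induction q) (auto intro: closed)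

locale irreducible_rat_poly =
  fixes R :: "rat poly"
  assumes irred: "Factorial_Ring.irreducible R"
begin

lemma bezout:
  assumes "\<not> R dvd q"
  obtains a b where "a * R + b * q = 1"
proof -
  have "prime_elem R" using irred by (simp add: prime_elem_iff_irreducible)
  then have "Rings.coprime R q" using assms by (rule prime_elem_imp_coprime)
  then have "fst (bezout_coefficients R q) * R + snd (bezout_coefficients R q) * q = 1"
    by (simp add: bezout_coefficients_fst_snd)
  then show ?thesis using that by blast
qed

lemma rat_eval_eq_0_iff:
  assumes "rat_eval R z = 0"
  shows "rat_eval q z = 0 \<longleftrightarrow> R dvd q"
proof
  assume q: "rat_eval q z = 0"
  show "R dvd q"
  proof (rule ccontr)
    assume "\<not> R dvd q"
    then obtain a b where "a * R + b * q = 1" by (rule bezout)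
    then have "rat_eval (a * R + b * q) z = 1" by simp
    with assms q show False by simp
  qed
qed (use assms in auto)

lemma rat_eval_eq_iff:
  assumes "rat_eval R z = 0"
  shows "rat_eval p z = rat_eval q z \<longleftrightarrow> R dvd p - q"
  using rat_eval_eq_0_iff[OF assms, of "p - q"] by simp

text \<open>Either equation says that \<open>R\<close> divides \<open>p - q\<close>, which does not
  mention the root. This replaces the isomorphism from Q(z) to Q(z') in all later arguments.\<close>

lemma conjugate_transfer:
  assumes "rat_eval R z = 0" "rat_eval R z' = 0"
  shows "rat_eval p z = rat_eval q z \<longleftrightarrow> rat_eval p z' = rat_eval q z'"
  using assms by (simp add: rat_eval_eq_iff)

text \<open>The polynomial values at \<open>z\<close> already form a field: a polynomial not
  divisible by \<open>R\<close> is coprime to it, and the Bezout cofactor evaluates to the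
  inverse.\<close>

lemma adjoin_rat_root:
  assumes z: "rat_eval R z = 0"
  shows "adjoin_rat {z} = range (\<lambda>q. rat_eval q z)"
proof
  have "rat_subfield (range (\<lambda>q. rat_eval q z))"
  proof
    have "of_rat x \<in> range (\<lambda>q. rat_eval q z)" for x
      by (rule range_eqI[of _ _ "[:x:]"]) simp
    then show "\<rat> \<subseteq> range (\<lambda>q. rat_eval q z)" by (auto elim: Rats_cases)
  next
    fix x assume "x \<in> range (\<lambda>q. rat_eval q z)"
    then obtain q where q: "x = rat_eval q z" by blast
    show "inverse x \<in> range (\<lambda>q. rat_eval q z)"
    proof (cases "R dvd q")
      case True
      then have "x = 0" using q rat_eval_eq_0_iff[OF z] by simp
      then show ?thesis by (intro range_eqI[of _ _ 0]) simp
    next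
      case False
      then obtain a b where "a * R + b * q = 1" by (rule bezout)
      then have "rat_eval (a * R + b * q) z = 1" by simp
      then have "rat_eval b z * x = 1" using z q by simp
      then have "inverse x = rat_eval b z" by (metis inverse_unique mult.commute)
      then show ?thesis by blast
    qed
  next
    fix x y assume "x \<in> range (\<lambda>q. rat_eval q z)" "y \<in> range (\<lambda>q. rat_eval q z)"
    then obtain p q where pq: "x = rat_eval p z" "y = rat_eval q z" by blast
    show "x + y \<in> range (\<lambda>q. rat_eval q z)"
      by (rule range_eqI[of _ _ "p + q"]) (simp add: pq)
    show "x * y \<in> range (\<lambda>q. rat_eval q z)"
      by (rule range_eqI[of _ _ "p * q"]) (simp add: pq)
  qed
  then show "adjoin_rat {z} \<subseteq> range (\<lambda>q. rat_eval q z)"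
    by (rule adjoin_rat_least) (auto intro: range_eqI[of _ _ "[:0,1:]"])
  show "range (\<lambda>q. rat_eval q z) \<subseteq> adjoin_rat {z}"
    using rat_subfield.rat_eval_closed[OF rat_subfield_adjoin_rat[of "{z}"]] adjoin_rat_superset[of "{z}"]
    by auto
qed

end

section \<open>The Galois group of a subfield\<close>

context rat_subfield
begin

abbreviation G where "G \<equiv> galois_group K"

lemma mem_galois_group_iff:
  "\<sigma> \<in> carrier G \<longleftrightarrow> \<sigma> \<in> Bij K
     \<and> (\<forall>x\<in>K. \<forall>y\<in>K. \<sigma> (x + y) = \<sigma> x + \<sigma> y \<and> \<sigma> (x * y) = \<sigma> x * \<sigma> y) \<and> (\<forall>q\<in>\<rat>. \<sigma> q = q)"
  by (auto simp: galois_group_def ring_iso_def Ring.ring_hom_def Bij_def bij_betw_def)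

lemma galois_group_mult:
  "\<sigma> \<in> carrier G \<Longrightarrow> \<tau> \<in> carrier G \<Longrightarrow> \<sigma> \<otimes>\<^bsub>G\<^esub> \<tau> = compose K \<sigma> \<tau>"
  unfolding mem_galois_group_iff by (simp add: galois_group_def BijGroup_def)

lemma galois_group_one: "\<one>\<^bsub>G\<^esub> = (\<lambda>x\<in>K. x)"
  by (simp add: galois_group_def BijGroup_def)

lemma galois_group_maps: "\<sigma> \<in> carrier G \<Longrightarrow> x \<in> K \<Longrightarrow> \<sigma> x \<in> K"
  unfolding mem_galois_group_iff using Bij_imp_funcset by blast

lemma group_galois_group: "Group.group G"
proof (rule groupI)
  show "\<one>\<^bsub>G\<^esub> \<in> carrier G"
    unfolding galois_group_one mem_galois_group_iff
    using rat_closed by (auto simp: id_Bij closed)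
next
  fix \<sigma> \<tau> assume st: "\<sigma> \<in> carrier G" "\<tau> \<in> carrier G"
  show "\<sigma> \<otimes>\<^bsub>G\<^esub> \<tau> \<in> carrier G"
    using st galois_group_maps[OF st(2)] rat_closed
    unfolding galois_group_mult[OF st] mem_galois_group_iff
    using compose_Bij[of \<sigma> K \<tau>] by (auto simp: compose_def closed)
next
  fix \<rho> \<sigma> \<tau> assume st: "\<rho> \<in> carrier G" "\<sigma> \<in> carrier G" "\<tau> \<in> carrier G"
  then have "\<rho> \<in> carrier (BijGroup K)" "\<sigma> \<in> carrier (BijGroup K)" "\<tau> \<in> carrier (BijGroup K)"
    by (auto simp: BijGroup_def mem_galois_group_iff)
  then show "\<rho> \<otimes>\<^bsub>G\<^esub> \<sigma> \<otimes>\<^bsub>G\<^esub> \<tau> = \<rho> \<otimes>\<^bsub>G\<^esub> (\<sigma> \<otimes>\<^bsub>G\<^esub> \<tau>)"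
    using Group.group.is_monoid[OF group_BijGroup, THEN Group.monoid.m_assoc]
    by (simp add: galois_group_def)
next
  fix \<sigma> assume s: "\<sigma> \<in> carrier G"
  then show "\<one>\<^bsub>G\<^esub> \<otimes>\<^bsub>G\<^esub> \<sigma> = \<sigma>"
    using Group.group.is_monoid[OF group_BijGroup, THEN Group.monoid.l_one, of \<sigma> K]
    by (simp add: galois_group_def BijGroup_def)
next
  fix \<sigma> assume s: "\<sigma> \<in> carrier G"
  then have B: "\<sigma> \<in> Bij K" by (simp add: mem_galois_group_iff)
  then have bij: "bij_betw \<sigma> K K" by (simp add: Bij_def)
  let ?t = "\<lambda>x\<in>K. inv_into K \<sigma> x"
  have inv: "inv_into K \<sigma> (\<sigma> x) = x" if "x \<in> K" for x
    using that bij by (simp add: bij_betw_inv_into_left)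
  have "inv_into K \<sigma> (x + y) = inv_into K \<sigma> x + inv_into K \<sigma> y"
    "inv_into K \<sigma> (x * y) = inv_into K \<sigma> x * inv_into K \<sigma> y" if "x \<in> K" "y \<in> K" for x y
    using s by (intro Bij_inv_into_lemma[OF _ B _ that]; auto simp: mem_galois_group_iff closed)+
  moreover have "inv_into K \<sigma> q = q" if "q \<in> \<rat>" for q
    using inv[OF rat_closed[OF that]] s that by (simp add: mem_galois_group_iff)
  ultimately have t: "?t \<in> carrier G"
    unfolding mem_galois_group_iff using restrict_inv_into_Bij[OF B] rat_closed by (simp add: closed)
  have "compose K ?t \<sigma> = (\<lambda>x\<in>K. x)"
    by (rule Bij_compose_restrict_eq[OF B])
  then show "\<exists>\<tau>\<in>carrier G. \<tau> \<otimes>\<^bsub>G\<^esub> \<sigma> = \<one>\<^bsub>G\<^esub>"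
    using t galois_group_mult[OF t s] galois_group_one by auto
qed

end

lemma cyclic_group_of_prime_order:
  assumes "Group.group G" "Factorial_Ring.prime (Coset.order G)"
  shows "cyclic_group G"
proof -
  interpret Group.group G by fact
  have fin: "finite (carrier G)"
    using assms(2) unfolding Coset.order_def by (intro card_ge_0_finite) (simp add: prime_gt_0_nat)
  have "card (carrier G) \<noteq> 1"
    using assms(2) by (auto simp: Coset.order_def)
  then obtain x where x: "x \<in> carrier G" "x \<noteq> \<one>\<^bsub>G\<^esub>"
  proof -
    have "carrier G \<noteq> {\<one>\<^bsub>G\<^esub>}" using \<open>card (carrier G) \<noteq> 1\<close> by auto
    then show ?thesis using that one_closed by blast
  qed
  have "ord x dvd Coset.order G" using ord_dvd_group_order[OF x(1)] .
  moreover have "ord x \<noteq> 1" using ord_eq_1[OF x(1)] x(2) by simp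
  ultimately have o: "ord x = card (carrier G)"
    using assms(2) unfolding Coset.order_def by (auto simp: prime_nat_iff)
  have "generate G {x} = carrier G"
  proof (rule card_subset_eq[OF fin])
    show "generate G {x} \<subseteq> carrier G" using x by (intro generate_incl) simp
    show "card (generate G {x}) = card (carrier G)" using generate_pow_card[OF x(1)] o by simp
  qed
  then have "subgroup_generated G {x} = G"
    using x by (simp add: subgroup_generated_def)
  then show ?thesis unfolding cyclic_group_def using x by blast
qed

section \<open>Irreducible cubic polynomials\<close>

lemma poly_cubic: "poly (map_poly of_int [:w, v, u, 1:]) (z :: complex) = z ^ 3 + of_int u * z ^ 2 + of_int v * z + of_int w"
  by (simp add: map_poly_pCons algebra_simps power2_eq_square power3_eq_cube)

lemma algebraic_int_cubicI:
  fixes z :: complex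
  assumes "z ^ 3 + of_int u * z ^ 2 + of_int v * z + of_int w = 0"
  shows "algebraic_int z"
  unfolding algebraic_int_altdef_ipoly using assms poly_cubic[of w v u z]
  by (intro exI[of _ "[:w, v, u, 1:]"]) simp

text \<open>A proper factorization of a cubic has a linear factor, hence a rational root; a rational
  root of a monic integer polynomial is an algebraic integer, hence an integer.\<close>

lemma monic_irreducible_cubic_iff:
  "monic_irreducible [:w, v, u, 1:] \<longleftrightarrow> (\<forall>n. n ^ 3 + u * n ^ 2 + v * n + w \<noteq> 0)"
proof -
  define R :: "rat poly" where "R = map_poly of_int [:w, v, u, 1:]"
  have R: "R = [:of_int w, of_int v, of_int u, 1:]" by (simp add: R_def map_poly_pCons)
  have R_poly: "poly R x = x ^ 3 + of_int u * x ^ 2 + of_int v * x + of_int w" for x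
    by (simp add: R algebra_simps power2_eq_square power3_eq_cube)
  have int_root: "\<exists>n. n ^ 3 + u * n ^ 2 + v * n + w = 0" if x: "poly R x = 0" for x
  proof -
    have "algebraic_int x"
      unfolding algebraic_int_altdef_ipoly using x
      by (intro exI[of _ "[:w, v, u, 1:]"]) (simp add: R_def)
    then have "x \<in> \<int>"
      using rational_algebraic_int_is_int[of x] by (metis Rats_of_rat id_apply of_rat_eq_id)
    then obtain n where "x = of_int n" by (auto elim: Ints_cases)
    with x have "(of_int (n ^ 3 + u * n ^ 2 + v * n + w) :: rat) = 0" by (simp add: R_poly)
    then show ?thesis by (metis of_int_eq_0_iff)
  qed
  have "Factorial_Ring.irreducible R \<longleftrightarrow> (\<forall>n. n ^ 3 + u * n ^ 2 + v * n + w \<noteq> 0)"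
  proof (intro iffI allI notI)
    fix n :: int
    assume irr: "Factorial_Ring.irreducible R" and n: "n ^ 3 + u * n ^ 2 + v * n + w = 0"
    have "poly R (of_int n) = of_int (n ^ 3 + u * n ^ 2 + v * n + w)" by (simp add: R_poly)
    then have "[:- of_int n, 1:] dvd R" using n by (simp add: poly_eq_0_iff_dvd)
    then obtain q where q: "R = [:- of_int n, 1:] * q" by (elim dvdE)
    then have "[:- of_int n, 1:] dvd (1 :: rat poly) \<or> q dvd 1" using irr by (blast dest: irreducibleD)
    moreover have "q \<noteq> 0" using q R by auto
    then have "Polynomial.degree R = Polynomial.degree [:- of_int n, 1 :: rat:] + Polynomial.degree q"
      unfolding q by (intro Polynomial.degree_mult_eq) auto
    then have "Polynomial.degree q = 2" by (simp add: R)
    ultimately show False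
      by (auto simp: is_unit_iff_degree)
  next
    assume no: "\<forall>n. n ^ 3 + u * n ^ 2 + v * n + w \<noteq> 0"
    show "Factorial_Ring.irreducible R"
    proof (rule irreducibleI)
      show "R \<noteq> 0" by (simp add: R)
      show "\<not> R dvd 1" by (simp add: R is_unit_iff_degree)
      fix a b assume ab: "R = a * b"
      then have nz: "a \<noteq> 0" "b \<noteq> 0" using R by auto
      then have deg: "Polynomial.degree a + Polynomial.degree b = 3"
        using Polynomial.degree_mult_eq[OF nz] unfolding ab[symmetric] by (simp add: R)
      have no_linear: "Polynomial.degree c \<noteq> 1" if "c dvd R" for c
      proof
        assume c: "Polynomial.degree c = 1"
        then obtain p q where pq: "c = [:p, q:]" "q \<noteq> 0"
          by (metis One_nat_def degree_eq_zeroE degree_pCons_eq_if nat.inject one_neq_zero pCons_cases zero_neq_one pCons_eq_0_iff)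
        then have "poly c (- p / q) = 0" by simp
        then have "poly R (- p / q) = 0" using that by (metis dvd_def mult_eq_0_iff poly_mult)
        then show False using int_root no by blast
      qed
      have "Polynomial.degree a \<noteq> 1" "Polynomial.degree b \<noteq> 1"
        using no_linear[of a] no_linear[of b] ab by auto
      then have "Polynomial.degree a = 0 \<or> Polynomial.degree b = 0" using deg by linarith
      then show "a dvd 1 \<or> b dvd 1" using nz by (simp add: is_unit_iff_degree)
    qed
  qed
  then show ?thesis unfolding monic_irreducible_def R_def by simp
qed

section \<open>Cubics, their roots and their discriminants\<close>

text \<open>The classical discriminant of x^3 + u x^2 + v x + w; \<open>vandermonde_squared\<close>
  identifies it with the squared product of the root differences.\<close>

definition cubic_disc :: "int \<Rightarrow> int \<Rightarrow> int \<Rightarrow> int" where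
  "cubic_disc u v w = u^2 * v^2 - 4 * v^3 - 4 * u^3 * w + 18 * u * v * w - 27 * w^2"

text \<open>Vieta's relations for an ordered triple of roots. Permuting the roots or translating
  them gives new instances of the locale, so each fact about \<open>r\<close> is available for
  \<open>s\<close> and \<open>t\<close> too.\<close>

locale cubic_roots =
  fixes u v w :: int and r s t :: complex
  assumes e1: "r + s + t = - of_int u"
    and e2: "r * s + s * t + t * r = of_int v"
    and e3: "r * s * t = - of_int w"

lemma cubic_roots_exist:
  obtains r s t where "cubic_roots u v w r s t"
proof -
  have "\<exists>r. poly (map_poly of_int [:w, v, u, 1:]) (r :: complex) = 0"
    by (rule fundamental_theorem_of_algebra_alt[rule_format]) (auto simp: map_poly_pCons)
  then obtain r :: complex where r: "r ^ 3 + of_int u * r ^ 2 + of_int v * r + of_int w = 0"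
    unfolding poly_cubic by blast
  \<comment> \<open>Dividing the cubic by x - r leaves x^2 + b x + (v + r b), whose roots are given
    by the quadratic formula with \<open>d\<close> a root of its discriminant.\<close>
  define b where "b = of_int u + r"
  define d where "d = csqrt (b ^ 2 - 4 * (of_int v + r * b))"
  have d: "d ^ 2 = b ^ 2 - 4 * (of_int v + r * b)" by (simp add: d_def)
  have st: "(- b + d) / 2 * ((- b - d) / 2) = of_int v + r * b"
    using d by (simp add: field_simps power2_eq_square)
  show ?thesis
  proof
    show "cubic_roots u v w r ((- b + d) / 2) ((- b - d) / 2)"
    proof
      have sum: "(- b + d) / 2 + (- b - d) / 2 = - b" by (simp add: field_simps)
      show "r + (- b + d) / 2 + (- b - d) / 2 = - of_int u"
        unfolding add.assoc sum by (simp add: b_def)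
      have "r * ((- b + d) / 2) + (- b - d) / 2 * r = - r * b"
        using sum by (metis (no_types) distrib_left mult.commute mult_minus_left mult_minus_right)
      then show "r * ((- b + d) / 2) + (- b + d) / 2 * ((- b - d) / 2) + (- b - d) / 2 * r = of_int v"
        unfolding st by (simp add: algebra_simps)
      show "r * ((- b + d) / 2) * ((- b - d) / 2) = - of_int w"
        using r unfolding mult.assoc[of r] st
        by (simp add: b_def algebra_simps power2_eq_square power3_eq_cube eq_neg_iff_add_eq_0)
    qed
  qed
qed

context cubic_roots
begin

abbreviation P :: "int poly" where "P \<equiv> [:w, v, u, 1:]"

lemma rotate: "cubic_roots u v w s t r"
  using e1 e2 e3 by unfold_locales (simp_all add: algebra_simps)

lemma swap: "cubic_roots u v w s r t"
  using e1 e2 e3 by unfold_locales (simp_all add: algebra_simps)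

lemma factorization:
  "z ^ 3 + of_int u * z ^ 2 + of_int v * z + of_int w = (z - r) * (z - s) * (z - t)"
proof -
  have uw: "of_int u = - (r + s + t)" "of_int w = - (r * s * t)" using e1 e3 by simp_all
  show ?thesis
    unfolding uw e2[symmetric] by (simp add: algebra_simps power2_eq_square power3_eq_cube)
qed

lemma root_eq: "r ^ 3 + of_int u * r ^ 2 + of_int v * r + of_int w = 0"
  by (simp add: factorization)

lemma complex_roots_eq: "complex_roots P = {r, s, t}"
  unfolding complex_roots_def poly_cubic factorization by auto

abbreviation disc :: int where "disc \<equiv> cubic_disc u v w"

definition vandermonde :: complex where
  "vandermonde = (r - s) * (s - t) * (t - r)"

lemma vandermonde_squared: "vandermonde ^ 2 = of_int disc"
proof -
  have uw: "of_int u = - (r + s + t)" "of_int w = - (r * s * t)" using e1 e3 by simp_all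
  have D: "(of_int disc :: complex) = of_int u^2 * of_int v^2 - 4 * of_int v^3
      - 4 * of_int u^3 * of_int w + 18 * of_int u * of_int v * of_int w - 27 * of_int w^2"
    by (simp add: cubic_disc_def)
  show ?thesis unfolding D vandermonde_def uw e2[symmetric]
    by (simp add: algebra_simps power2_eq_square power3_eq_cube)
qed

lemma derivative_at_root: "(r - s) * (r - t) = 3 * r ^ 2 + 2 * of_int u * r + of_int v"
proof -
  have u: "of_int u = - (r + s + t)" using e1 by simp
  show ?thesis unfolding u e2[symmetric] by (simp add: algebra_simps power2_eq_square)
qed

lemma algebraic_int_root: "algebraic_int r"
  by (rule algebraic_int_cubicI[OF root_eq])

end

locale irreducible_cubic = cubic_roots +
  assumes no_root: "n ^ 3 + u * n ^ 2 + v * n + w \<noteq> (0 :: int)"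
begin

lemma irreducible_cubic_rotate: "irreducible_cubic u v w s t r"
  using rotate no_root by (simp add: irreducible_cubic_def irreducible_cubic_axioms_def)

lemma monic_irreducible: "monic_irreducible P"
  using no_root by (simp add: monic_irreducible_cubic_iff)

definition R :: "rat poly" where "R = map_poly of_int P"

sublocale irreducible_rat_poly R
  by unfold_locales (use monic_irreducible in \<open>simp add: R_def monic_irreducible_def\<close>)

lemma rat_eval_R: "rat_eval R r = 0" "rat_eval R s = 0" "rat_eval R t = 0"
  unfolding R_def rat_eval_of_int_poly poly_cubic factorization by auto

lemma degree_R: "Polynomial.degree R = 3"
  by (simp add: R_def map_poly_pCons)

lemma lin_indep:
  assumes "rat_eval [:a, b, c:] r = 0"
  shows "a = 0" "b = 0" "c = 0"
proof -
  have "R dvd [:a, b, c:]" using assms rat_eval_eq_0_iff[OF rat_eval_R(1)] by blast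
  moreover have "Polynomial.degree [:a, b, c:] < 3" by (simp add: degree_pCons_eq_if)
  ultimately have "[:a, b, c:] = 0"
    using dvd_imp_degree_le degree_R by (metis linorder_not_less)
  then show "a = 0" "b = 0" "c = 0" by auto
qed

lemma lin_indep_of_int:
  assumes "of_int a + of_int b * r + of_int c * r ^ 2 = 0"
  shows "a = 0" "b = 0" "c = 0"
  using lin_indep[of "of_int a" "of_int b" "of_int c"] assms
  by (simp_all add: algebra_simps power2_eq_square)

lemma rat_eval_reduce: "\<exists>a b c. \<forall>z\<in>{r,s,t}. rat_eval q z = rat_eval [:a, b, c:] z"
proof -
  have "R \<noteq> 0" using degree_R by auto
  define m where "m = q mod R"
  have "m = 0 \<or> Polynomial.degree m < 3"
    using degree_mod_less[OF \<open>R \<noteq> 0\<close>, of q] degree_R by (auto simp: m_def)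
  then have "Polynomial.degree m < 3" by auto
  then have "m = [:Polynomial.coeff m 0, Polynomial.coeff m 1, Polynomial.coeff m 2:]"
    by (intro poly_eqI) (auto simp: coeff_pCons coeff_eq_0 numeral_2_eq_2 split: nat.splits)
  moreover have "rat_eval q z = rat_eval m z" if "z \<in> {r,s,t}" for z
  proof -
    have "rat_eval q z = rat_eval (q div R * R + m) z" by (simp add: m_def)
    also have "\<dots> = rat_eval m z" using rat_eval_R that by auto
    finally show ?thesis .
  qed
  ultimately show ?thesis by metis
qed

lemma adjoin_rat_elim:
  assumes "x \<in> adjoin_rat {r}"
  obtains a b c where "x = rat_eval [:a, b, c:] r"
  using assms rat_eval_reduce unfolding adjoin_rat_root[OF rat_eval_R(1)] by blast

lemma rat_eval_mem: "rat_eval q r \<in> adjoin_rat {r}"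
  unfolding adjoin_rat_root[OF rat_eval_R(1)] by blast

lemma root_neq: "r \<noteq> s"
proof
  assume "r = s"
  \<comment> \<open>A double root would annihilate the derivative, a relation of degree 2 with
    leading coefficient 3.\<close>
  then have "of_int v + of_int (2 * u) * r + of_int 3 * r ^ 2 = 0" using derivative_at_root by (simp add: algebra_simps)
  then show False using lin_indep_of_int(3)[of v "2 * u" 3] by simp
qed

lemma roots_distinct: "r \<noteq> s" "s \<noteq> t" "t \<noteq> r"
  using root_neq irreducible_cubic.root_neq[OF irreducible_cubic_rotate]
    irreducible_cubic.root_neq[OF irreducible_cubic.irreducible_cubic_rotate[OF irreducible_cubic_rotate]]
  by auto

lemma splitting_field_eq: "splitting_field P = adjoin_rat {r, s, t}"
  by (simp add: splitting_field_def complex_roots_eq)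

end

lemma monic_irreducible_cubicE:
  assumes "monic_irreducible [:w, v, u, 1:]"
  obtains r s t where "irreducible_cubic u v w r s t"
proof -
  obtain r s t where "cubic_roots u v w r s t" by (rule cubic_roots_exist)
  with assms have "irreducible_cubic u v w r s t"
    by (simp add: irreducible_cubic_def irreducible_cubic_axioms_def monic_irreducible_cubic_iff)
  then show ?thesis by (rule that)
qed

context rat_subfield
begin

lemma galois_group_rat_eval:
  assumes "\<sigma> \<in> carrier G" "x \<in> K"
  shows "\<sigma> (rat_eval q x) = rat_eval q (\<sigma> x)"
proof (induction q)
  case 0
  then show ?case using assms by (simp add: mem_galois_group_iff)
next
  case (pCons a q)
  have "rat_eval q x \<in> K" by (rule rat_eval_closed[OF assms(2)])
  with pCons show ?case
    using assms by (simp add: mem_galois_group_iff closed)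
qed

end

section \<open>Square discriminant and cyclic Galois group\<close>

context irreducible_cubic
begin

text \<open>The product of the root differences is then an integer up to sign; dividing it by (r -
  s) (r - t), the derivative at \<open>r\<close>, puts s - t into Q(r), where s + t = - u - r lies
  anyway.\<close>

lemma roots_mem_if_disc_square:
  assumes d: "d ^ 2 = disc"
  shows "s \<in> adjoin_rat {r}" "t \<in> adjoin_rat {r}"
proof -
  interpret K: rat_subfield "adjoin_rat {r}" by (rule rat_subfield_adjoin_rat)
  have r: "r \<in> adjoin_rat {r}" using adjoin_rat_superset by blast
  have "vandermonde ^ 2 = (of_int d) ^ 2"
    unfolding vandermonde_squared d[symmetric] by simp
  then have "vandermonde = of_int d \<or> vandermonde = - of_int d" by (rule power2_eq_iff[THEN iffD1])
  then have V: "vandermonde \<in> adjoin_rat {r}" using K.closed by auto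
  have F: "3 * r ^ 2 + 2 * of_int u * r + of_int v \<noteq> 0"
    using roots_distinct by (simp flip: derivative_at_root)
  have "(s - t) * (3 * r ^ 2 + 2 * of_int u * r + of_int v) = - vandermonde"
    unfolding derivative_at_root[symmetric] vandermonde_def by (simp add: algebra_simps)
  then have "s - t = - vandermonde / (3 * r ^ 2 + 2 * of_int u * r + of_int v)"
    using F by (simp add: field_simps)
  then have diff: "s - t \<in> adjoin_rat {r}" using V r by (auto intro!: K.closed)
  have "s + t = - of_int u - r" using e1 by (simp add: algebra_simps)
  then have sum: "s + t \<in> adjoin_rat {r}" using r by (simp add: K.closed)
  have "((s + t) + (s - t)) / 2 \<in> adjoin_rat {r}" "((s + t) - (s - t)) / 2 \<in> adjoin_rat {r}"
    by (intro K.closed sum diff)+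
  then show "s \<in> adjoin_rat {r}" "t \<in> adjoin_rat {r}" by simp_all
qed

lemma splitting_field_if_disc_square:
  assumes "d ^ 2 = disc"
  shows "splitting_field P = adjoin_rat {r}"
proof -
  have "adjoin_rat {r, s, t} \<subseteq> adjoin_rat {r}"
    using roots_mem_if_disc_square[OF assms] adjoin_rat_superset[of "{r}"]
    by (intro adjoin_rat_least rat_subfield_adjoin_rat) auto
  moreover have "adjoin_rat {r} \<subseteq> adjoin_rat {r, s, t}"
    using adjoin_rat_superset[of "{r, s, t}"] by (intro adjoin_rat_least rat_subfield_adjoin_rat) auto
  ultimately show ?thesis by (simp add: splitting_field_eq)
qed

text \<open>The homomorphism of Q(r) that sends \<open>r\<close> to \<open>z\<close>. If
  \<open>z\<close> is a root of \<open>R\<close>, the chosen representing polynomial does not affect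
  the value, by \<open>conjugate_transfer\<close>.\<close>

definition embedding :: "complex \<Rightarrow> complex \<Rightarrow> complex" where
  "embedding z = (\<lambda>x\<in>adjoin_rat {r}. rat_eval (SOME q. rat_eval q r = x) z)"

lemma embedding_rat_eval:
  assumes "rat_eval R z = 0"
  shows "embedding z (rat_eval q r) = rat_eval q z"
proof -
  have "rat_eval (SOME p. rat_eval p r = rat_eval q r) r = rat_eval q r"
    by (rule someI[of _ q]) simp
  then show ?thesis
    using conjugate_transfer[OF rat_eval_R(1) assms] rat_eval_mem by (simp add: embedding_def)
qed

lemma embedding_in_galois_group:
  assumes z: "rat_eval R z = 0" and eq: "adjoin_rat {z} = adjoin_rat {r}"
  shows "embedding z \<in> carrier (galois_group (adjoin_rat {r}))"
proof -
  interpret K: rat_subfield "adjoin_rat {r}" by (rule rat_subfield_adjoin_rat)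
  note emb = embedding_rat_eval[OF z]
  have "inj_on (embedding z) (adjoin_rat {r})"
    unfolding adjoin_rat_root[OF rat_eval_R(1)]
    using conjugate_transfer[OF rat_eval_R(1) z] by (auto simp: inj_on_def emb)
  moreover have "embedding z ` adjoin_rat {r} = adjoin_rat {z}"
    unfolding adjoin_rat_root[OF rat_eval_R(1)] adjoin_rat_root[OF z] image_image emb ..
  then have "embedding z ` adjoin_rat {r} = adjoin_rat {r}" unfolding eq .
  moreover have "embedding z \<in> extensional (adjoin_rat {r})"
    by (simp add: embedding_def)
  ultimately have "embedding z \<in> Bij (adjoin_rat {r})" by (simp add: Bij_def bij_betw_def)
  moreover have "embedding z (x + y) = embedding z x + embedding z y
      \<and> embedding z (x * y) = embedding z x * embedding z y"
    if xy: "x \<in> adjoin_rat {r}" "y \<in> adjoin_rat {r}" for x y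
  proof -
    obtain p q where "x = rat_eval p r" "y = rat_eval q r"
      using xy unfolding adjoin_rat_root[OF rat_eval_R(1)] by blast
    then show ?thesis using emb[of p] emb[of q] emb[of "p + q"] emb[of "p * q"] by simp
  qed
  moreover have "embedding z q = q" if "q \<in> \<rat>" for q
    using that emb[of "[:a:]" for a] by (auto elim!: Rats_cases)
  ultimately show ?thesis unfolding K.mem_galois_group_iff by blast
qed

lemma galois_group_element:
  assumes \<sigma>: "\<sigma> \<in> carrier (galois_group (adjoin_rat {r}))"
  shows "\<sigma> \<in> {embedding r, embedding s, embedding t}"
proof -
  interpret K: rat_subfield "adjoin_rat {r}" by (rule rat_subfield_adjoin_rat)
  have r: "r \<in> adjoin_rat {r}" using adjoin_rat_superset by blast
  note ev = K.galois_group_rat_eval[OF \<sigma> r]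
  have "rat_eval R (\<sigma> r) = 0"
    using ev[of R] ev[of 0] rat_eval_R(1) by simp
  moreover have "\<sigma> = embedding (\<sigma> r)"
  proof (rule extensionalityI)
    show "\<sigma> \<in> extensional (adjoin_rat {r})" using \<sigma> by (simp add: K.mem_galois_group_iff Bij_def)
    show "embedding (\<sigma> r) \<in> extensional (adjoin_rat {r})" by (simp add: embedding_def)
    show "\<sigma> x = embedding (\<sigma> r) x" if "x \<in> adjoin_rat {r}" for x
      using that ev embedding_rat_eval[OF \<open>rat_eval R (\<sigma> r) = 0\<close>]
      unfolding adjoin_rat_root[OF rat_eval_R(1)] by auto
  qed
  ultimately show ?thesis
    unfolding R_def rat_eval_of_int_poly poly_cubic factorization by auto
qed

text \<open>All three roots generate the same field, so the three embeddings of Q(r) are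
  automorphisms of it and exhaust the Galois group; a group of order 3 is cyclic.\<close>

lemma cyclic_if_disc_square:
  assumes d: "d ^ 2 = disc"
  shows "cyclic_poly P"
proof -
  let ?K = "adjoin_rat {r}"
  interpret K: rat_subfield ?K by (rule rat_subfield_adjoin_rat)
  interpret s: irreducible_cubic u v w s t r by (rule irreducible_cubic_rotate)
  interpret t: irreducible_cubic u v w t r s by (rule s.irreducible_cubic_rotate)
  have eq: "adjoin_rat {s} = ?K" "adjoin_rat {t} = ?K"
    using s.splitting_field_if_disc_square[of d] t.splitting_field_if_disc_square[of d] d
      splitting_field_if_disc_square[OF d] by simp_all
  have carrier: "carrier (galois_group ?K) = {embedding r, embedding s, embedding t}"
    using galois_group_element embedding_in_galois_group[OF rat_eval_R(1)]
      embedding_in_galois_group[OF rat_eval_R(2) eq(1)] embedding_in_galois_group[OF rat_eval_R(3) eq(2)]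
    by blast
  have X: "rat_eval [:0, 1:] z = z" for z by simp
  have "embedding z r = z" if "rat_eval R z = 0" for z
    using embedding_rat_eval[OF that, of "[:0, 1:]"] unfolding X .
  then have "embedding r \<noteq> embedding s" "embedding s \<noteq> embedding t" "embedding r \<noteq> embedding t"
    using rat_eval_R roots_distinct by metis+
  then have "Coset.order (galois_group ?K) = 3"
    unfolding Coset.order_def carrier by simp
  moreover from this have "cyclic_group (galois_group ?K)"
    by (intro cyclic_group_of_prime_order K.group_galois_group) simp
  ultimately show ?thesis
    using monic_irreducible splitting_field_if_disc_square[OF d] by (simp add: cyclic_poly_def)
qed

text \<open>
  If \<open>s\<close> were not in \<open>\<rat>(r)\<close>, then exchanging \<open>s\<close> and \<open>t\<close> would define an automorphism of order 2
  of the splitting field.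
\<close>

lemma root_mem_if_order_3:
  assumes "Coset.order (galois_group (splitting_field P)) = 3"
  shows "s \<in> adjoin_rat {r}"
proof (rule ccontr)
  assume s: "s \<notin> adjoin_rat {r}"
  let ?L = "adjoin_rat {r}"
  interpret L: rat_subfield ?L by (rule rat_subfield_adjoin_rat)
  define e where "e = s + t"
  define n where "n = s * t"
  have rL: "r \<in> ?L" using adjoin_rat_superset by blast
  have "e = - of_int u - r" using e1 by (simp add: e_def algebra_simps)
  then have eL: "e \<in> ?L" using rL by (simp add: L.closed)
  have "n = of_int v - r * e" using e2 by (simp add: e_def n_def algebra_simps)
  then have nL: "n \<in> ?L" using rL eL by (simp add: L.closed)
  \<comment> \<open>Over \<open>?L\<close> the roots \<open>s\<close> and \<open>t\<close> are the
    two zeros of X^2 - e X + n, so this set is the quadratic extension \<open>?L\<close>(s), and it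
    contains \<open>t\<close>.\<close>
  define K where "K = {a + b * s | a b. a \<in> ?L \<and> b \<in> ?L}"
  have KI: "a + b * s \<in> K" if "a \<in> ?L" "b \<in> ?L" for a b using that by (auto simp: K_def)
  have t: "t = e - s" by (simp add: e_def)
  have s2: "s * s = e * s - n" by (simp add: e_def n_def algebra_simps)
  have t2: "t * t = e * t - n" by (simp add: e_def n_def algebra_simps)
  \<comment> \<open>Uniqueness of coordinates, the place where \<open>s\<close> lying outside
    \<open>?L\<close> is used; it makes the exchange map below well defined.\<close>
  have coord: "a = a'" "b = b'"
    if "a + b * s = a' + b' * s" "a \<in> ?L" "b \<in> ?L" "a' \<in> ?L" "b' \<in> ?L" for a b a' b'
  proof -
    show b: "b = b'"
    proof (rule ccontr)
      assume "b \<noteq> b'"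
      then have "s = (a' - a) / (b - b')" using that(1) by (simp add: field_simps)
      then show False using s that L.closed by auto
    qed
    show "a = a'" using that(1) b by simp
  qed
  \<comment> \<open>The product has the same coordinates for \<open>s\<close> as for
    \<open>t\<close> in the next fact, since both satisfy the same quadratic equation. This is why
    exchanging them is multiplicative.\<close>
  have K_mult: "(a + b * s) * (a' + b' * s) = (a * a' - b * b' * n) + (a * b' + a' * b + b * b' * e) * s"
    for a b a' b'
  proof -
    have "(a + b * s) * (a' + b' * s) = a * a' + (a * b' + a' * b) * s + b * b' * (s * s)"
      by (simp add: algebra_simps)
    then show ?thesis unfolding s2 by (simp add: algebra_simps)
  qed
  have K_mult': "(a + b * t) * (a' + b' * t) = (a * a' - b * b' * n) + (a * b' + a' * b + b * b' * e) * t"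
    for a b a' b'
  proof -
    have "(a + b * t) * (a' + b' * t) = a * a' + (a * b' + a' * b) * t + b * b' * (t * t)"
      by (simp add: algebra_simps)
    then show ?thesis unfolding t2 by (simp add: algebra_simps)
  qed
  have K: "rat_subfield K"
  proof
    show "\<rat> \<subseteq> K" using KI[of _ 0] L.rat_closed by (auto simp: L.closed)
  next
    fix x y assume "x \<in> K" "y \<in> K"
    then obtain a b a' b' where x: "x = a + b * s" "a \<in> ?L" "b \<in> ?L"
      and y: "y = a' + b' * s" "a' \<in> ?L" "b' \<in> ?L" by (auto simp: K_def)
    have xy: "x + y = (a + a') + (b + b') * s" using x y by (simp add: algebra_simps)
    show "x + y \<in> K" unfolding xy by (intro KI L.closed x y)
    show "x * y \<in> K"
      unfolding x(1) y(1) K_mult by (intro KI L.closed x y eL nL)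
  next
    fix x assume "x \<in> K"
    then obtain a b where x: "x = a + b * s" "a \<in> ?L" "b \<in> ?L" by (auto simp: K_def)
    \<comment> \<open>The relative norm of \<open>x\<close>: dividing the conjugate a + b t by it
      gives the inverse.\<close>
    define N where "N = a * a + a * b * e + b * b * n"
    have N: "x * (a + b * t) = N" by (simp add: x(1) N_def e_def n_def algebra_simps)
    have NL: "N \<in> ?L" unfolding N_def by (intro L.closed x eL nL)
    show "inverse x \<in> K"
    proof (cases "x = 0")
      case True
      then show ?thesis using KI[of 0 0] by (simp add: L.closed)
    next
      case False
      have "a + b * t \<noteq> 0"
      proof
        assume 0: "a + b * t = 0"
        then have eq: "(a + b * e) + (- b) * s = 0 + 0 * s" by (simp add: t algebra_simps)
        have m: "a + b * e \<in> ?L" "- b \<in> ?L" "0 \<in> ?L" by (intro L.closed x eL)+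
        have "- b = 0" by (rule coord(2)[OF eq m m(3)])
        then have "b = 0" by simp
        with 0 False x show False by simp
      qed
      then have "N \<noteq> 0" using N False by auto
      then have "inverse x = (a + b * t) / N"
        using N False by (simp add: field_simps)
      also have "\<dots> = (a + b * e) / N + (- b / N) * s" by (simp add: t algebra_simps diff_divide_distrib add_divide_distrib)
      also have "\<dots> \<in> K" by (intro KI L.closed x eL NL)
      finally show ?thesis .
    qed
  qed
  interpret K: rat_subfield K by (rule K)
  have rK: "r \<in> K" using KI[OF rL, of 0] by (simp add: L.closed)
  have sK: "s \<in> K" using KI[of 0 1] by (simp add: L.closed)
  have tK: "t \<in> K" using KI[of e "-1"] eL by (simp add: L.closed t)
  have "adjoin_rat {r, s, t} \<subseteq> K"
    using rK sK tK by (intro adjoin_rat_least K) auto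
  moreover have "K \<subseteq> adjoin_rat {r, s, t}"
  proof
    fix x assume "x \<in> K"
    then obtain a b where x: "x = a + b * s" "a \<in> ?L" "b \<in> ?L" by (auto simp: K_def)
    interpret S: rat_subfield "adjoin_rat {r, s, t}" by (rule rat_subfield_adjoin_rat)
    have sup: "{r, s, t} \<subseteq> adjoin_rat {r, s, t}" by (rule adjoin_rat_superset)
    then have "?L \<subseteq> adjoin_rat {r, s, t}" by (intro adjoin_rat_least rat_subfield_adjoin_rat) auto
    then show "x \<in> adjoin_rat {r, s, t}" using x sup by (auto intro!: S.closed)
  qed
  ultimately have KS: "splitting_field P = K" by (simp add: splitting_field_eq)
  define \<tau> where "\<tau> = (\<lambda>x\<in>K. SOME y. \<exists>a\<in>?L. \<exists>b\<in>?L. x = a + b * s \<and> y = a + b * t)"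
  have \<tau>: "\<tau> (a + b * s) = a + b * t" if "a \<in> ?L" "b \<in> ?L" for a b
  proof -
    have "\<exists>a'\<in>?L. \<exists>b'\<in>?L. a + b * s = a' + b' * s \<and> \<tau> (a + b * s) = a' + b' * t"
      using someI[of "\<lambda>y. \<exists>a'\<in>?L. \<exists>b'\<in>?L. a + b * s = a' + b' * s \<and> y = a' + b' * t" "a + b * t"] that
      by (auto simp: \<tau>_def KI)
    then show ?thesis using coord that by blast
  qed
  have \<tau>t: "\<tau> (a + b * t) = a + b * s" if "a \<in> ?L" "b \<in> ?L" for a b
  proof -
    have eq: "a + b * t = (a + b * e) + (- b) * s" by (simp add: t algebra_simps)
    have "\<tau> (a + b * t) = (a + b * e) + (- b) * t" unfolding eq by (intro \<tau> L.closed that eL)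
    then show ?thesis by (simp add: t algebra_simps)
  qed
  have tKI: "a + b * t \<in> K" if "a \<in> ?L" "b \<in> ?L" for a b
  proof -
    have "a + b * t = (a + b * e) + (- b) * s" by (simp add: t algebra_simps)
    also have "\<dots> \<in> K" by (intro KI L.closed that eL)
    finally show ?thesis .
  qed
  have maps: "\<tau> x \<in> K" and invol: "\<tau> (\<tau> x) = x" if "x \<in> K" for x
    using that \<tau> \<tau>t tKI by (auto simp: K_def)
  have "bij_betw \<tau> K K" by (rule bij_betw_byWitness[of _ \<tau>]) (auto simp: maps invol)
  moreover have "\<tau> \<in> extensional K" by (simp add: \<tau>_def)
  moreover have "\<tau> (x + y) = \<tau> x + \<tau> y \<and> \<tau> (x * y) = \<tau> x * \<tau> y" if xy: "x \<in> K" "y \<in> K" for x y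
  proof -
    obtain a b a' b' where x: "x = a + b * s" "a \<in> ?L" "b \<in> ?L"
      and y: "y = a' + b' * s" "a' \<in> ?L" "b' \<in> ?L" using xy by (auto simp: K_def)
    have "x + y = (a + a') + (b + b') * s" using x y by (simp add: algebra_simps)
    then have "\<tau> (x + y) = (a + a') + (b + b') * t"
      using \<tau>[OF L.add_closed[OF x(2) y(2)] L.add_closed[OF x(3) y(3)]] by simp
    moreover have "\<tau> (x * y) = (a * a' - b * b' * n) + (a * b' + a' * b + b * b' * e) * t"
      unfolding x(1) y(1) K_mult by (intro \<tau> L.closed x y eL nL)
    ultimately show ?thesis unfolding K_mult'[symmetric] using \<tau> x y by (simp add: algebra_simps)
  qed
  moreover have "\<tau> q = q" if "q \<in> \<rat>" for q
    using \<tau>[of q 0] L.rat_closed[OF that] by (simp add: L.closed)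
  ultimately have \<tau>G: "\<tau> \<in> carrier K.G" by (simp add: K.mem_galois_group_iff Bij_def)
  interpret G: Group.group K.G by (rule K.group_galois_group)
  \<comment> \<open>The square and, in a group of order 3, the cube of \<open>\<tau>\<close> are
    trivial, so \<open>\<tau>\<close> itself is trivial, although it moves \<open>s\<close> to
    \<open>t\<close>.\<close>
  have "\<tau> \<otimes>\<^bsub>K.G\<^esub> \<tau> = \<one>\<^bsub>K.G\<^esub>"
    unfolding K.galois_group_mult[OF \<tau>G \<tau>G] K.galois_group_one
    by (auto simp: compose_def invol fun_eq_iff)
  moreover have "\<tau> [^]\<^bsub>K.G\<^esub> (3::nat) = \<one>\<^bsub>K.G\<^esub>"
    using G.pow_order_eq_1[OF \<tau>G] assms KS by simp
  ultimately have "\<tau> = \<one>\<^bsub>K.G\<^esub>"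
    using \<tau>G by (simp add: numeral_3_eq_3)
  then have "\<tau> s = s" using sK by (simp add: K.galois_group_one)
  moreover have "\<tau> s = t" using \<tau>[of 0 1] by (simp add: L.closed)
  ultimately show False using roots_distinct by simp
qed

text \<open>The product of the root differences lies in Q(r), say as q(r). Its square is rational,
  so q(s) and q(t) agree with q(r) up to sign, and q(r) + q(s) + q(t) is rational. A sum of three
  signs is never zero, so q(r) is rational, and being an algebraic integer it is an integer.\<close>

lemma disc_square_if_order_3:
  assumes order: "Coset.order (galois_group (splitting_field P)) = 3"
  shows "\<exists>d. d ^ 2 = disc"
proof -
  let ?L = "adjoin_rat {r}"
  interpret L: rat_subfield ?L by (rule rat_subfield_adjoin_rat)
  have rL: "r \<in> ?L" using adjoin_rat_superset by blast
  have sL: "s \<in> ?L" by (rule root_mem_if_order_3[OF order])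
  have "t = - of_int u - r - s" using e1 by (simp add: algebra_simps)
  then have tL: "t \<in> ?L" using rL sL by (simp add: L.closed)
  have "vandermonde \<in> ?L" unfolding vandermonde_def by (intro L.closed rL sL tL)
  then obtain a b c where V: "vandermonde = rat_eval [:a, b, c:] r" by (rule adjoin_rat_elim)
  let ?q = "[:a, b, c:]"
  have "rat_eval (?q * ?q) r = vandermonde ^ 2"
    unfolding V by (simp only: rat_eval_simps power2_eq_square)
  then have "rat_eval (?q * ?q) r = rat_eval [:of_int disc:] r"
    unfolding vandermonde_squared by simp
  then have sq: "rat_eval (?q * ?q) z = rat_eval [:of_int disc:] z" if "rat_eval R z = 0" for z
    using conjugate_transfer[OF rat_eval_R(1) that] by blast
  have pm: "rat_eval ?q z = vandermonde \<or> rat_eval ?q z = - vandermonde" if "rat_eval R z = 0" for z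
  proof -
    have "(rat_eval ?q z) ^ 2 = rat_eval (?q * ?q) z" unfolding rat_eval_simps power2_eq_square ..
    also have "\<dots> = vandermonde ^ 2" unfolding sq[OF that] vandermonde_squared by simp
    finally show ?thesis by (rule power2_eq_iff[THEN iffD1])
  qed
  have "rat_eval ?q r + rat_eval ?q s + rat_eval ?q t
      = of_rat a * 3 + of_rat b * (r + s + t) + of_rat c * ((r + s + t) ^ 2 - 2 * (r * s + s * t + t * r))"
    by (simp add: algebra_simps power2_eq_square)
  then have "rat_eval ?q r + rat_eval ?q s + rat_eval ?q t \<in> \<rat>"
    unfolding e1 e2 by simp
  then have tr: "vandermonde + rat_eval ?q s + rat_eval ?q t \<in> \<rat>" unfolding V .
  have "vandermonde \<in> \<rat>"
  proof -
    have triple: "vandermonde \<in> \<rat>" if "vandermonde + vandermonde + vandermonde \<in> \<rat>"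
      using Rats_divide[OF that, of 3] by simp
    show ?thesis
      using tr pm[OF rat_eval_R(2)] pm[OF rat_eval_R(3)] by (elim disjE) (simp_all add: triple del: rat_eval_simps)
  qed
  moreover have "algebraic_int vandermonde"
    unfolding algebraic_int_altdef_ipoly using vandermonde_squared
    by (intro exI[of _ "[:- disc, 0, 1:]"]) (simp add: map_poly_pCons power2_eq_square)
  ultimately have "vandermonde \<in> \<int>" by (intro rational_algebraic_int_is_int)
  then obtain d where "vandermonde = of_int d" by (auto elim: Ints_cases)
  then have "(of_int (d ^ 2) :: complex) = of_int disc" using vandermonde_squared by simp
  then show ?thesis by (metis of_int_eq_iff)
qed

end

section \<open>Monogenic cubic polynomials\<close>

lemma of_int_div_algebraic_int:
  fixes n p :: int
  assumes "algebraic_int (of_int n / of_int p :: complex)" "p \<noteq> 0"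
  shows "p dvd n"
proof -
  have "(of_int n / of_int p :: complex) \<in> \<int>"
    using assms(1) by (rule rational_algebraic_int_is_int) simp
  then obtain m where "(of_int n / of_int p :: complex) = of_int m" by (auto elim: Ints_cases)
  then have "(of_int n :: complex) = of_int (p * m)" using assms(2) by (simp add: field_simps)
  then have "n = p * m" by (simp only: of_int_eq_iff)
  then show ?thesis by simp
qed

text \<open>Groups the norm of A + B r + C r^2 by symmetric functions of the roots, so that each
  group can be replaced by an expression in the coefficients of the cubic.\<close>

lemma prod_conjugates_expansion:
  fixes A B C r s t :: "'a :: comm_ring_1"
  shows "(A + B * r + C * r^2) * (A + B * s + C * s^2) * (A + B * t + C * t^2)
    = A^3 + A^2 * B * (r + s + t) + A^2 * C * (r^2 + s^2 + t^2) + A * B^2 * (r * s + s * t + t * r)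
      + A * B * C * (r * s^2 + r^2 * s + s * t^2 + s^2 * t + t * r^2 + t^2 * r)
      + A * C^2 * (r^2 * s^2 + s^2 * t^2 + t^2 * r^2)
      + (r * s * t) * (B^3 + B^2 * C * (r + s + t) + B * C^2 * (r * s + s * t + t * r) + C^3 * (r * s * t))"
  by (simp add: algebra_simps power2_eq_square power3_eq_cube)

lemma norm_form_identity:
  fixes A B C U V W :: "'a :: comm_ring_1"
  shows "A^3 + A^2 * B * (- U) + A^2 * C * (U^2 - 2 * V) + A * B^2 * V + A * B * C * (3 * W - U * V)
      + A * C^2 * (V^2 - 2 * U * W) + (- W) * (B^3 + B^2 * C * (- U) + B * C^2 * V + C^3 * (- W))
    = A^3 - U * A^2 * B + (U^2 - 2 * V) * A^2 * C + V * A * B^2 + (3 * W - U * V) * A * B * C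
      + (V^2 - 2 * U * W) * A * C^2 - W * B^3 + U * W * B^2 * C - V * W * B * C^2 + W^2 * C^3"
  by (simp add: algebra_simps power2_eq_square power3_eq_cube)

lemma algebraic_int_diff:
  fixes x y :: complex
  shows "algebraic_int x \<Longrightarrow> algebraic_int y \<Longrightarrow> algebraic_int (x - y)"
  using algebraic_int_plus[of x "- y"] by simp

lemma algebraic_int_of_int: "algebraic_int (of_int n :: complex)"
  by (rule int_imp_algebraic_int) simp

lemma algebraic_int_power: "algebraic_int (x :: complex) \<Longrightarrow> algebraic_int (x ^ n)"
  by (induction n) (auto intro: algebraic_int_times int_imp_algebraic_int)

lemmas algebraic_int_intros = algebraic_int_plus algebraic_int_diff algebraic_int_times
  algebraic_int_of_int algebraic_int_power algebraic_int_minus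

text \<open>The new coefficients are those of f(x + n), that is, half the second derivative, the
  derivative and the value of f at n.\<close>

lemma (in cubic_roots) shift:
  "cubic_roots (u + 3 * n) (3 * n ^ 2 + 2 * u * n + v) (n ^ 3 + u * n ^ 2 + v * n + w)
     (r - of_int n) (s - of_int n) (t - of_int n)"
proof
  have sums: "r - N + (s - N) + (t - N) = (r + s + t) - 3 * N"
    "(r - N) * (s - N) + (s - N) * (t - N) + (t - N) * (r - N)
      = (r * s + s * t + t * r) - 2 * N * (r + s + t) + 3 * N ^ 2"
    "(r - N) * (s - N) * (t - N)
      = r * s * t - N * (r * s + s * t + t * r) + N ^ 2 * (r + s + t) - N ^ 3" for N
    by (simp_all add: algebra_simps power2_eq_square power3_eq_cube)
  show "r - of_int n + (s - of_int n) + (t - of_int n) = - of_int (u + 3 * n)"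
    unfolding sums e1 by simp
  show "(r - of_int n) * (s - of_int n) + (s - of_int n) * (t - of_int n)
      + (t - of_int n) * (r - of_int n) = of_int (3 * n\<^sup>2 + 2 * u * n + v)"
    unfolding sums e1 e2 by simp
  show "(r - of_int n) * (s - of_int n) * (t - of_int n) = - of_int (n ^ 3 + u * n\<^sup>2 + v * n + w)"
    unfolding sums e1 e2 e3 by simp
qed

section \<open>Norms and integrality at a single prime\<close>

context cubic_roots
begin

text \<open>The norm of x + y r + z r^2 as a cubic form in the coordinates, with coefficients in
  \<open>u\<close>, \<open>v\<close>, \<open>w\<close>; see \<open>norm_form_eq\<close>.\<close>

definition norm_form :: "int \<Rightarrow> int \<Rightarrow> int \<Rightarrow> int" where
  "norm_form x y z = x^3 - u * x^2 * y + (u^2 - 2 * v) * x^2 * z + v * x * y^2 + (3 * w - u * v) * x * y * z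
     + (v^2 - 2 * u * w) * x * z^2 - w * y^3 + u * w * y^2 * z - v * w * y * z^2 + w^2 * z^3"

lemma norm_form_eq:
  "(of_int x + of_int y * r + of_int z * r^2) * (of_int x + of_int y * s + of_int z * s^2)
     * (of_int x + of_int y * t + of_int z * t^2) = of_int (norm_form x y z)"
proof -
  have uw: "of_int u = - (r + s + t)" "of_int w = - (r * s * t)" using e1 e3 by simp_all
  have p2: "r^2 + s^2 + t^2 = of_int u ^ 2 - 2 * of_int v"
    unfolding uw e2[symmetric] by (simp add: algebra_simps power2_eq_square)
  have p21: "r * s^2 + r^2 * s + s * t^2 + s^2 * t + t * r^2 + t^2 * r = 3 * of_int w - of_int u * of_int v"
    unfolding uw e2[symmetric] by (simp add: algebra_simps power2_eq_square)
  have p22: "r^2 * s^2 + s^2 * t^2 + t^2 * r^2 = of_int v ^ 2 - 2 * of_int u * of_int w"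
    unfolding uw e2[symmetric] by (simp add: algebra_simps power2_eq_square)
  have "(of_int x + of_int y * r + of_int z * r^2) * (of_int x + of_int y * s + of_int z * s^2)
     * (of_int x + of_int y * t + of_int z * t^2) = of_int x ^ 3 + of_int x ^ 2 * of_int y * (- of_int u)
       + of_int x ^ 2 * of_int z * (of_int u ^ 2 - 2 * of_int v) + of_int x * of_int y ^ 2 * of_int v
       + of_int x * of_int y * of_int z * (3 * of_int w - of_int u * of_int v)
       + of_int x * of_int z ^ 2 * (of_int v ^ 2 - 2 * of_int u * of_int w)
       + (- of_int w) * (of_int y ^ 3 + of_int y ^ 2 * of_int z * (- of_int u) + of_int y * of_int z ^ 2 * of_int v
         + of_int z ^ 3 * (- of_int w))"
    unfolding prod_conjugates_expansion p2 p21 p22 e1 e2 e3 ..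
  also have "\<dots> = of_int (norm_form x y z)"
    unfolding norm_form_def of_int_add of_int_diff of_int_mult of_int_power of_int_numeral
    by (rule norm_form_identity)
  finally show ?thesis .
qed

end

context irreducible_cubic
begin

lemma irreducible_cubic_shift:
  "irreducible_cubic (u + 3 * n) (3 * n ^ 2 + 2 * u * n + v) (n ^ 3 + u * n ^ 2 + v * n + w)
     (r - of_int n) (s - of_int n) (t - of_int n)"
proof -
  have "m ^ 3 + (u + 3 * n) * m ^ 2 + (3 * n ^ 2 + 2 * u * n + v) * m + (n ^ 3 + u * n ^ 2 + v * n + w) \<noteq> 0" for m
    using no_root[of "m + n"] by (simp add: algebra_simps power2_eq_square power3_eq_cube)
  then show ?thesis
    using shift by (simp add: irreducible_cubic_def irreducible_cubic_axioms_def)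
qed

lemma conjugate_algebraic_int:
  assumes "algebraic_int (rat_eval q r)" "rat_eval R z = 0"
  shows "algebraic_int (rat_eval q z)"
proof -
  obtain p :: "int poly" where p: "poly (map_poly of_int p) (rat_eval q r) = 0" "lead_coeff p = 1"
    using assms(1) unfolding algebraic_int_altdef_ipoly by blast
  have "rat_eval (map_poly of_int p \<circ>\<^sub>p q) r = rat_eval 0 r"
    using p by (simp add: rat_eval_pcompose rat_eval_of_int_poly)
  then have "rat_eval (map_poly of_int p \<circ>\<^sub>p q) z = rat_eval 0 z"
    using conjugate_transfer[OF rat_eval_R(1) assms(2)] by blast
  then have "poly (map_poly of_int p) (rat_eval q z) = 0"
    by (simp add: rat_eval_pcompose rat_eval_of_int_poly)
  with p show ?thesis unfolding algebraic_int_altdef_ipoly by blast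
qed

lemma conjugates_algebraic_int:
  fixes x y z N :: int
  assumes "algebraic_int ((of_int x + of_int y * r + of_int z * r ^ 2) / of_int N)"
  shows "algebraic_int ((of_int x + of_int y * s + of_int z * s ^ 2) / of_int N)"
    "algebraic_int ((of_int x + of_int y * t + of_int z * t ^ 2) / of_int N)"
proof -
  define q where "q = [:of_int x / of_int N, of_int y / of_int N, of_int z / of_int N :: rat:]"
  have q: "rat_eval q \<theta> = (of_int x + of_int y * \<theta> + of_int z * \<theta> ^ 2) / of_int N" for \<theta>
    by (simp add: q_def of_rat_divide add_divide_distrib power2_eq_square algebra_simps)
  show "algebraic_int ((of_int x + of_int y * s + of_int z * s ^ 2) / of_int N)"
    "algebraic_int ((of_int x + of_int y * t + of_int z * t ^ 2) / of_int N)"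
    using assms conjugate_algebraic_int[of q, OF _ rat_eval_R(2)] conjugate_algebraic_int[of q, OF _ rat_eval_R(3)]
    unfolding q by blast+
qed

text \<open>For a prime \<open>N\<close> this says that \<open>N\<close> does not divide the index
  of Z[r] in the ring of integers.\<close>

definition saturated_at :: "int \<Rightarrow> bool" where
  "saturated_at N \<longleftrightarrow> (\<forall>x y z :: int. algebraic_int ((of_int x + of_int y * r + of_int z * r ^ 2) / of_int N)
      \<longrightarrow> N dvd x \<and> N dvd y \<and> N dvd z)"

text \<open>Cramer's rule: the three conjugates of the element form a Vandermonde system for its
  coordinates, so each coordinate times \<open>vandermonde\<close> is \<open>p\<close> times an
  algebraic integer. A second factor \<open>vandermonde\<close> makes this rational, and
  \<open>p\<close> divides the coordinate times the discriminant.\<close>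

lemma saturated_if_not_dvd_disc:
  assumes p: "Factorial_Ring.prime p" "\<not> p dvd disc"
  shows "saturated_at p"
  unfolding saturated_at_def
proof (intro allI impI)
  fix x y z :: int
  assume \<beta>r: "algebraic_int ((of_int x + of_int y * r + of_int z * r ^ 2) / of_int p)"
  note \<beta>s = conjugates_algebraic_int(1)[OF \<beta>r] and \<beta>t = conjugates_algebraic_int(2)[OF \<beta>r]
  have r: "algebraic_int r" by (rule algebraic_int_root)
  have s: "algebraic_int s" using rotate by (rule cubic_roots.algebraic_int_root)
  have t: "algebraic_int t" using cubic_roots.rotate[OF rotate] by (rule cubic_roots.algebraic_int_root)
  have p0: "p \<noteq> 0" using p by auto
  let ?\<beta> = "\<lambda>\<theta>. (of_int x + of_int y * \<theta> + of_int z * \<theta> ^ 2) / of_int p"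
  have V: "algebraic_int vandermonde"
    unfolding vandermonde_def by (intro algebraic_int_intros r s t)
  have key: "p dvd n" if "algebraic_int a" "a * of_int p = of_int n * vandermonde" for n a
  proof -
    have "a * vandermonde * of_int p = of_int n * vandermonde ^ 2"
      using that(2) by (simp add: power2_eq_square algebra_simps)
    then have "a * vandermonde = of_int (n * disc) / of_int p"
      using p0 by (simp add: vandermonde_squared field_simps)
    then have "algebraic_int (of_int (n * disc) / of_int p :: complex)"
      using algebraic_int_times[OF that(1) V] by simp
    then have "p dvd n * disc" using p0 by (rule of_int_div_algebraic_int)
    then show ?thesis using p by (simp add: prime_dvd_mult_iff)
  qed
  have clear: "(a / of_int p * b + c / of_int p * d + e / of_int p * f) * of_int p = a * b + c * d + e * f"
    for a b c d e f :: complex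
    using p0 by (simp add: field_simps)
  have "p dvd z"
  proof (rule key)
    show "algebraic_int (?\<beta> r * (t - s) + ?\<beta> s * (r - t) + ?\<beta> t * (s - r))"
      by (intro algebraic_int_intros r s t \<beta>r \<beta>s \<beta>t)
    show "(?\<beta> r * (t - s) + ?\<beta> s * (r - t) + ?\<beta> t * (s - r)) * of_int p = of_int z * vandermonde"
      unfolding clear vandermonde_def by (simp add: algebra_simps power2_eq_square)
  qed
  moreover have "p dvd y"
  proof (rule key)
    show "algebraic_int (?\<beta> r * (s^2 - t^2) + ?\<beta> s * (t^2 - r^2) + ?\<beta> t * (r^2 - s^2))"
      by (intro algebraic_int_intros r s t \<beta>r \<beta>s \<beta>t)
    show "(?\<beta> r * (s^2 - t^2) + ?\<beta> s * (t^2 - r^2) + ?\<beta> t * (r^2 - s^2)) * of_int p = of_int y * vandermonde"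
      unfolding clear vandermonde_def by (simp add: algebra_simps power2_eq_square)
  qed
  moreover have "p dvd x"
  proof (rule key)
    show "algebraic_int (?\<beta> r * (t^2 * s - s^2 * t) + ?\<beta> s * (r^2 * t - t^2 * r) + ?\<beta> t * (s^2 * r - r^2 * s))"
      by (intro algebraic_int_intros r s t \<beta>r \<beta>s \<beta>t)
    show "(?\<beta> r * (t^2 * s - s^2 * t) + ?\<beta> s * (r^2 * t - t^2 * r) + ?\<beta> t * (s^2 * r - r^2 * s)) * of_int p
        = of_int x * vandermonde"
      unfolding clear vandermonde_def by (simp add: algebra_simps power2_eq_square)
  qed
  ultimately show "p dvd x \<and> p dvd y \<and> p dvd z" by blast
qed

lemma norm_divisible:
  fixes x y z p :: int
  assumes "p \<noteq> 0" "algebraic_int ((of_int x + of_int y * r + of_int z * r ^ 2) / of_int p)"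
  shows "p ^ 3 dvd norm_form x y z"
proof -
  let ?\<beta> = "\<lambda>\<theta>. (of_int x + of_int y * \<theta> + of_int z * \<theta> ^ 2) / of_int p"
  have "algebraic_int (?\<beta> r * ?\<beta> s * ?\<beta> t)"
    using assms(2) conjugates_algebraic_int[OF assms(2)] by (intro algebraic_int_times)
  also have "?\<beta> r * ?\<beta> s * ?\<beta> t = of_int (norm_form x y z) / of_int (p ^ 3)"
    unfolding norm_form_eq[symmetric] by (simp add: power3_eq_cube)
  finally show ?thesis using assms(1) by (intro of_int_div_algebraic_int) auto
qed

text \<open>The coordinates are cleared one at a time by norms, which must be divisible by p^3.
  Modulo \<open>p\<close> the norm is x^3; once x / p is subtracted, the norm is divisible by
  \<open>w\<close> and the quotient is - y^3 modulo \<open>p\<close>; after y also the norm is w^2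
  z^3. Since \<open>p\<close> divides \<open>w\<close> exactly once, \<open>p\<close> divides each
  coordinate in turn.\<close>

lemma saturated_if_eisenstein:
  assumes p: "Factorial_Ring.prime p" "p dvd u" "p dvd v" "p dvd w" "\<not> p ^ 2 dvd w"
  shows "saturated_at p"
  unfolding saturated_at_def
proof (intro allI impI)
  fix x y z :: int
  assume \<beta>: "algebraic_int ((of_int x + of_int y * r + of_int z * r ^ 2) / of_int p)"
  have p0: "p \<noteq> 0" using p by auto
  have r: "algebraic_int r" by (rule algebraic_int_root)
  obtain w' where w: "w = p * w'" using p(4) by blast
  have w': "\<not> p dvd w'" using p(5) by (auto simp: w power2_eq_square)
  have "p dvd norm_form x y z"
    using norm_divisible[OF p0 \<beta>] by (rule dvd_trans[rotated]) simp
  moreover have "p dvd norm_form x y z - x ^ 3"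
  proof -
    obtain u' v' where "u = p * u'" "v = p * v'" using p by (auto elim!: dvdE)
    then have "norm_form x y z - x ^ 3 = p * (- u' * x^2 * y + (p * u'^2 - 2 * v') * x^2 * z + v' * x * y^2
        + (3 * w' - u' * v) * x * y * z + (p * v'^2 - 2 * u' * w) * x * z^2 - w' * y^3 + u' * w * y^2 * z
        - v' * w * y * z^2 + p * w'^2 * z^3)"
      unfolding norm_form_def by (simp add: w algebra_simps power2_eq_square)
    then show ?thesis by simp
  qed
  ultimately have "p dvd x ^ 3" by (metis dvd_diff_right_iff)
  then have x: "p dvd x" using p(1) prime_dvd_power by blast
  then obtain x' where x': "x = p * x'" by blast
  have "algebraic_int ((of_int x + of_int y * r + of_int z * r ^ 2) / of_int p - of_int x')"
    by (intro algebraic_int_intros \<beta>)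
  also have "(of_int x + of_int y * r + of_int z * r ^ 2) / of_int p - of_int x'
      = (of_int 0 + of_int y * r + of_int z * r ^ 2) / of_int p"
    using p0 by (simp add: x' field_simps)
  finally have \<beta>': "algebraic_int ((of_int 0 + of_int y * r + of_int z * r ^ 2) / of_int p)" .
  have "p ^ 3 dvd norm_form 0 y z" by (rule norm_divisible[OF p0 \<beta>'])
  also have "norm_form 0 y z = p * (w' * (- (y^3) + u * y^2 * z - v * y * z^2 + w * z^3))"
    unfolding norm_form_def by (simp add: w algebra_simps power2_eq_square)
  finally have "p * p dvd w' * (- (y^3) + u * y^2 * z - v * y * z^2 + w * z^3)"
    using p0 by (simp add: power3_eq_cube mult.assoc)
  then have "p dvd w' * (- (y^3) + u * y^2 * z - v * y * z^2 + w * z^3)" using dvd_mult_left by blast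
  then have A: "p dvd - (y^3) + u * y^2 * z - v * y * z^2 + w * z^3"
    using p(1) w' by (simp only: prime_dvd_mult_iff) simp
  have "p dvd u * y^2 * z - v * y * z^2 + w * z^3"
    using p by (intro dvd_add dvd_diff dvd_mult2)
  from dvd_diff[OF this A] have "p dvd y ^ 3" by simp
  then have y: "p dvd y" using p(1) prime_dvd_power by blast
  then obtain y' where y': "y = p * y'" by blast
  have "algebraic_int ((of_int 0 + of_int y * r + of_int z * r ^ 2) / of_int p - of_int y' * r)"
    by (intro algebraic_int_intros \<beta>' r)
  also have "(of_int 0 + of_int y * r + of_int z * r ^ 2) / of_int p - of_int y' * r
      = (of_int 0 + of_int 0 * r + of_int z * r ^ 2) / of_int p"
    using p0 by (simp add: y' field_simps)
  finally have \<beta>'': "algebraic_int ((of_int 0 + of_int 0 * r + of_int z * r ^ 2) / of_int p)" .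
  have "p ^ 3 dvd norm_form 0 0 z" by (rule norm_divisible[OF p0 \<beta>''])
  also have "norm_form 0 0 z = p * p * (w' * w' * z ^ 3)"
    unfolding norm_form_def by (simp add: w algebra_simps power2_eq_square)
  finally have "p dvd w' * w' * z ^ 3"
    using p0 by (simp add: power3_eq_cube mult.assoc)
  then have "p dvd z ^ 3" using p(1) w' by (simp add: prime_dvd_mult_iff)
  then have z: "p dvd z" using p(1) prime_dvd_power by blast
  from x y z show "p dvd x \<and> p dvd y \<and> p dvd z" by blast
qed

text \<open>Z[r] and Z[r - n] coincide, and the change of coordinates between the two power bases is
  unitriangular over the integers.\<close>

lemma saturated_if_eisenstein_shift:
  assumes p: "Factorial_Ring.prime p" "p dvd u + 3 * n" "p dvd 3 * n ^ 2 + 2 * u * n + v"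
    "p dvd n ^ 3 + u * n ^ 2 + v * n + w" "\<not> p ^ 2 dvd n ^ 3 + u * n ^ 2 + v * n + w"
  shows "saturated_at p"
  unfolding saturated_at_def
proof (intro allI impI)
  fix x y z :: int
  assume \<beta>: "algebraic_int ((of_int x + of_int y * r + of_int z * r ^ 2) / of_int p)"
  interpret S: irreducible_cubic "u + 3 * n" "3 * n ^ 2 + 2 * u * n + v" "n ^ 3 + u * n ^ 2 + v * n + w"
    "r - of_int n" "s - of_int n" "t - of_int n" by (rule irreducible_cubic_shift)
  have "a + b * r + c * r ^ 2 = (a + b * m + c * m ^ 2) + (b + 2 * c * m) * (r - m) + c * (r - m) ^ 2"
    for a b c m :: complex
    by (simp add: algebra_simps power2_eq_square)
  from this[of "of_int x" "of_int y" "of_int z" "of_int n"]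
  have "of_int x + of_int y * r + of_int z * r ^ 2 = of_int (x + y * n + z * n ^ 2)
      + of_int (y + 2 * z * n) * (r - of_int n) + of_int z * (r - of_int n) ^ 2" by simp
  with \<beta> have "algebraic_int ((of_int (x + y * n + z * n ^ 2)
      + of_int (y + 2 * z * n) * (r - of_int n) + of_int z * (r - of_int n) ^ 2) / of_int p)" by simp
  then have d: "p dvd x + y * n + z * n ^ 2" "p dvd y + 2 * z * n" "p dvd z"
    using S.saturated_if_eisenstein[OF p] unfolding S.saturated_at_def by blast+
  then have y: "p dvd y" by (metis dvd_add_left_iff dvd_mult dvd_mult2)
  then have "p dvd x" using d by (metis dvd_add_left_iff dvd_mult2)
  with y d show "p dvd x \<and> p dvd y \<and> p dvd z" by blast
qed

lemma saturated_at_all: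
  assumes sat: "\<And>p. Factorial_Ring.prime p \<Longrightarrow> saturated_at p"
  shows "N > 0 \<Longrightarrow> saturated_at (int N)"
proof (induction N rule: less_induct)
  case (less N)
  show ?case
  proof (cases "N = 1")
    case True then show ?thesis by (simp add: saturated_at_def)
  next
    case False
    then obtain p where p: "Factorial_Ring.prime p" "p dvd N" by (metis prime_factor_nat)
    then obtain M where N: "N = p * M" by blast
    have M: "M > 0" "M < N" using less.prems p prime_gt_1_nat[OF p(1)] by (auto simp: N)
    have nz: "p \<noteq> 0" "M \<noteq> 0" using M p by auto
    have pi: "Factorial_Ring.prime (int p)" using p by simp
    show ?thesis
      unfolding saturated_at_def
    proof (intro allI impI)
      fix x y z :: int
      assume \<beta>: "algebraic_int ((of_int x + of_int y * r + of_int z * r ^ 2) / of_int (int N))"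
      have "algebraic_int ((of_int x + of_int y * r + of_int z * r ^ 2) / of_int (int N) * of_int (int M))"
        by (intro algebraic_int_intros \<beta>)
      also have "(of_int x + of_int y * r + of_int z * r ^ 2) / of_int (int N) * of_int (int M)
          = (of_int x + of_int y * r + of_int z * r ^ 2) / of_int (int p)"
        using nz by (simp add: N field_simps)
      finally have "int p dvd x \<and> int p dvd y \<and> int p dvd z"
        using sat[OF pi] unfolding saturated_at_def by blast
      then obtain x' y' z' where xyz: "x = int p * x'" "y = int p * y'" "z = int p * z'" by (auto elim!: dvdE)
      have "(of_int x + of_int y * r + of_int z * r ^ 2) / of_int (int N)
          = (of_int x' + of_int y' * r + of_int z' * r ^ 2) / of_int (int M)"
        using nz by (simp add: N xyz field_simps)
      with \<beta> have "int M dvd x' \<and> int M dvd y' \<and> int M dvd z'"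
        using less.IH[OF M(2,1)] unfolding saturated_at_def by simp
      then show "int N dvd x \<and> int N dvd y \<and> int N dvd z" by (simp add: N xyz)
    qed
  qed
qed

lemma common_denominator:
  fixes a b c :: rat
  obtains N :: nat and x y z where "N > 0" "a = of_int x / of_nat N" "b = of_int y / of_nat N" "c = of_int z / of_nat N"
proof -
  have quotient: "\<exists>n d. x = of_int n / of_int d \<and> d > 0" for x :: rat
    by (metis Fract_of_int_quotient Rat_cases)
  obtain a1 a2 b1 b2 c1 c2 where a: "a = of_int a1 / of_int a2" "a2 > 0"
    and b: "b = of_int b1 / of_int b2" "b2 > 0" and c: "c = of_int c1 / of_int c2" "c2 > 0"
    using quotient[of a] quotient[of b] quotient[of c] by blast
  show ?thesis
  proof (rule that)
    show "nat (a2 * b2 * c2) > 0" using a b c by simp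
    have "(of_nat (nat (a2 * b2 * c2)) :: rat) = of_int (a2 * b2 * c2)" using a b c by simp
    then show "a = of_int (a1 * b2 * c2) / of_nat (nat (a2 * b2 * c2))"
      "b = of_int (b1 * a2 * c2) / of_nat (nat (a2 * b2 * c2))"
      "c = of_int (c1 * a2 * b2) / of_nat (nat (a2 * b2 * c2))"
      using a b c by (simp_all add: field_simps)
  qed
qed

definition int_span :: "complex set" where
  "int_span = {of_int a + of_int b * r + of_int c * r ^ 2 | a b c. True}"

lemma powers_eq: "{r ^ i | i. i < Polynomial.degree P} = {1, r, r ^ 2}"
proof -
  have "{r ^ i | i. i < Polynomial.degree P} = (\<lambda>i. r ^ i) ` {..<3}" by auto
  also have "{..<3} = {0, 1, 2 :: nat}" by auto
  finally show ?thesis by simp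
qed

lemma powers_distinct: "1 \<noteq> r" "1 \<noteq> r ^ 2" "r \<noteq> r ^ 2"
  using lin_indep_of_int(2)[of "-1" 1 0] lin_indep_of_int(3)[of "-1" 0 1] lin_indep_of_int(3)[of 0 "-1" 1] by auto

lemma is_int_basis_iff: "is_int_basis {1, r, r ^ 2} M \<longleftrightarrow> M = int_span"
proof -
  have "int_module.span {1, r, r ^ 2} = int_span"
  proof -
    have "x \<in> int_module.span {1, r, r ^ 2} \<longleftrightarrow> (\<exists>a b c. x - of_int a * 1 - of_int b * r - of_int c * r ^ 2 = 0)" for x
      by (simp add: int_module.span_insert)
    also have "\<dots> x \<longleftrightarrow> x \<in> int_span" for x
      by (auto simp: int_span_def algebra_simps)
    finally show ?thesis by blast
  qed
  moreover have "\<not> int_module.dependent {1, r, r ^ 2}"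
    using lin_indep_of_int powers_distinct
    by (auto simp: int_module.dependent_finite add.assoc)
  ultimately show ?thesis by (auto simp: is_int_basis_def)
qed

lemma int_span_subset: "int_span \<subseteq> ring_of_integers (adjoin_rat {r})"
proof -
  interpret K: rat_subfield "adjoin_rat {r}" by (rule rat_subfield_adjoin_rat)
  have "r \<in> adjoin_rat {r}" using adjoin_rat_superset by blast
  then show ?thesis
    by (auto simp: int_span_def ring_of_integers_def intro!: K.closed algebraic_int_intros algebraic_int_root)
qed

lemma ring_of_integers_if_saturated:
  assumes sat: "\<And>p. Factorial_Ring.prime p \<Longrightarrow> saturated_at p"
  shows "ring_of_integers (adjoin_rat {r}) = int_span"
proof (intro equalityI int_span_subset subsetI)
  fix x assume "x \<in> ring_of_integers (adjoin_rat {r})"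
  then have x: "x \<in> adjoin_rat {r}" "algebraic_int x" by (auto simp: ring_of_integers_def)
  obtain a b c where abc: "x = rat_eval [:a, b, c:] r" using x(1) by (rule adjoin_rat_elim)
  obtain N :: nat and k l m where N: "N > 0" "a = of_int k / of_nat N" "b = of_int l / of_nat N" "c = of_int m / of_nat N"
    by (rule common_denominator)
  have xN: "x = (of_int k + of_int l * r + of_int m * r ^ 2) / of_int (int N)"
    unfolding abc N(2-4) by (simp add: of_rat_divide add_divide_distrib power2_eq_square algebra_simps)
  then have "int N dvd k \<and> int N dvd l \<and> int N dvd m"
    using saturated_at_all[OF sat N(1)] x(2) unfolding saturated_at_def by blast
  then obtain k' l' m' where "k = int N * k'" "l = int N * l'" "m = int N * m'" by (auto elim!: dvdE)
  then have "x = of_int k' + of_int l' * r + of_int m' * r ^ 2"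
    using N(1) by (simp add: xN field_simps)
  then show "x \<in> int_span" by (auto simp: int_span_def)
qed

lemma ring_of_integers_if_monogenic:
  assumes "monogenic P"
  shows "ring_of_integers (adjoin_rat {r}) = int_span"
proof -
  have "r \<in> complex_roots P" by (simp add: complex_roots_eq)
  then have "is_int_basis {r ^ i | i. i < Polynomial.degree P} (ring_of_integers (adjoin_rat {r}))"
    using assms unfolding monogenic_def by blast
  then show ?thesis unfolding powers_eq is_int_basis_iff .
qed

end

text \<open>A prime is harmless if it misses the discriminant or if some translate of the polynomial
  is Eisenstein at it. The hypothesis does not mention the root, which is what serves all roots in
  \<open>monogenic\<close> at once.\<close>

lemma (in irreducible_cubic) monogenicI:
  assumes local: "\<And>p :: int. Factorial_Ring.prime p \<Longrightarrow> p dvd disc \<Longrightarrow>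
    \<exists>n. p dvd u + 3 * n \<and> p dvd 3 * n ^ 2 + 2 * u * n + v
      \<and> p dvd n ^ 3 + u * n ^ 2 + v * n + w \<and> \<not> p ^ 2 dvd n ^ 3 + u * n ^ 2 + v * n + w"
  shows "monogenic P"
proof -
  have basis: "is_int_basis {x ^ i | i. i < Polynomial.degree P} (ring_of_integers (adjoin_rat {x}))"
    if "irreducible_cubic u v w x y z" for x y z
  proof -
    interpret X: irreducible_cubic u v w x y z by (rule that)
    have "X.saturated_at p" if "Factorial_Ring.prime p" for p
      using local[OF that] X.saturated_if_not_dvd_disc[OF that] X.saturated_if_eisenstein_shift[OF that]
      by blast
    then show ?thesis
      unfolding X.powers_eq X.is_int_basis_iff by (rule X.ring_of_integers_if_saturated)
  qed
  have "irreducible_cubic u v w s t r" "irreducible_cubic u v w t r s"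
    using irreducible_cubic_rotate irreducible_cubic.irreducible_cubic_rotate by blast+
  then show ?thesis
    unfolding monogenic_def complex_roots_eq
    using monic_irreducible basis[OF irreducible_cubic_axioms] basis by blast
qed

section \<open>Obstructions to monogenicity and invariance of the discriminant\<close>

text \<open>An explicit integral equation for \<beta> = (y^2 + a y) / p. The cubic gives \<beta> y =
  - b y - p c; multiplying by y + a and dividing by p gives \<beta>^2 + b \<beta> = - c (y + a);
  eliminating y between the two leaves a monic cubic in \<beta>.\<close>

lemma dedekind_identity:
  fixes a b c p y \<beta> :: "'a :: field"
  assumes p: "p \<noteq> 0" and y: "y ^ 3 + a * y ^ 2 + p * b * y + p ^ 2 * c = 0"
    and \<beta>: "p * \<beta> = y ^ 2 + a * y"
  shows "\<beta> ^ 3 + 2 * b * \<beta> ^ 2 + (b ^ 2 + c * a) * \<beta> + (c * b * a - p * c ^ 2) = 0"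
proof -
  have "p * (\<beta> * y + b * y + p * c) = (p * \<beta>) * y + p * b * y + p ^ 2 * c"
    by (simp add: algebra_simps power2_eq_square)
  also have "\<dots> = 0"
    using y unfolding \<beta> by (simp add: algebra_simps power2_eq_square power3_eq_cube)
  finally have \<beta>y: "\<beta> * y + b * y + p * c = 0" using p by simp
  have "p * (\<beta> ^ 2 + b * \<beta> + c * (y + a)) = \<beta> * (p * \<beta>) + b * (p * \<beta>) + p * c * (y + a)"
    by (simp add: algebra_simps power2_eq_square)
  also have "\<dots> = (\<beta> * y + b * y + p * c) * (y + a)"
    unfolding \<beta> by (simp add: algebra_simps power2_eq_square)
  finally have \<beta>2: "\<beta> ^ 2 + b * \<beta> + c * (y + a) = 0" using \<beta>y p by simp
  have "\<beta> ^ 3 + 2 * b * \<beta> ^ 2 + (b ^ 2 + c * a) * \<beta> + (c * b * a - p * c ^ 2)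
      = (\<beta> + b) * (\<beta> ^ 2 + b * \<beta> + c * (y + a)) - c * (\<beta> * y + b * y + p * c)"
    by (simp add: algebra_simps power2_eq_square power3_eq_cube)
  then show ?thesis unfolding \<beta>2 \<beta>y by simp
qed

text \<open>The index form of a cubic order. For g(x) = a + b x + c x^2 the factors on the right are
  the difference quotients (g(r) - g(s)) / (r - s) and so on.\<close>

lemma index_form_identity:
  fixes b c r s t :: "'a :: comm_ring_1"
  shows "(b - c * - (r + s + t)) ^ 3 + - (r + s + t) * (b - c * - (r + s + t)) ^ 2 * c
      + (r * s + s * t + t * r) * (b - c * - (r + s + t)) * c ^ 2 + - (r * s * t) * c ^ 3
    = (b + c * (r + s)) * (b + c * (s + t)) * (b + c * (t + r))"
  by (simp add: algebra_simps power2_eq_square power3_eq_cube)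

context irreducible_cubic
begin

text \<open>
  With \<open>y = r - n\<close>, the element \<open>(y\<^sup>2 + (u + 3n) y) / p\<close> would be integral: this is the converse
  half of Dedekind's criterion at a multiple root \<open>n\<close> modulo \<open>p\<close>.
\<close>

lemma not_monogenic:
  fixes p n :: int
  assumes p: "p > 1" "p dvd 3 * n ^ 2 + 2 * u * n + v" "p ^ 2 dvd n ^ 3 + u * n ^ 2 + v * n + w"
  shows "\<not> monogenic P"
proof
  assume mono: "monogenic P"
  interpret K: rat_subfield "adjoin_rat {r}" by (rule rat_subfield_adjoin_rat)
  have rK: "r \<in> adjoin_rat {r}" using adjoin_rat_superset by blast
  obtain b where b: "3 * n ^ 2 + 2 * u * n + v = p * b" using p(2) by blast
  obtain c where c: "n ^ 3 + u * n ^ 2 + v * n + w = p ^ 2 * c" using p(3) by blast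
  define a where "a = u + 3 * n"
  define y where "y = r - of_int n"
  define \<beta> where "\<beta> = (y ^ 2 + of_int a * y) / of_int p"
  have p0: "(of_int p :: complex) \<noteq> 0" using p by simp
  have y: "y ^ 3 + of_int a * y ^ 2 + of_int (p * b) * y + of_int (p ^ 2 * c) = 0"
    using cubic_roots.root_eq[OF shift[of n]] unfolding a_def y_def b c .
  have py: "y ^ 2 + of_int a * y = of_int p * \<beta>" using p0 by (simp add: \<beta>_def)
  have "\<beta> ^ 3 + of_int (2 * b) * \<beta> ^ 2 + of_int (b ^ 2 + c * a) * \<beta> + of_int (c * b * a - p * c ^ 2) = 0"
    using dedekind_identity[OF p0 _ py[symmetric], of "of_int b" "of_int c"] y by simp
  then have "algebraic_int \<beta>" by (rule algebraic_int_cubicI)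
  moreover have "\<beta> \<in> adjoin_rat {r}"
    unfolding \<beta>_def y_def by (intro K.closed rK)
  ultimately have "\<beta> \<in> int_span"
    using ring_of_integers_if_monogenic[OF mono] by (auto simp: ring_of_integers_def)
  then obtain k l m where klm: "\<beta> = of_int k + of_int l * r + of_int m * r ^ 2" by (auto simp: int_span_def)
  \<comment> \<open>Compares coordinates: \<open>\<beta>\<close> has the coefficient 1 / p at r^2,
    which cannot be the integer \<open>m\<close>.\<close>
  have "(p' * k' - n' ^ 2 + a' * n') + (p' * l' + 2 * n' - a') * r + (p' * m' - 1) * r ^ 2
      = p' * (k' + l' * r + m' * r ^ 2) - ((r - n') ^ 2 + a' * (r - n'))" for p' k' l' m' n' a'
    by (simp add: algebra_simps power2_eq_square)
  from this[of "of_int p" "of_int k" "of_int n" "of_int a" "of_int l" "of_int m"]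
  have "of_int (p * k - n ^ 2 + a * n) + of_int (p * l + 2 * n - a) * r + of_int (p * m - 1) * r ^ 2
      = of_int p * \<beta> - (y ^ 2 + of_int a * y)"
    unfolding klm y_def by simp
  also have "\<dots> = 0" by (simp add: py)
  finally have "p * m - 1 = 0" by (rule lin_indep_of_int(3))
  then have "p dvd 1" by (metis dvd_triv_left eq_iff_diff_eq_0)
  then show False using p(1) by simp
qed

text \<open>The conjugates of r' = g(r) are g(r), g(s), g(t), whose product of differences is that
  of r, s, t times the index form \<open>I\<close>. The discriminant is therefore multiplied by the
  square of an integer.\<close>

lemma disc_dvd_of_int_combination:
  fixes a b c :: int
  assumes X: "irreducible_cubic u' v' w' r' s' t'"
    and r': "r' = of_int a + of_int b * r + of_int c * r ^ 2"
  shows "disc dvd cubic_disc u' v' w'"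
proof -
  interpret X: irreducible_cubic u' v' w' r' s' t' by (rule X)
  define g where "g \<theta> = of_int a + of_int b * \<theta> + of_int c * \<theta> ^ 2" for \<theta> :: complex
  define q where "q = [:of_int a, of_int b, of_int c :: rat:]"
  have q: "rat_eval q \<theta> = g \<theta>" for \<theta> by (simp add: q_def g_def algebra_simps power2_eq_square)
  have root: "g \<theta> \<in> {r', s', t'}" if "rat_eval R \<theta> = 0" for \<theta>
  proof -
    have "rat_eval (X.R \<circ>\<^sub>p q) r = rat_eval 0 r"
      using X.rat_eval_R(1) by (simp add: rat_eval_pcompose q r' g_def)
    then have "rat_eval (X.R \<circ>\<^sub>p q) \<theta> = rat_eval 0 \<theta>"
      using conjugate_transfer[OF rat_eval_R(1) that] by blast
    then have "rat_eval X.R (g \<theta>) = 0" by (simp add: rat_eval_pcompose q)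
    then show ?thesis unfolding X.R_def rat_eval_of_int_poly poly_cubic X.factorization by auto
  qed
  have inj: "g x \<noteq> g y" if "irreducible_cubic u v w x y z" for x y z
  proof
    interpret Y: irreducible_cubic u v w x y z by (rule that)
    assume eq: "g x = g y"
    \<comment> \<open>Here g(x) - g(y) = (x - y) (b + c (x + y)), and x + y = - u - z turns the
      second factor into a linear relation for the third root. It forces b = c = 0, so r' would be
      an integer.\<close>
    have "(x - y) * (of_int (b - c * u) + of_int (- c) * z + of_int 0 * z ^ 2) = 0"
    proof -
      have u: "of_int u = - (x + y + z)" using Y.e1 by simp
      have "(x - y) * (of_int (b - c * u) + of_int (- c) * z + of_int 0 * z ^ 2) = g x - g y"
        unfolding of_int_diff of_int_mult of_int_minus u by (simp add: g_def algebra_simps power2_eq_square)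
      then show ?thesis using eq by simp
    qed
    then have 0: "of_int (b - c * u) + of_int (- c) * z + of_int 0 * z ^ 2 = 0"
      using Y.roots_distinct by simp
    interpret Z: irreducible_cubic u v w z x y
      by (rule irreducible_cubic.irreducible_cubic_rotate[OF Y.irreducible_cubic_rotate])
    have "b = 0" "c = 0" using Z.lin_indep_of_int(1,2)[OF 0] by auto
    then have "of_int (- a) + of_int 1 * r' + of_int 0 * r' ^ 2 = 0" by (simp add: r')
    then have "(1 :: int) = 0" by (rule X.lin_indep_of_int(2))
    then show False by simp
  qed
  have ne: "g r \<noteq> g s" "g s \<noteq> g t" "g t \<noteq> g r"
    using inj irreducible_cubic_axioms irreducible_cubic_rotate
      irreducible_cubic.irreducible_cubic_rotate[OF irreducible_cubic_rotate] by blast+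
  \<comment> \<open>Three distinct values among r', s', t' form a permutation of them, and nothing
    determines which; every order satisfies Vieta's relations.\<close>
  have rots: "cubic_roots u' v' w' r' t' s'" "cubic_roots u' v' w' s' r' t'" "cubic_roots u' v' w' s' t' r'"
    "cubic_roots u' v' w' t' r' s'" "cubic_roots u' v' w' t' s' r'"
    using X.swap X.rotate cubic_roots.rotate[OF X.rotate] cubic_roots.rotate[OF X.swap]
      cubic_roots.rotate[OF cubic_roots.rotate[OF X.swap]] by blast+
  have "cubic_roots u' v' w' (g r) (g s) (g t)"
    using root[OF rat_eval_R(1)] root[OF rat_eval_R(2)] root[OF rat_eval_R(3)] ne rots X.cubic_roots_axioms
    by auto
  then interpret Y: cubic_roots u' v' w' "g r" "g s" "g t" .
  define I where "I = (b - c * u) ^ 3 + u * (b - c * u) ^ 2 * c + v * (b - c * u) * c ^ 2 + w * c ^ 3"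
  have "Y.vandermonde = vandermonde * of_int I"
  proof -
    have uw: "of_int u = - (r + s + t)" "of_int w = - (r * s * t)" using e1 e3 by simp_all
    have "(of_int I :: complex) = (of_int b - of_int c * of_int u) ^ 3
        + of_int u * (of_int b - of_int c * of_int u) ^ 2 * of_int c
        + of_int v * (of_int b - of_int c * of_int u) * of_int c ^ 2 + of_int w * of_int c ^ 3"
      unfolding I_def of_int_add of_int_diff of_int_mult of_int_power ..
    then have I: "(of_int I :: complex)
        = (of_int b + of_int c * (r + s)) * (of_int b + of_int c * (s + t)) * (of_int b + of_int c * (t + r))"
      unfolding uw e2[symmetric] by (simp only: index_form_identity)
    have diff: "g x - g y = (x - y) * (of_int b + of_int c * (x + y))" for x y
      by (simp add: g_def algebra_simps power2_eq_square)
    show ?thesis unfolding Y.vandermonde_def vandermonde_def diff I by (simp only: mult_ac)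
  qed
  then have "(of_int Y.disc :: complex) = of_int (disc * I ^ 2)"
    unfolding Y.vandermonde_squared[symmetric]
    by (simp add: power_mult_distrib vandermonde_squared)
  then have "Y.disc = disc * I ^ 2" by (simp only: of_int_eq_iff)
  then show ?thesis by simp
qed

lemma disc_dvd_if_field_eq:
  assumes X: "irreducible_cubic u' v' w' r' s' t'" and mono: "monogenic P"
    and K: "adjoin_rat {r'} = adjoin_rat {r}"
  shows "disc dvd cubic_disc u' v' w'"
proof -
  have "algebraic_int r'"
    by (rule cubic_roots.algebraic_int_root[OF irreducible_cubic.axioms(1)[OF X]])
  then have "r' \<in> ring_of_integers (adjoin_rat {r})"
    using K adjoin_rat_superset[of "{r'}"] by (auto simp: ring_of_integers_def)
  then obtain a b c where "r' = of_int a + of_int b * r + of_int c * r ^ 2"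
    unfolding ring_of_integers_if_monogenic[OF mono] by (auto simp: int_span_def)
  then show ?thesis using disc_dvd_of_int_combination[OF X] by blast
qed

end

text \<open>
  The powers of a root form an integral basis, so that the discriminant of the polynomial is the
  discriminant of its splitting field.
\<close>

lemma disc_eq_if_equivalent:
  assumes "monogenic [:w, v, u, 1:]" "monogenic [:w', v', u', 1:]"
    and "d ^ 2 = cubic_disc u v w" "d' ^ 2 = cubic_disc u' v' w'"
    and eq: "equivalent [:w, v, u, 1:] [:w', v', u', 1:]"
  shows "cubic_disc u v w = cubic_disc u' v' w'"
proof -
  have "monic_irreducible [:w, v, u, 1:]" "monic_irreducible [:w', v', u', 1:]"
    using assms by (auto simp: monogenic_def)
  then obtain r s t r' s' t' where X: "irreducible_cubic u v w r s t" and Y: "irreducible_cubic u' v' w' r' s' t'"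
    by (metis monic_irreducible_cubicE)
  interpret X: irreducible_cubic u v w r s t by (rule X)
  interpret Y: irreducible_cubic u' v' w' r' s' t' by (rule Y)
  have K: "adjoin_rat {r'} = adjoin_rat {r}"
    using eq X.splitting_field_if_disc_square[OF assms(3)] Y.splitting_field_if_disc_square[OF assms(4)]
    by (simp add: equivalent_def)
  have "X.disc dvd Y.disc" using X.disc_dvd_if_field_eq[OF Y assms(1) K] .
  moreover have "Y.disc dvd X.disc" using Y.disc_dvd_if_field_eq[OF X assms(2) K[symmetric]] .
  moreover have "X.disc \<ge> 0" "Y.disc \<ge> 0" using assms(3,4) by (metis zero_le_power2)+
  ultimately show ?thesis by (intro zdvd_antisym_nonneg)
qed

section \<open>Squarefree values of quadratic polynomials\<close>

lemma prime_nat_3: "Factorial_Ring.prime (3 :: nat)"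
  by simp

text \<open>Modulo \<open>p\<close> the number \<open>k\<close> has order 3: its cube is 1, and k =
  1 would give p = 3. Fermat then makes 3 divide p - 1, and k^2 + k + 1 is odd.\<close>

lemma prime_dvd_quadratic_mod_6:
  fixes p k :: nat
  assumes p: "Factorial_Ring.prime p" "p \<noteq> 3" and dvd: "p dvd k ^ 2 + k + 1"
  shows "p mod 6 = 1"
proof -
  have "odd (k ^ 2 + k + 1)" by simp
  then have p2: "p \<noteq> 2" using dvd by (metis dvd_trans)
  have odd: "p mod 2 = 1" using p p2 prime_ge_2_nat[OF p(1)] prime_odd_nat[of p] by (simp add: odd_iff_mod_2_eq_one)
  have p3: "p mod 3 \<noteq> 0" using p primes_dvd_imp_eq[OF prime_nat_3 p(1)] by (auto simp: dvd_eq_mod_eq_0[symmetric])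
  have k: "\<not> p dvd k"
  proof
    assume "p dvd k"
    then have "p dvd k ^ 2 + k" by (simp add: power2_eq_square)
    with dvd have "p dvd 1" using dvd_add_right_iff by blast
    with p show False by simp
  qed
  have ne1: "\<not> [k = 1] (mod p)"
  proof
    assume "[k = 1] (mod p)"
    then have "[k ^ 2 + k + 1 = 1 ^ 2 + 1 + 1] (mod p)" by (intro cong_add cong_pow) auto
    then have "p dvd 3" using dvd by (simp add: cong_dvd_iff numeral_3_eq_3)
    with p show False using primes_dvd_imp_eq[OF p(1) prime_nat_3] by simp
  qed
  have "k ^ 3 + k ^ 2 + k = k * (k ^ 2 + k + 1)" by (simp add: algebra_simps power2_eq_square power3_eq_cube)
  then have "[k ^ 3 + (k ^ 2 + k) = 0] (mod p)" using dvd by (metis add.assoc cong_0_iff dvd_mult)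
  moreover have "[1 + (k ^ 2 + k) = 0] (mod p)" using dvd by (simp add: cong_0_iff add.commute)
  ultimately have cube: "[k ^ 3 = 1] (mod p)" by (metis cong_add_rcancel_nat cong_sym cong_trans)
  have fermat: "[k ^ (p - 1) = 1] (mod p)" using fermat_theorem[OF p(1) k] .
  have "p mod 3 = 1"
  proof (rule ccontr)
    assume "p mod 3 \<noteq> 1"
    then have "p mod 3 = 2" using p3 by linarith
    then have "p = p div 3 * 3 + 2" by (metis div_mult_mod_eq)
    then have "p - 1 = 3 * (p div 3) + 1" by linarith
    then have "k ^ (p - 1) = (k ^ 3) ^ (p div 3) * k" by (simp add: power_mult power_add)
    moreover have "[(k ^ 3) ^ (p div 3) * k = 1 ^ (p div 3) * k] (mod p)"
      by (intro cong_mult cong_pow cube) simp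
    ultimately have "[k = 1] (mod p)" using fermat by (metis cong_sym cong_trans mult_1 power_one)
    with ne1 show False ..
  qed
  with odd show ?thesis by presburger
qed

lemma card_residue_class_le:
  fixes q N :: nat
  assumes "q > 0"
  shows "card {k. k < N \<and> k mod q = a} \<le> N div q + 1"
proof -
  have "inj_on (\<lambda>k. k div q) {k. k < N \<and> k mod q = a}"
    by (rule inj_onI) (metis (mono_tags, lifting) div_mult_mod_eq mem_Collect_eq)
  moreover have "(\<lambda>k. k div q) ` {k. k < N \<and> k mod q = a} \<subseteq> {..N div q}"
    by (auto intro!: div_le_mono)
  ultimately have "card {k. k < N \<and> k mod q = a} \<le> card {..N div q}"
    by (intro card_inj_on_le) auto
  then show ?thesis by simp
qed

text \<open>Telescoping: (6 i + 1)^2 exceeds (6 i - 2) (6 i + 4), whose reciprocal is one sixth of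
  the difference of 1 / (6 i - 2) and 1 / (6 i + 4). The sum starts with 1 / (6 * 4).\<close>

lemma sum_inverse_squares_le: "(\<Sum>i=1..n. 1 / real (6 * i + 1) ^ 2) \<le> 1 / 24"
proof -
  have "(\<Sum>i=1..n. 1 / real (6 * i + 1) ^ 2) \<le> 1 / 24 - 1 / (6 * real (6 * n + 4))"
  proof (induction n)
    case (Suc n)
    define x where "x = real (6 * n + 4)"
    have x: "x > 0" by (simp add: x_def)
    have "1 / (x + 3) ^ 2 \<le> 1 / (x * (x + 6))"
      using x by (intro divide_left_mono) (auto simp: power2_eq_square algebra_simps intro!: add_pos_pos mult_pos_pos)
    also have "\<dots> = 1 / (6 * x) - 1 / (6 * (x + 6))"
    proof -
      define a b where "a = 1 / x" and "b = 1 / (x + 6)"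
      have "a * x = 1" "b * (x + 6) = 1" using x by (simp_all add: a_def b_def)
      then have "a - b = a * (b * (x + 6)) - b * (a * x)" by simp
      also have "\<dots> = 6 * (a * b)" by (simp add: algebra_simps)
      finally have "a * b = a / 6 - b / 6" by simp
      moreover have "a * b = 1 / (x * (x + 6))" "a / 6 = 1 / (6 * x)" by (simp_all add: a_def b_def)
      moreover have "b / 6 = 1 / (6 * (x + 6))"
        unfolding b_def divide_divide_eq_left by (simp only: mult.commute)
      ultimately show ?thesis by simp
    qed
    finally have "1 / real (6 * Suc n + 1) ^ 2 \<le> 1 / (6 * x) - 1 / (6 * real (6 * Suc n + 4))"
      by (simp add: x_def algebra_simps)
    with Suc.IH show ?case by (simp add: x_def)
  qed simp
  also have "\<dots> \<le> 1 / 24" by simp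
  finally show ?thesis .
qed

text \<open>One solution \<open>k0\<close> determines two residue classes, k0 and - 1 - k0, each
  with at most N / q + 1 members below \<open>N\<close>. If q is at least 2 N, then k + k0 + 1 is
  positive and less than q, so the second class contributes nothing and \<open>k0\<close> is the
  only solution.\<close>

lemma card_square_divisible_le:
  fixes f :: "nat \<Rightarrow> nat" and q N :: nat
  assumes q: "q > 0"
    and sym: "\<And>k k'. q dvd f k \<Longrightarrow> q dvd f k' \<Longrightarrow> [k = k'] (mod q) \<or> q dvd k + k' + 1"
  defines "A \<equiv> {k. k < N \<and> q dvd f k}"
  shows "real (card A) \<le> 2 * real N / real q + 1 + (if q < 2 * N then 1 else 0)"
proof (cases "A = {}")
  case False
  then obtain k0 where k0: "k0 \<in> A" by blast
  show ?thesis
  proof (cases "q < 2 * N")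
    case True
    define B where "B a = {k. k < N \<and> k mod q = a}" for a
    have "A \<subseteq> B (k0 mod q) \<union> B ((q - (k0 + 1) mod q) mod q)"
    proof
      fix k assume k: "k \<in> A"
      then have "[k = k0] (mod q) \<or> q dvd k + k0 + 1" using k0 sym by (auto simp: A_def)
      then show "k \<in> B (k0 mod q) \<union> B ((q - (k0 + 1) mod q) mod q)"
      proof
        assume "[k = k0] (mod q)"
        then show ?thesis using k by (simp add: A_def B_def cong_def)
      next
        assume "q dvd k + k0 + 1"
        moreover have "q dvd (q - (k0 + 1) mod q) + (k0 + 1)"
        proof -
          have "(k0 + 1) mod q < q" using q by simp
          then have "(q - (k0 + 1) mod q) + (k0 + 1) = q + (k0 + 1) div q * q"
            using div_mult_mod_eq[of "k0 + 1" q] by linarith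
          then show ?thesis by simp
        qed
        ultimately have "[k + (k0 + 1) = (q - (k0 + 1) mod q) + (k0 + 1)] (mod q)"
          by (simp add: cong_def mod_0_imp_dvd dvd_imp_mod_0 add.assoc)
        then have "[k = q - (k0 + 1) mod q] (mod q)" by (simp only: cong_add_rcancel_nat)
        then show ?thesis using k by (simp add: A_def B_def cong_def)
      qed
    qed
    then have "card A \<le> card (B (k0 mod q) \<union> B ((q - (k0 + 1) mod q) mod q))"
      by (intro card_mono) (auto simp: B_def)
    also have "\<dots> \<le> card (B (k0 mod q)) + card (B ((q - (k0 + 1) mod q) mod q))" by (rule card_Un_le)
    also have "\<dots> \<le> (N div q + 1) + (N div q + 1)"
      unfolding B_def by (intro add_mono card_residue_class_le q)
    finally have "real (card A) \<le> 2 * real (N div q) + 2" by linarith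
    also have "real (N div q) \<le> real N / real q" by (rule of_nat_div_le_of_nat)
    finally show ?thesis using True by simp
  next
    case False
    have "k = k0" if "k \<in> A" for k
    proof -
      have lt: "k < N" "k0 < N" using that k0 by (auto simp: A_def)
      have "\<not> q dvd k + k0 + 1"
        using lt False by (intro nat_dvd_not_less) auto
      then have "[k = k0] (mod q)" using sym that k0 by (auto simp: A_def)
      then show "k = k0" using lt False by (simp add: cong_def)
    qed
    then have "A \<subseteq> {k0}" by blast
    then have "card A \<le> 1" using card_mono[of "{k0}" A] by simp
    then have "real (card A) \<le> 1" by simp
    also have "\<dots> \<le> 2 * real N / real q + 1" by simp
    finally show ?thesis using False by simp
  qed
next
  case True
  then show ?thesis by simp
qed

text \<open>
  The prime \<open>p = 6 i + 1\<close> contributes at most \<open>2 N / p\<^sup>2 + 2\<close> values, and only one if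
  \<open>2 N \<le> p\<^sup>2\<close>, since the two roots of \<open>f\<close> modulo \<open>p\<^sup>2\<close> are exchanged by \<open>k \<mapsto> - 1 - k\<close>. The
  second bound is what makes the contribution of the many large primes smaller than \<open>N\<close>.
\<close>

lemma card_non_squarefree_le:
  fixes f :: "nat \<Rightarrow> nat" and N :: nat and c :: real
  assumes mod6: "\<And>p k. Factorial_Ring.prime p \<Longrightarrow> p \<noteq> 3 \<Longrightarrow> p dvd f k \<Longrightarrow> p mod 6 = 1"
    and sym: "\<And>p k k'. Factorial_Ring.prime p \<Longrightarrow> p \<noteq> 3 \<Longrightarrow> p ^ 2 dvd f k \<Longrightarrow> p ^ 2 dvd f k' \<Longrightarrow>
      [k = k'] (mod p ^ 2) \<or> p ^ 2 dvd k + k' + 1"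
    and pos: "\<And>k. f k > 0" and le: "\<And>k. k < N \<Longrightarrow> real (f k) \<le> (c * N) ^ 2" and c: "c \<ge> 0"
  shows "real (card {k. k < N \<and> (\<exists>p. Factorial_Ring.prime p \<and> p \<noteq> 3 \<and> p ^ 2 dvd f k)})
    \<le> (c / 6 + 1 / 12) * N + sqrt (2 * N)"
proof -
  \<comment> \<open>A prime 6 i + 1 whose square divides a value of at most (c N)^2 is at most c
    N.\<close>
  define I where "I = nat \<lfloor>c * N / 6\<rfloor>"
  define A where "A i = {k. k < N \<and> Factorial_Ring.prime (6 * i + 1) \<and> (6 * i + 1) ^ 2 dvd f k}" for i
  have "{k. k < N \<and> (\<exists>p. Factorial_Ring.prime p \<and> p \<noteq> 3 \<and> p ^ 2 dvd f k)} \<subseteq> (\<Union>i\<in>{1..I}. A i)"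
  proof
    fix k assume "k \<in> {k. k < N \<and> (\<exists>p. Factorial_Ring.prime p \<and> p \<noteq> 3 \<and> p ^ 2 dvd f k)}"
    then obtain p where k: "k < N" and p: "Factorial_Ring.prime p" "p \<noteq> 3" "p ^ 2 dvd f k" by blast
    have "p dvd f k" using p(3) by (metis dvd_mult_left power2_eq_square)
    then have "p mod 6 = 1" using mod6 p by blast
    then obtain i where i: "p = 6 * i + 1" by (metis div_mult_mod_eq mult.commute)
    have "i \<noteq> 0" using p i by (metis add_0 mult_0_right not_prime_1)
    have "p ^ 2 \<le> f k" using p(3) pos by (rule dvd_imp_le)
    then have "real p ^ 2 \<le> (c * N) ^ 2" using le[OF k] by (metis of_nat_le_iff of_nat_power order_trans)
    then have "real p \<le> c * N" by (rule power2_le_imp_le) (use c in simp)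
    then have "real i \<le> c * N / 6" by (simp add: i)
    then have "i \<le> I" unfolding I_def by linarith
    then show "k \<in> (\<Union>i\<in>{1..I}. A i)"
      using \<open>i \<noteq> 0\<close> k p i by (auto simp: A_def intro!: bexI[of _ i])
  qed
  then have "card {k. k < N \<and> (\<exists>p. Factorial_Ring.prime p \<and> p \<noteq> 3 \<and> p ^ 2 dvd f k)} \<le> card (\<Union>i\<in>{1..I}. A i)"
    by (intro card_mono) (auto simp: A_def)
  also have "\<dots> \<le> (\<Sum>i=1..I. card (A i))" by (rule card_UN_le) simp
  finally have "real (card {k. k < N \<and> (\<exists>p. Factorial_Ring.prime p \<and> p \<noteq> 3 \<and> p ^ 2 dvd f k)})
    \<le> real (\<Sum>i=1..I. card (A i))" by (rule of_nat_mono)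
  also have "\<dots> = (\<Sum>i=1..I. real (card (A i)))" by (rule of_nat_sum)
  also have "\<dots> \<le> (\<Sum>i=1..I. 2 * real N / real (6 * i + 1) ^ 2 + 1 + (if (6 * i + 1) ^ 2 < 2 * N then 1 else 0))"
  proof (rule sum_mono)
    fix i assume "i \<in> {1..I}"
    show "real (card (A i)) \<le> 2 * real N / real (6 * i + 1) ^ 2 + 1 + (if (6 * i + 1) ^ 2 < 2 * N then 1 else 0)"
    proof (cases "Factorial_Ring.prime (6 * i + 1)")
      case True
      have "6 * i + 1 \<noteq> 3" by presburger
      then have "real (card {k. k < N \<and> (6 * i + 1) ^ 2 dvd f k})
          \<le> 2 * real N / real ((6 * i + 1) ^ 2) + 1 + (if (6 * i + 1) ^ 2 < 2 * N then 1 else 0)"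
        using True by (intro card_square_divisible_le sym[of "6 * i + 1"]) auto
      then show ?thesis using True by (simp add: A_def)
    next
      case False
      then show ?thesis by (simp add: A_def)
    qed
  qed
  also have "\<dots> = 2 * real N * (\<Sum>i=1..I. 1 / real (6 * i + 1) ^ 2) + real I
      + (\<Sum>i=1..I. if (6 * i + 1) ^ 2 < 2 * N then 1 else 0)"
    by (simp add: sum.distrib sum_distrib_left)
  also have "\<dots> \<le> 2 * real N * (1 / 24) + c * N / 6 + sqrt (2 * N)"
  proof (intro add_mono mult_left_mono sum_inverse_squares_le)
    have "real I = of_int \<lfloor>c * N / 6\<rfloor>" using c by (simp add: I_def)
    also have "\<dots> \<le> c * N / 6" by (rule of_int_floor_le)
    finally show "real I \<le> c * N / 6" .
    have "(\<Sum>i=1..I. if (6 * i + 1) ^ 2 < 2 * N then 1 else 0) = real (card {i\<in>{1..I}. (6 * i + 1) ^ 2 < 2 * N})"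
      by (simp add: sum.If_cases Int_def)
    also have "\<dots> \<le> real (card {1..nat \<lfloor>sqrt (2 * N)\<rfloor>})"
    proof (intro of_nat_mono card_mono subsetI)
      fix i assume "i \<in> {i\<in>{1..I}. (6 * i + 1) ^ 2 < 2 * N}"
      then have i: "i \<ge> 1" "(6 * i + 1) ^ 2 < 2 * N" by auto
      have "i ^ 2 \<le> (6 * i + 1) ^ 2" by (intro power_mono) auto
      then have "i ^ 2 \<le> 2 * N" using i by linarith
      then have "real i ^ 2 \<le> 2 * N" by (metis of_nat_le_iff of_nat_power)
      then have "real i \<le> sqrt (2 * N)" by (intro real_le_rsqrt) simp
      then show "i \<in> {1..nat \<lfloor>sqrt (2 * N)\<rfloor>}" using i by (simp add: le_nat_floor)
    qed simp
    also have "\<dots> \<le> sqrt (2 * N)" by simp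
    finally show "(\<Sum>i=1..I. if (6 * i + 1) ^ 2 < 2 * N then 1 else 0) \<le> sqrt (2 * N)" .
  qed simp
  also have "\<dots> = (c / 6 + 1 / 12) * N + sqrt (2 * N)" by (simp add: algebra_simps)
  finally show ?thesis .
qed

lemma infinite_if_complement_sparse:
  fixes Q :: "nat \<Rightarrow> bool" and \<alpha> :: real
  assumes bound: "\<And>N. real (card {k. k < N \<and> \<not> Q k}) \<le> \<alpha> * N + sqrt (2 * N) + 1" and \<alpha>: "\<alpha> \<le> 19 / 20"
  shows "infinite {k. Q k}"
proof
  assume fin: "finite {k. Q k}"
  define C where "C = card {k. Q k}"
  \<comment> \<open>N = 2 m^2 makes the square root exactly 2 m. The bound then reads 2 m^2 \<le> 20
    C + 40 m + 20, which fails for m = C + 31 because m^2 \<ge> 31 m.\<close>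
  define m where "m = C + 31"
  define N where "N = 2 * m ^ 2"
  have "{..<N} = {k. k < N \<and> Q k} \<union> {k. k < N \<and> \<not> Q k}" by auto
  then have "N \<le> card {k. k < N \<and> Q k} + card {k. k < N \<and> \<not> Q k}"
    by (metis card_Un_le card_lessThan)
  also have "card {k. k < N \<and> Q k} \<le> C" unfolding C_def by (intro card_mono fin) auto
  finally have "real N \<le> real C + real (card {k. k < N \<and> \<not> Q k})" by linarith
  also have "\<dots> \<le> real C + (\<alpha> * N + sqrt (2 * N) + 1)" using bound by simp
  also have "\<alpha> * N \<le> 19 / 20 * real N" using \<alpha> by (intro mult_right_mono) auto
  also have "sqrt (2 * N) = 2 * m"
    by (rule real_sqrt_unique) (auto simp: N_def power2_eq_square)
  finally have "real N \<le> 20 * C + 40 * m + 20" by simp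
  then have "2 * real m ^ 2 \<le> 20 * C + 40 * m + 20" by (simp add: N_def)
  moreover have "real m ^ 2 \<ge> 31 * real m"
    unfolding power2_eq_square by (intro mult_right_mono) (auto simp: m_def)
  ultimately show False by (simp add: m_def)
qed

lemma square_dvd_product_of_two:
  fixes p a b :: int
  assumes p: "Factorial_Ring.prime p" and "p ^ 2 dvd a * b" and no: "\<not> (p dvd a \<and> p dvd b)"
  shows "p ^ 2 dvd a \<or> p ^ 2 dvd b"
proof (cases "p dvd a")
  case True
  then have "Rings.coprime (p ^ 2) b" using no p by (simp add: prime_imp_coprime)
  then show ?thesis using assms(2) by (simp add: coprime_dvd_mult_left_iff)
next
  case False
  then have "Rings.coprime (p ^ 2) a" using p by (simp add: prime_imp_coprime)
  then show ?thesis using assms(2) by (simp add: coprime_dvd_mult_right_iff)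
qed

text \<open>The difference of the two values is c (k - k') (k + k' + 1). If \<open>p\<close> divided
  both factors it would divide 2 k + 1, hence 4 e - c, which is up to the factor - c the
  discriminant of the quadratic. So p^2 divides a single factor.\<close>

lemma quadratic_roots_mod_prime_square:
  fixes p e c k k' :: nat
  assumes p: "Factorial_Ring.prime p" and c: "\<not> p dvd c" and disc: "\<not> p dvd 4 * e - c" "c \<le> 4 * e"
    and k: "p ^ 2 dvd c * k ^ 2 + c * k + e" and k': "p ^ 2 dvd c * k' ^ 2 + c * k' + e"
  shows "[k = k'] (mod p ^ 2) \<or> p ^ 2 dvd k + k' + 1"
proof -
  let ?p = "int p"
  have ip: "Factorial_Ring.prime ?p" using p by simp
  have d: "?p ^ 2 dvd int c * int k ^ 2 + int c * int k + int e" "?p ^ 2 dvd int c * int k' ^ 2 + int c * int k' + int e"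
    using k k' by (metis int_dvd_int_iff of_nat_add of_nat_mult of_nat_power)+
  from dvd_diff[OF this] have "?p ^ 2 dvd int c * ((int k - int k') * (int k + int k' + 1))"
    by (simp add: algebra_simps power2_eq_square)
  moreover have "Rings.coprime (?p ^ 2) (int c)" using ip c by (simp add: prime_imp_coprime)
  ultimately have "?p ^ 2 dvd (int k - int k') * (int k + int k' + 1)"
    by (simp add: coprime_dvd_mult_right_iff)
  moreover have "\<not> (?p dvd int k - int k' \<and> ?p dvd int k + int k' + 1)"
  proof
    assume "?p dvd int k - int k' \<and> ?p dvd int k + int k' + 1"
    then have "?p dvd (int k - int k') + (int k + int k' + 1)" using dvd_add by blast
    then have a: "?p dvd 2 * int k + 1" by simp
    have "?p dvd int c * int k ^ 2 + int c * int k + int e" using d(1) by (metis dvd_mult_left power2_eq_square)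
    then have "?p dvd 4 * (int c * int k ^ 2 + int c * int k + int e) - int c * (2 * int k + 1) * (2 * int k + 1)"
      using a by (intro dvd_diff dvd_mult) auto
    also have "\<dots> = 4 * int e - int c" by (simp add: algebra_simps power2_eq_square)
    also have "\<dots> = int (4 * e - c)" using disc(2) by (simp add: of_nat_diff)
    finally show False using disc(1) by (simp only: int_dvd_int_iff)
  qed
  ultimately have "?p ^ 2 dvd int k - int k' \<or> ?p ^ 2 dvd int k + int k' + 1"
    by (intro square_dvd_product_of_two ip)
  then show ?thesis
  proof
    assume "?p ^ 2 dvd int k - int k'"
    then have "[int k = int k'] (mod int (p ^ 2))" by (simp add: cong_iff_dvd_diff)
    then have "[k = k'] (mod p ^ 2)" by (simp only: cong_int_iff)
    then show ?thesis ..
  next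
    assume "?p ^ 2 dvd int k + int k' + 1"
    then have "int (p ^ 2) dvd int (k + k' + 1)" by (simp add: algebra_simps)
    then have "p ^ 2 dvd k + k' + 1" by (simp only: int_dvd_int_iff)
    then show ?thesis ..
  qed
qed

lemma squarefree_iff_no_prime_square:
  fixes n :: nat
  assumes "n > 0"
  shows "squarefree n \<longleftrightarrow> (\<forall>p. Factorial_Ring.prime p \<longrightarrow> \<not> p ^ 2 dvd n)"
  using assms by (auto simp: squarefree_factorial_semiring)

text \<open>The values are at most (k + 1)^2, so c = 1 in the sieve, with loss 1/6 + 1/12.
  Divisibility by 3 occurs only for k = 1 mod 3 and costs another third, in total 7/12.\<close>

lemma infinite_squarefree_coprime_3:
  "infinite {k :: nat. squarefree (k ^ 2 + k + 1) \<and> \<not> 3 dvd k ^ 2 + k + 1}"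
proof (rule infinite_if_complement_sparse)
  fix N :: nat
  let ?bad = "{k. k < N \<and> (\<exists>p. Factorial_Ring.prime p \<and> p \<noteq> 3 \<and> p ^ 2 dvd k ^ 2 + k + 1)}"
  have "{k. k < N \<and> \<not> (squarefree (k ^ 2 + k + 1) \<and> \<not> 3 dvd k ^ 2 + k + 1)}
      \<subseteq> ?bad \<union> {k. k < N \<and> k mod 3 = 1}"
  proof
    fix k assume k: "k \<in> {k. k < N \<and> \<not> (squarefree (k ^ 2 + k + 1) \<and> \<not> 3 dvd k ^ 2 + k + 1)}"
    have three: "k mod 3 = 1" if "3 dvd k ^ 2 + k + 1"
    proof (rule ccontr)
      assume "k mod 3 \<noteq> 1"
      then have "k = 3 * (k div 3) \<or> k = 3 * (k div 3) + 2" by presburger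
      then consider "k = 3 * (k div 3)" | "k = 3 * (k div 3) + 2" by blast
      then obtain j where "k ^ 2 + k + 1 = 3 * j + 1"
      proof cases
        case 1
        define i where "i = k div 3"
        have "k ^ 2 + k + 1 = 3 * (3 * i ^ 2 + i) + 1"
          using 1 unfolding i_def[symmetric] by (simp add: power2_eq_square algebra_simps)
        then show ?thesis by (rule that)
      next
        case 2
        define i where "i = k div 3"
        have "k ^ 2 + k + 1 = 3 * (3 * i ^ 2 + 5 * i + 2) + 1"
          using 2 unfolding i_def[symmetric] by (simp add: power2_eq_square algebra_simps)
        then show ?thesis by (rule that)
      qed
      with \<open>3 dvd k ^ 2 + k + 1\<close> show False by presburger
    qed
    show "k \<in> ?bad \<union> {k. k < N \<and> k mod 3 = 1}"
    proof (cases "3 dvd k ^ 2 + k + 1")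
      case True then show ?thesis using k three by simp
    next
      case False
      then have "\<not> squarefree (k ^ 2 + k + 1)" using k by blast
      then obtain p where p: "Factorial_Ring.prime p" "p ^ 2 dvd k ^ 2 + k + 1"
        using squarefree_iff_no_prime_square[of "k ^ 2 + k + 1"] by auto
      have "p \<noteq> 3" using p False by (metis dvd_mult_left dvd_trans power2_eq_square)
      then show ?thesis using k p by blast
    qed
  qed
  then have "card {k. k < N \<and> \<not> (squarefree (k ^ 2 + k + 1) \<and> \<not> 3 dvd k ^ 2 + k + 1)}
      \<le> card (?bad \<union> {k. k < N \<and> k mod 3 = 1})" by (intro card_mono) auto
  also have "\<dots> \<le> card ?bad + card {k. k < N \<and> k mod 3 = 1}" by (rule card_Un_le)
  finally have "real (card {k. k < N \<and> \<not> (squarefree (k ^ 2 + k + 1) \<and> \<not> 3 dvd k ^ 2 + k + 1)})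
      \<le> real (card ?bad) + real (card {k. k < N \<and> k mod 3 = 1})" by linarith
  also have "real (card ?bad) \<le> (1 / 6 + 1 / 12) * N + sqrt (2 * N)"
  proof (rule card_non_squarefree_le)
    show "[k = k'] (mod p ^ 2) \<or> p ^ 2 dvd k + k' + 1"
      if "Factorial_Ring.prime p" "p \<noteq> 3" "p ^ 2 dvd k ^ 2 + k + 1" "p ^ 2 dvd k' ^ 2 + k' + 1" for p k k' :: nat
    proof -
      have "\<not> p dvd 1" "\<not> p dvd 4 * 1 - 1"
        using that by (auto simp: numeral_3_eq_3[symmetric] dest: primes_dvd_imp_eq[OF _ prime_nat_3])
      then show ?thesis using quadratic_roots_mod_prime_square[of p 1 1 k k'] that by simp
    qed
    show "real (k ^ 2 + k + 1) \<le> (1 * real N) ^ 2" if "k < N" for k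
    proof -
      have "(k + 1) ^ 2 \<le> N ^ 2" using that by (intro power_mono) auto
      then have "k ^ 2 + k + 1 \<le> N ^ 2" by (simp add: power2_eq_square)
      then show ?thesis by (metis mult_1 of_nat_le_iff of_nat_power)
    qed
  qed (use prime_dvd_quadratic_mod_6 in auto)
  also have "real (card {k. k < N \<and> k mod 3 = 1}) \<le> real N / 3 + 1"
  proof -
    have "real (card {k. k < N \<and> k mod 3 = 1}) \<le> real (N div 3) + 1"
      using card_residue_class_le[of 3 N 1] by linarith
    then show ?thesis using of_nat_div_le_of_nat[of N 3] by simp
  qed
  finally show "real (card {k. k < N \<and> \<not> (squarefree (k ^ 2 + k + 1) \<and> \<not> 3 dvd k ^ 2 + k + 1)})
      \<le> 7 / 12 * real N + sqrt (real (2 * N)) + 1" by (simp add: algebra_simps)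
qed simp

text \<open>
  The prime divisors of \<open>27 k\<^sup>2 + 27 k + 7\<close> are also 1 modulo 6, since
  \<open>3 (27 k\<^sup>2 + 27 k + 7) = m\<^sup>2 + m + 1\<close> for \<open>m = 9 k + 4\<close>. The constant \<open>26 / 5\<close> is slightly
  larger than the square root of 27.
\<close>

lemma infinite_squarefree_27: "infinite {k :: nat. squarefree (27 * k ^ 2 + 27 * k + 7)}"
proof (rule infinite_if_complement_sparse)
  fix N :: nat
  have not3: "\<not> 3 dvd 27 * k ^ 2 + 27 * k + 7" for k :: nat by presburger
  have "{k. k < N \<and> \<not> squarefree (27 * k ^ 2 + 27 * k + 7)}
      = {k. k < N \<and> (\<exists>p. Factorial_Ring.prime p \<and> p \<noteq> 3 \<and> p ^ 2 dvd 27 * k ^ 2 + 27 * k + 7)}"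
    (is "_ = ?bad")
    using not3 by (auto simp: squarefree_iff_no_prime_square) (metis dvd_mult_left power2_eq_square)
  \<comment> \<open>The coefficient is 52/60 + 5/60 = 19/20, exactly the threshold of
    \<open>infinite_if_complement_sparse\<close>.\<close>
  moreover have "real (card ?bad) \<le> ((26 / 5) / 6 + 1 / 12) * N + sqrt (2 * N)"
  proof (rule card_non_squarefree_le)
    show "p mod 6 = 1" if "Factorial_Ring.prime p" "p \<noteq> 3" "p dvd 27 * k ^ 2 + 27 * k + 7" for p k :: nat
    proof -
      have "p dvd 3 * (27 * k ^ 2 + 27 * k + 7)" using that(3) by (rule dvd_mult)
      also have "3 * (27 * k ^ 2 + 27 * k + 7) = (9 * k + 4) ^ 2 + (9 * k + 4) + 1"
        by (simp add: algebra_simps power2_eq_square)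
      finally show ?thesis using that(1,2) by (intro prime_dvd_quadratic_mod_6)
    qed
    show "[k = k'] (mod p ^ 2) \<or> p ^ 2 dvd k + k' + 1"
      if "Factorial_Ring.prime p" "p \<noteq> 3" "p ^ 2 dvd 27 * k ^ 2 + 27 * k + 7" "p ^ 2 dvd 27 * k' ^ 2 + 27 * k' + 7" for p k k' :: nat
    proof -
      have "\<not> p dvd 3 ^ 3"
        using that(1,2) by (metis prime_dvd_power primes_dvd_imp_eq prime_nat_3)
      moreover have "\<not> p dvd 4 * 7 - 27" using that(1) not_prime_1 by auto
      ultimately show ?thesis using quadratic_roots_mod_prime_square[of p 27 7 k k'] that by simp
    qed
    show "real (27 * k ^ 2 + 27 * k + 7) \<le> (26 / 5 * real N) ^ 2" if "k < N" for k
    proof -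
      have "(k + 1) ^ 2 \<le> N ^ 2" using that by (intro power_mono) auto
      then have "27 * k ^ 2 + 27 * k + 7 \<le> 27 * N ^ 2" by (simp add: power2_eq_square)
      then have "real (27 * k ^ 2 + 27 * k + 7) \<le> 27 * real N ^ 2" by (metis of_nat_le_iff of_nat_mult of_nat_numeral of_nat_power)
      also have "\<dots> \<le> (26 / 5 * real N) ^ 2" by (simp add: power_mult_distrib power2_eq_square)
      finally show ?thesis .
    qed
  qed auto
  ultimately show "real (card {k. k < N \<and> \<not> squarefree (27 * k ^ 2 + 27 * k + 7)})
      \<le> 19 / 20 * real N + sqrt (real (2 * N)) + 1" by simp
qed simp

section \<open>The two families\<close>

text \<open>For prime \<open>p\<close>, Eisenstein's condition on f(x + n), whose lower coefficients
  are the three expressions.\<close>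

definition eisenstein_at :: "int \<Rightarrow> int \<Rightarrow> int \<Rightarrow> int \<Rightarrow> int \<Rightarrow> bool" where
  "eisenstein_at u v w p n \<longleftrightarrow> p dvd u + 3 * n \<and> p dvd 3 * n ^ 2 + 2 * u * n + v
     \<and> p dvd n ^ 3 + u * n ^ 2 + v * n + w \<and> \<not> p ^ 2 dvd n ^ 3 + u * n ^ 2 + v * n + w"

lemma eisenstein_imp_no_root:
  assumes p: "Factorial_Ring.prime p" and E: "eisenstein_at u v w p n"
  shows "m ^ 3 + u * m ^ 2 + v * m + w \<noteq> 0"
proof
  assume root: "m ^ 3 + u * m ^ 2 + v * m + w = 0"
  define k where "k = m - n"
  define a where "a = u + 3 * n"
  define b where "b = 3 * n ^ 2 + 2 * u * n + v"
  define c where "c = n ^ 3 + u * n ^ 2 + v * n + w"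
  have E: "p dvd a" "p dvd b" "p dvd c" "\<not> p ^ 2 dvd c"
    using E by (auto simp: eisenstein_at_def a_def b_def c_def)
  have eq: "k ^ 3 + a * k ^ 2 + b * k + c = 0"
    using root by (simp add: k_def a_def b_def c_def algebra_simps power2_eq_square power3_eq_cube)
  have "p dvd - (a * k ^ 2 + b * k + c)" using E by simp
  also have "- (a * k ^ 2 + b * k + c) = k ^ 3" using eq by linarith
  finally have "p dvd k" using p prime_dvd_power by blast
  then obtain k' where k': "k = p * k'" by blast
  obtain a' b' where "a = p * a'" "b = p * b'" using E by blast
  then have "c = p ^ 2 * (- (p * k' ^ 3) - p * a' * k' ^ 2 - b' * k')"
    using eq by (simp add: k' algebra_simps power2_eq_square power3_eq_cube)
  then show False using E(4) by simp
qed

text \<open>The Eisenstein translates do double duty: one of them gives irreducibility, all of them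
  together give monogenicity. The root \<open>d\<close> of the discriminant gives cyclicity, and
  being no unit it supplies a prime.\<close>

lemma monogenic_cyclicI:
  assumes d: "d ^ 2 = cubic_disc u v w" "\<not> is_unit d"
    and local: "\<And>p. Factorial_Ring.prime p \<Longrightarrow> p dvd d \<Longrightarrow> \<exists>n. eisenstein_at u v w p n"
  shows "monogenic [:w, v, u, 1:]" "cyclic_poly [:w, v, u, 1:]"
proof -
  obtain q where q: "Factorial_Ring.prime q" "q dvd d"
    using d(2) prime_divisor_exists[of d] local by (cases "d = 0") (auto intro: that[of 2])
  then obtain n where "eisenstein_at u v w q n" using local by blast
  then have "monic_irreducible [:w, v, u, 1:]"
    unfolding monic_irreducible_cubic_iff using eisenstein_imp_no_root q by blast
  then obtain r s t where "irreducible_cubic u v w r s t" by (rule monic_irreducible_cubicE)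
  then interpret irreducible_cubic u v w r s t .
  show "cyclic_poly [:w, v, u, 1:]" using d(1) by (rule cyclic_if_disc_square)
  show "monogenic [:w, v, u, 1:]"
  proof (rule monogenicI)
    fix p :: int assume p: "Factorial_Ring.prime p" "p dvd disc"
    then have "p dvd d" using d(1) prime_dvd_power by metis
    then show "\<exists>n. p dvd u + 3 * n \<and> p dvd 3 * n ^ 2 + 2 * u * n + v
      \<and> p dvd n ^ 3 + u * n ^ 2 + v * n + w \<and> \<not> p ^ 2 dvd n ^ 3 + u * n ^ 2 + v * n + w"
      using local[OF p(1)] unfolding eisenstein_at_def by blast
  qed
qed

lemma not_prime_square_dvd_if_squarefree:
  assumes "squarefree n" "Factorial_Ring.prime (p :: int)"
  shows "\<not> p ^ 2 dvd int n"
proof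
  assume dvd: "p ^ 2 dvd int n"
  obtain q where q: "p = int q" using prime_ge_0_int[OF assms(2)] nonneg_int_cases by blast
  then have "int (q ^ 2) dvd int n" using dvd by simp
  then have "q ^ 2 dvd n" by (simp only: int_dvd_int_iff)
  then have "is_unit q" using assms(1) by (auto simp: squarefree_def)
  then show False using assms(2) q by simp
qed

lemma not_prime_square_dvd_mult:
  fixes p g b :: int
  assumes p: "Factorial_Ring.prime p" and g: "\<not> p ^ 2 dvd g" and b: "\<not> p dvd b"
  shows "\<not> p ^ 2 dvd g * b"
  using square_dvd_product_of_two[OF p, of g b] g b by (metis dvd_mult_left power2_eq_square)

text \<open>From 4 g = b^2 + 3 the discriminant becomes 81 g^2. A common prime of g and b divides 3,
  which is excluded, so squarefree g makes the polynomial Eisenstein at the primes of g; only 3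
  requires a translation.\<close>

lemma linear_trinomial_family_1:
  fixes k :: nat
  defines "g \<equiv> int (k ^ 2 + k + 1)" and "b \<equiv> 2 * int k + 1"
  assumes sf: "squarefree (k ^ 2 + k + 1)" and three: "\<not> 3 dvd k ^ 2 + k + 1"
  shows "(9 * g) ^ 2 = cubic_disc 0 (- 3 * g) (g * b)"
    and "monogenic (linear_trinomial (- 3 * g) (g * b))" "cyclic_poly (linear_trinomial (- 3 * g) (g * b))"
proof -
  have gb: "4 * g = b ^ 2 + 3" by (simp add: g_def b_def algebra_simps power2_eq_square)
  have g3: "\<not> 3 dvd g" using three unfolding g_def by presburger
  have disc: "cubic_disc 0 (- 3 * g) (g * b) = 27 * g ^ 2 * (4 * g - b ^ 2)"
    by (simp add: cubic_disc_def algebra_simps power2_eq_square power3_eq_cube)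
  show d: "(9 * g) ^ 2 = cubic_disc 0 (- 3 * g) (g * b)"
    unfolding disc gb by (simp add: power_mult_distrib)
  have u: "\<not> is_unit (9 * g)" unfolding zdvd1_eq by presburger
  have local: "\<exists>n. eisenstein_at 0 (- 3 * g) (g * b) p n" if p: "Factorial_Ring.prime p" "p dvd 9 * g" for p
  proof (cases "p = 3")
    case True
    have b3: "\<not> 3 dvd b"
    proof
      assume "3 dvd b"
      then have "3 dvd 4 * g" unfolding gb by (simp add: power2_eq_square)
      with g3 show False by presburger
    qed
    \<comment> \<open>The polynomial takes the value b (4 g - b^2) = 3 b at - b, divisible by 3
      exactly once.\<close>
    have eq: "(- b) ^ 3 + - 3 * g * (- b) + g * b = 3 * b"
    proof -
      have "(- b) ^ 3 + - 3 * g * (- b) + g * b = b * (4 * g - b ^ 2)"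
        by (simp add: algebra_simps power2_eq_square power3_eq_cube)
      then show ?thesis unfolding gb by simp
    qed
    have "eisenstein_at 0 (- 3 * g) (g * b) 3 (- b)"
      unfolding eisenstein_at_def mult_zero_left add_0_right mult_zero_right eq using b3 by auto
    then show ?thesis unfolding True by blast
  next
    case False
    have "p dvd g"
    proof (rule ccontr)
      assume "\<not> p dvd g"
      then have "p dvd 3 ^ 2" using p by (simp add: prime_dvd_mult_iff)
      then have "p dvd 3" using p(1) prime_dvd_power by blast
      then have "p = 3" using p(1) by (intro primes_dvd_imp_eq) auto
      with False show False ..
    qed
    have "\<not> p dvd b"
    proof
      assume "p dvd b"
      then have "p dvd 4 * g - b ^ 2" using \<open>p dvd g\<close> by (simp add: power2_eq_square)
      then have "p dvd 3" unfolding gb by simp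
      then have "p = 3" using p(1) by (intro primes_dvd_imp_eq) auto
      with False show False ..
    qed
    then have "\<not> p ^ 2 dvd g * b"
      using not_prime_square_dvd_mult not_prime_square_dvd_if_squarefree[OF sf p(1)] p(1) unfolding g_def by blast
    then have "eisenstein_at 0 (- 3 * g) (g * b) p 0"
      using \<open>p dvd g\<close> by (simp add: eisenstein_at_def)
    then show ?thesis by blast
  qed
  show "monogenic (linear_trinomial (- 3 * g) (g * b))" "cyclic_poly (linear_trinomial (- 3 * g) (g * b))"
    unfolding linear_trinomial_def using monogenic_cyclicI[OF d u local] by blast+
qed

text \<open>Here 4 g - 27 b^2 = 1, so g and b are coprime and every prime of the discriminant g^2
  divides g; the polynomial is Eisenstein there as it stands.\<close>

lemma linear_trinomial_family_2:
  fixes k :: nat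
  defines "g \<equiv> int (27 * k ^ 2 + 27 * k + 7)" and "b \<equiv> 2 * int k + 1"
  assumes sf: "squarefree (27 * k ^ 2 + 27 * k + 7)"
  shows "g ^ 2 = cubic_disc 0 (- g) (g * b)"
    and "monogenic (linear_trinomial (- g) (g * b))" "cyclic_poly (linear_trinomial (- g) (g * b))"
proof -
  have gb: "4 * g = 27 * b ^ 2 + 1" by (simp add: g_def b_def algebra_simps power2_eq_square)
  have disc: "cubic_disc 0 (- g) (g * b) = g ^ 2 * (4 * g - 27 * b ^ 2)"
    by (simp add: cubic_disc_def algebra_simps power2_eq_square power3_eq_cube)
  show d: "g ^ 2 = cubic_disc 0 (- g) (g * b)"
    unfolding disc gb by simp
  have "g \<ge> 7" by (simp add: g_def)
  then have u: "\<not> is_unit g" by simp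
  have local: "\<exists>n. eisenstein_at 0 (- g) (g * b) p n" if p: "Factorial_Ring.prime p" "p dvd g" for p
  proof -
    have "\<not> p dvd b"
    proof
      assume "p dvd b"
      then have "p dvd 4 * g - 27 * b ^ 2" using p(2) by (simp add: power2_eq_square)
      then have "is_unit p" unfolding gb by (simp only: add_diff_cancel_left')
      then show False using p(1) not_prime_unit by blast
    qed
    then have "\<not> p ^ 2 dvd g * b"
      using not_prime_square_dvd_mult not_prime_square_dvd_if_squarefree[OF sf p(1)] p(1) unfolding g_def by blast
    then have "eisenstein_at 0 (- g) (g * b) p 0"
      using p(2) by (simp add: eisenstein_at_def)
    then show ?thesis by blast
  qed
  show "monogenic (linear_trinomial (- g) (g * b))" "cyclic_poly (linear_trinomial (- g) (g * b))"
    unfolding linear_trinomial_def using monogenic_cyclicI[OF d u local] by blast+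
qed

section \<open>Trinomials without a linear term\<close>

lemma quadratic_trinomial_monogenic_cyclic:
  assumes "(A, B) \<in> {(3, -3), (-3, 3), (-3, 1), (3, -1 :: int)}"
  shows "monogenic (quadratic_trinomial A B)" "cyclic_poly (quadratic_trinomial A B)"
proof -
  have d: "9 ^ 2 = cubic_disc A 0 B" using assms by (auto simp: cubic_disc_def)
  \<comment> \<open>All four discriminants are 81. The translation is by the triple root modulo 3: 0
    if B = 3 or -3, and - B if B = 1 or -1.\<close>
  have "eisenstein_at 3 0 (-3) 3 0" "eisenstein_at (-3) 0 3 3 0" "eisenstein_at (-3) 0 1 3 (-1)" "eisenstein_at 3 0 (-1) 3 1"
    by (simp_all add: eisenstein_at_def)
  then have E: "\<exists>n. eisenstein_at A 0 B 3 n" using assms by blast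
  have local: "\<exists>n. eisenstein_at A 0 B p n" if p: "Factorial_Ring.prime p" "p dvd 9" for p
  proof -
    have "p dvd 3 ^ 2" using p(2) by simp
    then have "p dvd 3" using p(1) prime_dvd_power by blast
    then have "p = 3" using p(1) by (intro primes_dvd_imp_eq) auto
    then show ?thesis using E by simp
  qed
  show "monogenic (quadratic_trinomial A B)" "cyclic_poly (quadratic_trinomial A B)"
    unfolding quadratic_trinomial_def using monogenic_cyclicI[OF d _ local] by auto
qed

lemma splitting_field_subsetI:
  assumes "complex_roots f \<subseteq> splitting_field g"
  shows "splitting_field f \<subseteq> splitting_field g"
  using assms unfolding splitting_field_def by (intro adjoin_rat_least rat_subfield_adjoin_rat)

text \<open>In the listed order, z goes to - z - 1, z - 1, 1 / z and - 1 / z, carrying the roots of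
  the trinomial to those of x^3 - 3 x + 1; all four maps are rational and invertible.\<close>

lemma quadratic_trinomial_equivalent:
  assumes "(A, B) \<in> {(3, -3), (-3, 3), (-3, 1), (3, -1 :: int)}"
  shows "equivalent (quadratic_trinomial A B) (linear_trinomial (-3) 1)"
proof -
  let ?f = "quadratic_trinomial A B" and ?g = "linear_trinomial (-3) 1"
  interpret F: rat_subfield "splitting_field ?f" unfolding splitting_field_def by (rule rat_subfield_adjoin_rat)
  interpret G: rat_subfield "splitting_field ?g" unfolding splitting_field_def by (rule rat_subfield_adjoin_rat)
  have f: "z \<in> complex_roots ?f \<longleftrightarrow> z ^ 3 + of_int A * z ^ 2 + of_int B = 0" for z
    unfolding complex_roots_def quadratic_trinomial_def mem_Collect_eq poly_cubic by simp
  have g: "z \<in> complex_roots ?g \<longleftrightarrow> z ^ 3 - 3 * z + 1 = 0" for z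
    unfolding complex_roots_def linear_trinomial_def mem_Collect_eq poly_cubic by simp
  have F: "z \<in> splitting_field ?f" if "z ^ 3 + of_int A * z ^ 2 + of_int B = 0" for z
    using that adjoin_rat_superset f unfolding splitting_field_def by blast
  have G: "z \<in> splitting_field ?g" if "z ^ 3 - 3 * z + 1 = 0" for z
    using that adjoin_rat_superset g unfolding splitting_field_def by blast
  have inv: "inverse z ^ 3 + a * inverse z ^ 2 + b * inverse z + c = 0"
    if "1 + a * z + b * z ^ 2 + c * z ^ 3 = 0" "z \<noteq> 0" for a b c z :: complex
  proof -
    have "inverse z ^ 3 + a * inverse z ^ 2 + b * inverse z + c
        = (1 + a * z + b * z ^ 2 + c * z ^ 3) * inverse z ^ 3"
      using that(2) by (simp add: field_simps power2_eq_square power3_eq_cube)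
    then show ?thesis using that(1) by simp
  qed
  have "complex_roots ?f \<subseteq> splitting_field ?g"
  proof
    fix z assume "z \<in> complex_roots ?f"
    then have z: "z ^ 3 + of_int A * z ^ 2 + of_int B = 0" by (simp add: f)
    consider "A = 3" "B = -3" | "A = -3" "B = 3" | "A = -3" "B = 1" | "A = 3" "B = -1" using assms by auto
    then show "z \<in> splitting_field ?g"
    proof cases
      case 1
      then have "(- z - 1) ^ 3 - 3 * (- z - 1) + 1 = 0"
        using z by (simp add: algebra_simps power2_eq_square power3_eq_cube)
      then have "- (- z - 1) - 1 \<in> splitting_field ?g" by (intro G.closed G)
      then show ?thesis by simp
    next
      case 2
      then have "(z - 1) ^ 3 - 3 * (z - 1) + 1 = 0"
        using z by (simp add: algebra_simps power2_eq_square power3_eq_cube)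
      then have "(z - 1) + 1 \<in> splitting_field ?g" by (intro G.closed G)
      then show ?thesis by simp
    next
      case 3
      then have "z \<noteq> 0" using z by auto
      moreover have "1 + 0 * z + (- 3) * z ^ 2 + 1 * z ^ 3 = 0" using z 3 by (simp add: algebra_simps)
      ultimately have "inverse z ^ 3 + 0 * inverse z ^ 2 + (- 3) * inverse z + 1 = 0" by (rule inv[rotated])
      then have "inverse (inverse z) \<in> splitting_field ?g" by (intro G.closed G) simp
      then show ?thesis by simp
    next
      case 4
      then have "z \<noteq> 0" using z by auto
      moreover have "1 + 0 * (- z) + (- 3) * (- z) ^ 2 + 1 * (- z) ^ 3 = 0" using z 4 by (simp add: algebra_simps)
      ultimately have "inverse (- z) ^ 3 + 0 * inverse (- z) ^ 2 + (- 3) * inverse (- z) + 1 = 0"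
        by (intro inv) auto
      then have "- inverse (inverse (- z)) \<in> splitting_field ?g" by (intro G.closed G) simp
      then show ?thesis by simp
    qed
  qed
  moreover have "complex_roots ?g \<subseteq> splitting_field ?f"
  proof
    fix z assume "z \<in> complex_roots ?g"
    then have z: "z ^ 3 - 3 * z + 1 = 0" by (simp add: g)
    then have z0: "z \<noteq> 0" by auto
    consider "A = 3" "B = -3" | "A = -3" "B = 3" | "A = -3" "B = 1" | "A = 3" "B = -1" using assms by auto
    then show "z \<in> splitting_field ?f"
    proof cases
      case 1
      then have "(- z - 1) ^ 3 + of_int A * (- z - 1) ^ 2 + of_int B = 0"
        using z by (simp add: algebra_simps power2_eq_square power3_eq_cube)
      then have "- (- z - 1) - 1 \<in> splitting_field ?f" by (intro F.closed F)
      then show ?thesis by simp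
    next
      case 2
      then have "(z + 1) ^ 3 + of_int A * (z + 1) ^ 2 + of_int B = 0"
        using z by (simp add: algebra_simps power2_eq_square power3_eq_cube)
      then have "(z + 1) - 1 \<in> splitting_field ?f" by (intro F.closed F)
      then show ?thesis by simp
    next
      case 3
      have "1 + (- 3) * z + 0 * z ^ 2 + 1 * z ^ 3 = 0" using z by (simp add: algebra_simps)
      then have "inverse z ^ 3 + (- 3) * inverse z ^ 2 + 0 * inverse z + 1 = 0" using z0 by (rule inv)
      then have "inverse (inverse z) \<in> splitting_field ?f" using 3 by (intro F.closed F) simp
      then show ?thesis by simp
    next
      case 4
      have "1 + 3 * (- z) + 0 * (- z) ^ 2 + (- 1) * (- z) ^ 3 = 0" using z by (simp add: algebra_simps)
      then have "inverse (- z) ^ 3 + 3 * inverse (- z) ^ 2 + 0 * inverse (- z) + - 1 = 0"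
        using z0 by (intro inv) auto
      then have "- inverse (inverse (- z)) \<in> splitting_field ?f" using 4 by (intro F.closed F) simp
      then show ?thesis by simp
    qed
  qed
  ultimately show ?thesis unfolding equivalent_def by (intro equalityI splitting_field_subsetI)
qed

section \<open>Classification of the trinomials x^3 + A x^2 + B\<close>

lemma dvd_if_prime_dvd:
  fixes a b :: int
  assumes b: "b \<noteq> 0" and a: "a \<noteq> 0"
    and "\<And>p. Factorial_Ring.prime p \<Longrightarrow> p dvd b \<Longrightarrow> p dvd a \<and> \<not> p ^ 2 dvd b"
  shows "b dvd a"
proof (rule multiplicity_le_imp_dvd[OF b])
  fix p :: int assume p: "Factorial_Ring.prime p"
  show "multiplicity p b \<le> multiplicity p a"
  proof (cases "p dvd b")
    case True
    then have "p dvd a" "\<not> p ^ 2 dvd b" using assms(3) p by blast+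
    have "\<not> 2 \<le> multiplicity p b"
      using \<open>\<not> p ^ 2 dvd b\<close> multiplicity_dvd'[of 2 p b] by blast
    moreover have "1 \<le> multiplicity p a"
      using \<open>p dvd a\<close> a p by (intro multiplicity_geI) auto
    ultimately show ?thesis by linarith
  next
    case False
    then show ?thesis by (simp add: not_dvd_imp_multiplicity_0)
  qed
qed

lemma square_eq_power_9:
  fixes y :: int
  assumes "y \<noteq> 0" and "\<And>q. Factorial_Ring.prime q \<Longrightarrow> q dvd y \<Longrightarrow> q = 3"
  obtains j where "y ^ 2 = 9 ^ j"
proof -
  define j where "j = multiplicity 3 y"
  obtain z where z: "y = 3 ^ j * z" "\<not> 3 dvd z"
    using multiplicity_decompose'[of y 3] assms(1) unfolding j_def by auto
  have "is_unit z"
  proof (rule ccontr)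
    assume "\<not> is_unit z"
    moreover have "z \<noteq> 0" using z by auto
    ultimately obtain q where "Factorial_Ring.prime q" "q dvd z" using prime_divisor_exists by blast
    then show False using assms(2)[of q] z by auto
  qed
  then have "\<bar>z\<bar> = 1" by (simp only: zdvd1_eq)
  then have "z ^ 2 = 1" by (metis power2_abs power_one)
  then have "y ^ 2 = (3 ^ j) ^ 2" unfolding z(1) power_mult_distrib by simp
  also have "\<dots> = (3 ^ 2) ^ j" by (metis mult.commute power_mult)
  finally show ?thesis using that by simp
qed

lemma quadratic_trinomial_classification:
  fixes A B :: int
  assumes AB: "A * B \<noteq> 0" and mono: "monogenic (quadratic_trinomial A B)"
    and cyc: "cyclic_poly (quadratic_trinomial A B)"
  shows "(A, B) \<in> {(3, -3), (-3, 3), (-3, 1), (3, -1)}"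
proof -
  have "monic_irreducible [:B, 0, A, 1:]" using mono by (simp add: monogenic_def quadratic_trinomial_def)
  then obtain r s t where "irreducible_cubic A 0 B r s t" by (rule monic_irreducible_cubicE)
  then interpret irreducible_cubic A 0 B r s t .
  have mono: "monogenic [:B, 0, A, 1:]" using mono by (simp add: quadratic_trinomial_def)
  have dedekind: "\<not> p ^ 2 dvd n ^ 3 + A * n ^ 2 + B" if "p > 1" "p dvd 3 * n ^ 2 + 2 * A * n" for p n
  proof
    assume "p ^ 2 dvd n ^ 3 + A * n ^ 2 + B"
    then show False using not_monogenic[of p n] that mono by simp
  qed
  have "Coset.order (galois_group (splitting_field [:B, 0, A, 1:])) = 3"
    using cyc by (simp add: cyclic_poly_def quadratic_trinomial_def)
  then obtain d where d: "d ^ 2 = cubic_disc A 0 B" using disc_square_if_order_3 by blast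
  then have disc: "d ^ 2 = - B * (4 * A ^ 3 + 27 * B)"
    by (simp add: cubic_disc_def algebra_simps power2_eq_square)
  have A0: "A \<noteq> 0" and B0: "B \<noteq> 0" using AB by auto
  \<comment> \<open>The derivative vanishes at 0, so Dedekind's criterion applies there for every
    prime.\<close>
  have B_sf: "\<not> p ^ 2 dvd B" if "Factorial_Ring.prime p" for p
    using dedekind[of p 0] prime_gt_1_int[OF that] by simp
  \<comment> \<open>If \<open>p\<close> divides B but not A, then an odd \<open>p\<close> divides B
    (4 A^3 + 27 B) exactly once, so that the discriminant is no square. For p = 2 both terms of 4
    A^3 + 27 B are even, and a quarter of the discriminant is 3 modulo 4.\<close>
  have B_dvd: "p dvd A" if p: "Factorial_Ring.prime p" "p dvd B" for p
  proof (rule ccontr)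
    assume A: "\<not> p dvd A"
    obtain b where b: "B = p * b" using p(2) by blast
    have pb: "\<not> p dvd b" using B_sf[OF p(1)] unfolding b power2_eq_square by auto
    have p0: "p \<noteq> 0" using p by auto
    have "p dvd d ^ 2" unfolding disc b by simp
    then have "p dvd d" using p(1) prime_dvd_power by blast
    then obtain e where e: "d = p * e" by blast
    have "p * (p * e ^ 2) = p * (- b * (4 * A ^ 3 + 27 * (p * b)))"
      using disc unfolding e b by (simp add: power2_eq_square algebra_simps)
    then have eq: "p * e ^ 2 = - b * (4 * A ^ 3 + 27 * (p * b))"
      by (rule mult_left_cancel[OF p0, THEN iffD1])
    then have "4 * (A ^ 3 * b) = p * (- (e ^ 2) - 27 * b ^ 2)"
      by (simp add: algebra_simps power2_eq_square)
    then have "p dvd 4 * (A ^ 3 * b)" by simp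
    then have "p dvd 4" using pb A p(1) by (auto simp: prime_dvd_mult_iff dest: prime_dvd_power)
    then have "p dvd 2 ^ 2" by simp
    then have "p dvd 2" using p(1) prime_dvd_power by blast
    then have p2: "p = 2" using p(1) by (intro primes_dvd_imp_eq) auto
    have "odd (A ^ 3)" "odd b" using A pb p2 by simp_all
    obtain h where h: "A ^ 3 = 2 * h + 1" using \<open>odd (A ^ 3)\<close> by (rule oddE)
    obtain c where c: "b = 2 * c + 1" using \<open>odd b\<close> by (rule oddE)
    have "e ^ 2 = - b * (2 * A ^ 3 + 27 * b)" using eq by (simp add: p2 algebra_simps)
    also have "\<dots> = 4 * (- (2 * h * c + 27 * c ^ 2 + 28 * c + h) - 8) + 3"
      unfolding h c by (simp add: algebra_simps power2_eq_square)
    finally have e2: "e ^ 2 = 4 * (- (2 * h * c + 27 * c ^ 2 + 28 * c + h) - 8) + 3" .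
    show False
    proof (cases "even e")
      case True
      then obtain f where "e = 2 * f" by blast
      then have "4 * f ^ 2 = 4 * (- (2 * h * c + 27 * c ^ 2 + 28 * c + h) - 8) + 3" using e2 by (simp add: power2_eq_square)
      then show False by presburger
    next
      case False
      then obtain f where "e = 2 * f + 1" by (elim oddE)
      then have "4 * (f ^ 2 + f) + 1 = 4 * (- (2 * h * c + 27 * c ^ 2 + 28 * c + h) - 8) + 3"
        using e2 by (simp add: power2_eq_square algebra_simps)
      then show False by presburger
    qed
  qed
  have "B dvd A" using dvd_if_prime_dvd[OF B0 A0] B_dvd B_sf by blast
  then obtain m where "A = B * m" by blast
  define n where "n = - m"
  have A: "A = - (B * n)" using \<open>A = B * m\<close> by (simp add: n_def)
  have "d ^ 2 = B ^ 2 * (4 * B ^ 2 * n ^ 3 - 27)"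
    unfolding disc A by (simp add: algebra_simps power2_eq_square power3_eq_cube)
  moreover from this have "B dvd d" by (metis dvd_triv_left pow_divides_pow_iff zero_less_numeral)
  then obtain y where "d = B * y" by blast
  ultimately have y: "y ^ 2 + 27 = 4 * (B ^ 2 * n ^ 3)" using B0 by (simp add: power_mult_distrib)
  have "odd y"
  proof
    assume "even y"
    then obtain f where "y = 2 * f" by blast
    then have "4 * f ^ 2 + 27 = 4 * (B ^ 2 * n ^ 3)" using y by (simp add: power2_eq_square)
    then show False by presburger
  qed
  have only3: "q = 3" if q: "Factorial_Ring.prime q" "q dvd y" for q
  proof (rule ccontr)
    assume q3: "q \<noteq> 3"
    have "\<not> q dvd 3" using q q3 primes_dvd_imp_eq[of q 3] by auto
    then have cop: "Rings.coprime (q ^ 2) 3" using q(1) by (simp add: prime_imp_coprime)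
    obtain i k where ik: "i * q ^ 2 + k * 3 = 1"
      using bezout_int[of "q ^ 2" 3] cop by auto
    \<comment> \<open>The other critical point - 2 A / 3, taken modulo q^2. There 27 times the
      polynomial is 4 A^3 + 27 B = - B y^2, so a prime divisor of \<open>y\<close> other than 3
      violates Dedekind's criterion.\<close>
    define \<nu> where "\<nu> = - 2 * A * k"
    have \<nu>: "3 * \<nu> + 2 * A = 2 * A * i * q ^ 2"
    proof -
      have "3 * \<nu> + 2 * A = 2 * A * (1 - k * 3)" by (simp add: \<nu>_def algebra_simps)
      also have "1 - k * 3 = i * q ^ 2" using ik by linarith
      finally show ?thesis by (simp add: mult.assoc)
    qed
    have "3 * \<nu> ^ 2 + 2 * A * \<nu> = \<nu> * (3 * \<nu> + 2 * A)" by (simp add: algebra_simps power2_eq_square)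
    then have "q dvd 3 * \<nu> ^ 2 + 2 * A * \<nu>" unfolding \<nu> by (simp add: power2_eq_square)
    moreover have "q > 1" using q(1) by (rule prime_gt_1_int)
    ultimately have "\<not> q ^ 2 dvd \<nu> ^ 3 + A * \<nu> ^ 2 + B" by (intro dedekind)
    moreover have "q ^ 2 dvd 27 * (\<nu> ^ 3 + A * \<nu> ^ 2 + B)"
    proof -
      have "27 * (\<nu> ^ 3 + A * \<nu> ^ 2 + B)
          = (3 * \<nu> + 2 * A) * (9 * \<nu> ^ 2 + 3 * A * \<nu> - 2 * A ^ 2) + (4 * A ^ 3 + 27 * B)"
        by (simp add: algebra_simps power2_eq_square power3_eq_cube)
      also have "4 * A ^ 3 + 27 * B = - B * (4 * (B ^ 2 * n ^ 3) - 27)"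
        unfolding A by (simp add: algebra_simps power2_eq_square power3_eq_cube)
      also have "\<dots> = - B * y ^ 2" unfolding y[symmetric] by simp
      finally show ?thesis
        unfolding \<nu> using q(2) by (auto intro!: dvd_diff dvd_add dvd_mult dvd_mult2)
    qed
    moreover have "Rings.coprime (q ^ 2) 27"
    proof -
      have "Rings.coprime (q ^ 2) (3 ^ 3)"
        unfolding coprime_power_right_iff[of _ 3] using cop by (rule disjI1)
      also have "(3 :: int) ^ 3 = 27" by simp
      finally show ?thesis .
    qed
    ultimately show False using coprime_dvd_mult_right_iff by blast
  qed
  obtain j where j: "y ^ 2 = 9 ^ j"
    using square_eq_power_9[of y] only3 \<open>odd y\<close> by auto
  have n_pos: "n > 0"
  proof (rule ccontr)
    assume "\<not> n > 0"
    then have "n ^ 3 \<le> 0" by (simp add: power3_eq_cube mult_nonneg_nonpos)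
    then have "B ^ 2 * n ^ 3 \<le> 0" by (simp add: mult_nonneg_nonpos)
    then show False using y by (smt (verit) zero_le_power2)
  qed
  have B2: "B ^ 2 \<ge> 1" using B0 by (smt (verit) power2_less_eq_zero_iff)
  have n3: "n ^ 3 \<le> B ^ 2 * n ^ 3" using B2 n_pos by (simp add: mult_le_cancel_right1)
  have n_bound: "n < c" if "B ^ 2 * n ^ 3 < c ^ 3" "c > 0" for c :: int
    using n3 that n_pos by (meson linorder_not_le order_less_le_trans power_mono less_imp_le order_trans)
  have small_square: "B ^ 2 \<noteq> 7" "B ^ 2 \<noteq> 27"
  proof -
    have small: "\<bar>B\<bar> \<le> c \<longleftrightarrow> B ^ 2 \<le> c ^ 2" and large: "c \<le> \<bar>B\<bar> \<longleftrightarrow> c ^ 2 \<le> B ^ 2" if "c \<ge> 0" for c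
      using abs_le_square_iff[of B c] abs_le_square_iff[of c B] that by simp_all
    show "B ^ 2 \<noteq> 7" using small[of 2] large[of 3] by auto
    show "B ^ 2 \<noteq> 27" using small[of 5] large[of 6] by auto
  qed
  \<comment> \<open>B^2 n^3 is 7, 9 or 27 for j = 0, 1, 2. The first has no solution, the second
    gives n = 1 and B = 3 or -3, the third n = 3 and B = 1 or -1.\<close>
  have "j = 0 \<or> j = 1 \<or> j = 2 \<or> j = (j - 3) + 3" by linarith
  then consider "j = 0" | "j = 1" | "j = 2" | i where "j = i + 3" by blast
  then show ?thesis
  proof cases
    case 1
    then have eq: "B ^ 2 * n ^ 3 = 7" using y j by simp
    then have "n < 2" by (intro n_bound) auto
    then have "n = 1" using n_pos by simp
    then show ?thesis using eq small_square by simp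
  next
    case 2
    then have eq: "B ^ 2 * n ^ 3 = 9" using y j by simp
    then have "n < 3" by (intro n_bound) auto
    then have "n = 1 \<or> n = 2" using n_pos by auto
    then have n: "n = 1" and "B ^ 2 = 3 ^ 2" using eq by auto presburger+
    then have "B = 3 \<or> B = -3" using power2_eq_iff by blast
    then show ?thesis using n A by auto
  next
    case 3
    then have eq: "B ^ 2 * n ^ 3 = 27" using y j by simp
    then have "n < 4" by (intro n_bound) auto
    then have "n = 1 \<or> n = 2 \<or> n = 3" using n_pos by auto
    then have n: "n = 3" and "B ^ 2 = 1 ^ 2" using eq small_square by auto presburger+
    then have "B = 1 \<or> B = -1" using power2_eq_iff by blast
    then show ?thesis using n A by auto
  next
    case 4
    \<comment> \<open>The right-hand side is now 27 times a unit modulo 27. This forces 3 to divide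
      \<open>n\<close> and not \<open>B\<close>, and then Dedekind's criterion at 3 fails at - B,
      the triple root modulo 3.\<close>
    define z :: int where "z = 9 ^ i"
    have eq: "4 * (B ^ 2 * n ^ 3) = 27 * (27 * z + 1)"
      using y j by (simp add: 4 z_def power_add)
    have three: "Factorial_Ring.prime (3 :: int)" by simp
    have three_dvd: "3 dvd n" if "3 dvd b ^ 2 * n ^ 3" "\<not> 3 dvd b" for b :: int
      using that prime_dvd_mult_iff[OF three] prime_dvd_power[OF three] by blast
    have B3: "\<not> 3 dvd B"
    proof
      assume "3 dvd B"
      then obtain b where b: "B = 3 * b" by blast
      have b3: "\<not> 3 dvd b" using B_sf[OF three] unfolding b power2_eq_square by auto
      have "4 * (b ^ 2 * n ^ 3) = 3 * (27 * z + 1)" using eq by (simp add: b power_mult_distrib)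
      then have "3 dvd 4 * (b ^ 2 * n ^ 3)" by simp
      then have "3 dvd b ^ 2 * n ^ 3" by presburger
      then have "3 dvd n" using b3 by (rule three_dvd)
      then obtain l where "n = 3 * l" by blast
      then have "9 * (4 * (b ^ 2 * l ^ 3)) = 27 * z + 1"
        using \<open>4 * (b ^ 2 * n ^ 3) = 3 * (27 * z + 1)\<close> by (simp add: power_mult_distrib)
      then show False by presburger
    qed
    have "3 dvd 4 * (B ^ 2 * n ^ 3)" unfolding eq by simp
    then have "3 dvd B ^ 2 * n ^ 3" by presburger
    then have "3 dvd n" using B3 by (rule three_dvd)
    then obtain l where l: "n = 3 * l" by blast
    have eq: "4 * (B ^ 2 * l ^ 3) = 27 * z + 1" using eq by (simp add: l power_mult_distrib)
    \<comment> \<open>Since 4 B^2 l^3 = 1 mod 27, only l = 1 mod 3 is consistent. In that case l^3 =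
      1 mod 9, and the expression is congruent to 1 - 4 B^2, hence to 0, modulo 9.\<close>
    have "9 dvd 1 - B ^ 2 * (1 + 3 * l)"
    proof -
      define h where "h = l div 3"
      have "l = 3 * h \<or> l = 3 * h + 1 \<or> l = 3 * h + 2" unfolding h_def by presburger
      then consider "l = 3 * h" | "l = 3 * h + 1" | "l = 3 * h + 2" by blast
      then show ?thesis
      proof cases
        case 1
        then have "27 * (4 * (B ^ 2 * h ^ 3)) = 27 * z + 1" using eq by (simp add: power_mult_distrib)
        then show ?thesis by presburger
      next
        case 2
        define c where "c = B ^ 2 * (3 * h ^ 3 + 3 * h ^ 2 + h)"
        have "l ^ 3 = 9 * (3 * h ^ 3 + 3 * h ^ 2 + h) + 1"
          unfolding 2 by (simp add: algebra_simps power2_eq_square power3_eq_cube)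
        then have "4 * B ^ 2 = 27 * z + 1 - 36 * c"
          using eq by (simp add: c_def algebra_simps)
        moreover have "1 - B ^ 2 * (1 + 3 * l) = 1 - 4 * B ^ 2 - 9 * (h * B ^ 2)"
          unfolding 2 by (simp add: algebra_simps)
        ultimately have "1 - B ^ 2 * (1 + 3 * l) = 9 * (4 * c - 3 * z - h * B ^ 2)" by simp
        then show ?thesis by simp
      next
        case 3
        define c where "c = B ^ 2 * (3 * h ^ 3 + 6 * h ^ 2 + 4 * h)"
        have "l ^ 3 = 9 * (3 * h ^ 3 + 6 * h ^ 2 + 4 * h) + 8"
          unfolding 3 by (simp add: algebra_simps power2_eq_square power3_eq_cube)
        then have B2: "32 * B ^ 2 = 27 * z + 1 - 36 * c"
          using eq by (simp add: c_def algebra_simps)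
        define f where "f = B div 3"
        have "B = 3 * f + 1 \<or> B = 3 * f + 2" using B3 unfolding f_def by presburger
        then have "B ^ 2 = 3 * (3 * f ^ 2 + 2 * f) + 1 \<or> B ^ 2 = 3 * (3 * f ^ 2 + 4 * f + 1) + 1"
          by (auto simp: power2_eq_square algebra_simps)
        then obtain m where m: "B ^ 2 = 3 * m + 1" by blast
        have "31 = 3 * (9 * z - 12 * c - 32 * m)" using B2 unfolding m by simp
        then have "3 dvd (31 :: int)" by (metis dvd_triv_left)
        then show ?thesis by simp
      qed
    qed
    then have "3 ^ 2 dvd B * (1 - B ^ 2 * (1 + 3 * l))" by simp
    also have "B * (1 - B ^ 2 * (1 + 3 * l)) = (- B) ^ 3 + A * (- B) ^ 2 + B"
      unfolding A l by (simp add: algebra_simps power2_eq_square power3_eq_cube)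
    finally have "3 ^ 2 dvd (- B) ^ 3 + A * (- B) ^ 2 + B" .
    moreover have "3 dvd 3 * (- B) ^ 2 + 2 * A * (- B)"
      unfolding A l by (auto simp: algebra_simps intro!: dvd_add)
    ultimately show ?thesis using dedekind[of 3 "- B"] by simp
  qed
qed

theorem theorem1p1:
  shows "\<exists>F1 F2 :: int poly set.
    (single_parameter_family F1 \<and> infinite F1
     \<and> single_parameter_family F2 \<and> infinite F2
     \<and> (\<forall>f \<in> F1 \<union> F2. (\<exists>A B. A * B \<noteq> 0 \<and> f = linear_trinomial A B) \<and> monogenic f \<and> cyclic_poly f)
     \<and> F1 \<inter> F2 = {}
     \<and> (\<forall>f \<in> F1 \<union> F2. \<forall>g \<in> F1 \<union> F2. f \<noteq> g \<longrightarrow> \<not> equivalent f g))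
    \<and> ({f. (\<exists>A B. A * B \<noteq> 0 \<and> f = quadratic_trinomial A B) \<and> monogenic f \<and> cyclic_poly f}
         = {quadratic_trinomial 3 (-3), quadratic_trinomial (-3) 3,
            quadratic_trinomial (-3) 1, quadratic_trinomial 3 (-1)}
       \<and> linear_trinomial (-3) 1 \<in> F1
       \<and> (\<forall>f \<in> {quadratic_trinomial 3 (-3), quadratic_trinomial (-3) 3,
                 quadratic_trinomial (-3) 1, quadratic_trinomial 3 (-1)}.
            equivalent f (linear_trinomial (-3) 1)))"
proof -
  define g1 g2 :: "nat \<Rightarrow> nat" where "g1 k = k ^ 2 + k + 1" and "g2 k = 27 * k ^ 2 + 27 * k + 7" for k
  \<comment> \<open>The parameter is a natural number on purpose: k and - 1 - k give the same g and
    opposite b, hence negated roots and equivalent polynomials.\<close>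
  define f1 where "f1 k = linear_trinomial (- 3 * int (g1 k)) (int (g1 k) * (2 * int k + 1))" for k
  define f2 where "f2 k = linear_trinomial (- int (g2 k)) (int (g2 k) * (2 * int k + 1))" for k
  define S1 S2 where "S1 = {k. squarefree (g1 k) \<and> \<not> 3 dvd g1 k}" and "S2 = {k. squarefree (g2 k)}"
  define F1 F2 where "F1 = f1 ` S1" and "F2 = f2 ` S2"
  have pos: "g1 k > 0" "g2 k > 0" for k by (simp_all add: g1_def g2_def)
  have "strict_mono g1" "strict_mono g2"
    by (auto simp: strict_mono_Suc_iff g1_def g2_def power2_eq_square)
  then have inj: "inj g1" "inj g2" by (auto dest: strict_mono_imp_inj_on)
  have fam1: "single_parameter_family F1"
    unfolding single_parameter_family_def
  proof (intro exI)
    have "f1 k = linear_trinomial (poly [:-3, -3, -3:] (int k)) (poly [:1, 3, 3, 2:] (int k))" for k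
      by (simp add: f1_def g1_def algebra_simps power2_eq_square)
    then show "F1 = (\<lambda>k. linear_trinomial (poly [:-3, -3, -3:] k) (poly [:1, 3, 3, 2:] k)) ` int ` S1"
      unfolding F1_def image_image by simp
  qed
  have fam2: "single_parameter_family F2"
    unfolding single_parameter_family_def
  proof (intro exI)
    have "f2 k = linear_trinomial (poly [:-7, -27, -27:] (int k)) (poly [:7, 41, 81, 54:] (int k))" for k
      by (simp add: f2_def g2_def algebra_simps power2_eq_square)
    then show "F2 = (\<lambda>k. linear_trinomial (poly [:-7, -27, -27:] k) (poly [:7, 41, 81, 54:] k)) ` int ` S2"
      unfolding F2_def image_image by simp
  qed
  have "g1 k = g1 l" if "f1 k = f1 l" for k l
    using that by (simp add: f1_def linear_trinomial_def)
  then have inj_f1: "inj f1" using inj(1) by (meson injD injI)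
  have "g2 k = g2 l" if "f2 k = f2 l" for k l
    using that by (simp add: f2_def linear_trinomial_def)
  then have inj_f2: "inj f2" using inj(2) by (meson injD injI)
  have inf: "infinite F1" "infinite F2"
    unfolding F1_def F2_def S1_def S2_def
    using infinite_squarefree_coprime_3 infinite_squarefree_27 inj_on_subset[OF inj_f1] inj_on_subset[OF inj_f2]
    by (simp_all add: g1_def g2_def finite_image_iff)
  have props1: "(9 * int (g1 k)) ^ 2 = cubic_disc 0 (- 3 * int (g1 k)) (int (g1 k) * (2 * int k + 1))"
    "monogenic (f1 k)" "cyclic_poly (f1 k)" if "k \<in> S1" for k
    using linear_trinomial_family_1[of k] that unfolding S1_def f1_def g1_def by auto
  have props2: "(int (g2 k)) ^ 2 = cubic_disc 0 (- int (g2 k)) (int (g2 k) * (2 * int k + 1))"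
    "monogenic (f2 k)" "cyclic_poly (f2 k)" if "k \<in> S2" for k
    using linear_trinomial_family_2[of k] that unfolding S2_def f2_def g2_def by auto
  have nonzero: "\<exists>A B. A * B \<noteq> 0 \<and> f = linear_trinomial A B" if "f \<in> F1 \<union> F2" for f
  proof -
    have "- 3 * int (g1 k) * (int (g1 k) * (2 * int k + 1)) \<noteq> 0" "- int (g2 k) * (int (g2 k) * (2 * int k + 1)) \<noteq> 0" for k
      using pos[of k] by auto
    with that show ?thesis unfolding F1_def F2_def f1_def f2_def by blast
  qed
  have eq11: "f1 k = f1 l" if "k \<in> S1" "l \<in> S1" "equivalent (f1 k) (f1 l)" for k l
  proof -
    have "(9 * int (g1 k)) ^ 2 = (9 * int (g1 l)) ^ 2"
      using disc_eq_if_equivalent[OF _ _ props1(1)[OF that(1)] props1(1)[OF that(2)]] that(3)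
        props1[OF that(1)] props1[OF that(2)]
      unfolding f1_def linear_trinomial_def by simp
    then have "9 * int (g1 k) = 9 * int (g1 l)" by (rule power2_eq_imp_eq) simp_all
    then have "k = l" using inj(1) by (auto dest: injD)
    then show ?thesis by simp
  qed
  have eq22: "f2 k = f2 l" if "k \<in> S2" "l \<in> S2" "equivalent (f2 k) (f2 l)" for k l
  proof -
    have "int (g2 k) ^ 2 = int (g2 l) ^ 2"
      using disc_eq_if_equivalent[OF _ _ props2(1)[OF that(1)] props2(1)[OF that(2)]] that(3)
        props2[OF that(1)] props2[OF that(2)]
      unfolding f2_def linear_trinomial_def by simp
    then have "int (g2 k) = int (g2 l)" by (rule power2_eq_imp_eq) simp_all
    then have "k = l" using inj(2) by (auto dest: injD)
    then show ?thesis by simp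
  qed
  have ne12: "\<not> equivalent (f1 k) (f2 l)" if "k \<in> S1" "l \<in> S2" for k l
  proof
    assume eq: "equivalent (f1 k) (f2 l)"
    have "(9 * int (g1 k)) ^ 2 = int (g2 l) ^ 2"
      using disc_eq_if_equivalent[OF _ _ props1(1)[OF that(1)] props2(1)[OF that(2)]] eq
        props1[OF that(1)] props2[OF that(2)]
      unfolding f1_def f2_def linear_trinomial_def by simp
    then have "9 * int (g1 k) = int (g2 l)" by (rule power2_eq_imp_eq) simp_all
    \<comment> \<open>The right-hand side is 7 modulo 9; the prime 3 ramifies throughout the first
      family and never in the second.\<close>
    then have "9 * g1 k = 27 * l ^ 2 + 27 * l + 7" unfolding g2_def by linarith
    then show False by presburger
  qed
  have sym: "equivalent f g \<Longrightarrow> equivalent g f" and refl: "equivalent f f" for f g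
    by (simp_all add: equivalent_def)
  have disjoint: "F1 \<inter> F2 = {}" using ne12 refl unfolding F1_def F2_def by fastforce
  have distinct: "f = g" if "f \<in> F1 \<union> F2" "g \<in> F1 \<union> F2" "equivalent f g" for f g
    using that eq11 eq22 ne12 sym unfolding F1_def F2_def by blast
  \<comment> \<open>The member with k = 0, where g = b = 1.\<close>
  have T: "linear_trinomial (-3) 1 \<in> F1"
    unfolding F1_def by (rule image_eqI[of _ _ 0]) (simp_all add: f1_def S1_def g1_def)
  have four: "{f. (\<exists>A B. A * B \<noteq> 0 \<and> f = quadratic_trinomial A B) \<and> monogenic f \<and> cyclic_poly f}
      = {quadratic_trinomial 3 (-3), quadratic_trinomial (-3) 3,
         quadratic_trinomial (-3) 1, quadratic_trinomial 3 (-1)}" (is "?L = ?R")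
  proof
    show "?L \<subseteq> ?R" using quadratic_trinomial_classification by fastforce
    have "quadratic_trinomial A B \<in> ?L" if "(A, B) \<in> {(3, -3), (-3, 3), (-3, 1), (3, -1 :: int)}" for A B
    proof -
      have "A * B \<noteq> 0" using that by auto
      then show ?thesis using quadratic_trinomial_monogenic_cyclic[OF that] by blast
    qed
    then show "?R \<subseteq> ?L" by blast
  qed
  have mc: "monogenic f" "cyclic_poly f" if "f \<in> F1 \<union> F2" for f
    using that props1 props2 unfolding F1_def F2_def by auto
  have equiv: "\<forall>f \<in> ?R. equivalent f (linear_trinomial (-3) 1)"
    using quadratic_trinomial_equivalent by blast
  show ?thesis
  proof (intro exI conjI)
    show "single_parameter_family F1" "infinite F1" "single_parameter_family F2" "infinite F2"
      by (fact fam1 fam2 inf)+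
    show "\<forall>f \<in> F1 \<union> F2. (\<exists>A B. A * B \<noteq> 0 \<and> f = linear_trinomial A B) \<and> monogenic f \<and> cyclic_poly f"
      using nonzero mc by blast
    show "F1 \<inter> F2 = {}" by (fact disjoint)
    show "\<forall>f \<in> F1 \<union> F2. \<forall>g \<in> F1 \<union> F2. f \<noteq> g \<longrightarrow> \<not> equivalent f g"
      using distinct by blast
  qed (fact four T equiv)+
qed

end
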